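(* Assume that $u_0\in BV([0,1])$ satisfies the zero mean condition $\int_0^1 u_0\,dx=0$, and that $\lambda=\Delta t/\Delta x$ satisfies the CFL condition, i.e. $\Delta t\le c_f\,\Delta x$ with $c_f$ a constant depending on $f$ (through $F$) such that every map $\Psi_j$ is non-decreasing in each of its arguments. Let $\{\Delta x_k\}_{k\ge 1}$ be a sequence of mesh sizes with $\Delta x_k\to0$ and let $u\in C([0,T];L^1((0,1)))$ be such that the finite volume approximations satisfy $u_{\Delta x_k}\to u$ in $C([0,T];L^1((0,1)))$, i.e. $\sup_{t\in[0,T]}\|u_{\Delta x_k}(t,\cdot)-u(t,\cdot)\|_{L^1((0,1))}\to 0$. Then $u=\lim_{k\to\infty}u_{\Delta x_k}$ is an entropy solution, with initial data $u_0$, of the periodic Ostrovsky-Hunter equation $u_t+f(x,u)_x=P[u]$ on $(0,T)\times(0,1)$.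
   Context: Equation. Let $T>0$. The problem is $$u_t+f(x,u)_x=P[u],\quad x\in(0,1),\ t\in(0,T);\qquad u(0,x)=u_0(x);\qquad u(t,0)=u(t,1),$$ with $P[u](t,x)=\int_0^x u(t,y)\,dy-\int_0^1\int_0^y u(t,z)\,dz\,dy$. The flux $f=f(x,u)$ is twice continuously differentiable and $1$-periodic in $x$; functions of $x\in[0,1]$ are extended $1$-periodically. $f_x(x,u)$ denotes the partial derivative with respect to the first variable. Entropy solution. Let $\Pi_T=[0,T]\times[0,1]$, $\operatorname{sign}(0)=0$, $\eta(u,k)=|u-k|$ and $q(x,u,k)=\operatorname{sign}(u-k)(f(x,u)-f(x,k))$. A function $u\in C([0,T];L^1((0,1)))\cap L^\infty(\Pi_T)$ with $u(0,\cdot)=u_0$ is an entropy solution if for all constants $k\in\mathbb{R}$ and all non-negative smooth test functions $\varphi(t,x)$ that are $1$-periodic in $x$, $$\int_{\Pi_T}\Big(\eta(u,k)\varphi_t+q(x,u,k)\varphi_x-\operatorname{sign}(u-k)f_x(x,k)\varphi+\operatorname{sign}(u-k)P[u]\varphi\Big)dx\,dt-\int_0^1\eta(u(t,x),k)\varphi(t,x)\,dx\Big|_{t=0}^{t=T}\ge0 .$$ Scheme. Let $N,M$ be positive integers, $\Delta x=1/N$, $\Delta t=T/(M+1)$, $\lambda=\Delta t/\Delta x$, $x_{j+1/2}=j\Delta x$ ($j=0,\dots,N$), $t^n=n\Delta t$, $I_j=[x_{j-1/2},x_{j+1/2})$, $I^n=[t^n,t^{n+1})$, $I^n_j=I^n\times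 I_j$. Let $F(x,u,v)$ be a numerical flux, $1$-periodic in $x$, non-decreasing in $u$, non-increasing in $v$, consistent ($F(x,u,u)=f(x,u)$), differentiable in $x$, with $F$ and $F_x$ Lipschitz continuous in $u$ and $v$. For $n\ge0$, $j=1,\dots,N$, set $$u^{n+1}_j=u^n_j-\lambda\big(F^n_{j+1/2}-F^n_{j-1/2}\big)+\Delta t\,P^n_j,\qquad F^n_{j+1/2}=F(x_{j+1/2},u^n_j,u^n_{j+1}),$$ with $u^n_0=u^n_N$, $u^n_{N+1}=u^n_1$, $$P^n_j=\Delta x\Big(\sum_{i=1}^{j-1}u^n_i+\tfrac12u^n_j\Big)-(\Delta x)^2\sum_{\ell=1}^N\Big(\sum_{i=1}^{\ell-1}u^n_i+\tfrac12u^n_\ell\Big),\qquad u^0_j=\frac1{\Delta x}\int_{I_j}u_0(x)\,dx .$$ The monotonicity maps are $\Psi_j(u,v,w)=u$-, $v$-, $w$-functions $\Psi_j(u,v,w)=v-\lambda\big(F(x_{j+1/2},v,w)-F(x_{j-1/2},u,v)\big)$. The approximation is $u_{\Delta x}(t,x)=u^n_j$ for $(t,x)\in I^n_j$. *)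

theory Defs
  imports "HOL-Analysis.Analysis"
begin

(* Continuity of all directional derivatives amounts, in finite dimensions, to continuity of the
   Frechet derivative. *)
fun C_k :: "nat \<Rightarrow> ('a::euclidean_space \<Rightarrow> real) \<Rightarrow> bool" where
  "C_k 0 g \<longleftrightarrow> continuous_on UNIV g"
| "C_k (Suc n) g \<longleftrightarrow>
     (\<forall>x. g differentiable (at x)) \<and> (\<forall>v. C_k n (\<lambda>x. frechet_derivative g (at x) v))"

definition smooth :: "('a::euclidean_space \<Rightarrow> real) \<Rightarrow> bool" where
  "smooth g \<longleftrightarrow> (\<forall>n. C_k n g)"

definition bounded_variation_on :: "real \<Rightarrow> real \<Rightarrow> (real \<Rightarrow> real) \<Rightarrow> bool" where
  "bounded_variation_on a b v \<longleftrightarrow>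
     (\<exists>C. \<forall>(n::nat) (s::nat \<Rightarrow> real).
        (\<forall>i\<le>n. s i \<in> {a..b}) \<and> (\<forall>i<n. s i \<le> s (Suc i)) \<longrightarrow>
        (\<Sum>i<n. \<bar>v (s (Suc i)) - v (s i)\<bar>) \<le> C)"

(* The space BV([a,b]) of functions modulo null sets: some representative has bounded
   pointwise variation. *)
definition BV :: "real \<Rightarrow> real \<Rightarrow> (real \<Rightarrow> real) \<Rightarrow> bool" where
  "BV a b u0 \<longleftrightarrow>
     (\<exists>v. bounded_variation_on a b v \<and> (AE x in lebesgue. x \<in> {a..b} \<longrightarrow> u0 x = v x))"

definition L1_dist :: "(real \<Rightarrow> real) \<Rightarrow> (real \<Rightarrow> real) \<Rightarrow> real" where
  "L1_dist v w = (LINT x:{0<..<1}|lebesgue. \<bar>v x - w x\<bar>)"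

definition Pi_T :: "real \<Rightarrow> (real \<times> real) set" where
  "Pi_T T = {0..T} \<times> {0..1}"

(* C([0,T]; L1((0,1))), for functions u(t,x) given pointwise.  Measurability of every u(t,.) does
   not imply joint measurability, so the latter is part of the definition; every continuous curve
   in L1 has a jointly measurable representative. *)
definition C_L1 :: "real \<Rightarrow> (real \<Rightarrow> real \<Rightarrow> real) set" where
  "C_L1 T = {u.
     set_borel_measurable lebesgue (Pi_T T) (\<lambda>(t, x). u t x) \<and>
     (\<forall>t\<in>{0..T}. set_integrable lebesgue {0<..<1} (u t)) \<and>
     (\<forall>t\<in>{0..T}. ((\<lambda>s. L1_dist (u s) (u t)) \<longlongrightarrow> 0) (at t within {0..T}))}"

definition L_infinity :: "real \<Rightarrow> (real \<Rightarrow> real \<Rightarrow> real) set" where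
  "L_infinity T = {u.
     set_borel_measurable lebesgue (Pi_T T) (\<lambda>(t, x). u t x) \<and>
     (\<exists>C. AE (t, x) in lebesgue. (t, x) \<in> Pi_T T \<longrightarrow> \<bar>u t x\<bar> \<le> C)}"

definition P_op :: "(real \<Rightarrow> real \<Rightarrow> real) \<Rightarrow> real \<Rightarrow> real \<Rightarrow> real" where
  "P_op u t x = (LINT y:{0..x}|lebesgue. u t y)
              - (LINT y:{0..1}|lebesgue. (LINT z:{0..y}|lebesgue. u t z))"

definition eta :: "real \<Rightarrow> real \<Rightarrow> real" where
  "eta v k = \<bar>v - k\<bar>"

definition entropy_flux :: "(real \<Rightarrow> real \<Rightarrow> real) \<Rightarrow> real \<Rightarrow> real \<Rightarrow> real \<Rightarrow> real" where
  "entropy_flux f x v k = sgn (v - k) * (f x v - f x k)"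

(* Smooth functions on the closed strip [0,T] x R are restrictions of smooth functions on the
   plane; non-negativity is required on the strip only. *)
definition test_function :: "real \<Rightarrow> (real \<Rightarrow> real \<Rightarrow> real) \<Rightarrow> bool" where
  "test_function T \<phi> \<longleftrightarrow>
     smooth (\<lambda>(t, x). \<phi> t x) \<and> (\<forall>t x. \<phi> t (x + 1) = \<phi> t x) \<and> (\<forall>t\<in>{0..T}. \<forall>x. 0 \<le> \<phi> t x)"

definition entropy_solution ::
  "real \<Rightarrow> (real \<Rightarrow> real \<Rightarrow> real) \<Rightarrow> (real \<Rightarrow> real) \<Rightarrow> (real \<Rightarrow> real \<Rightarrow> real) \<Rightarrow> bool" where
  "entropy_solution T f u0 u \<longleftrightarrow>
     u \<in> C_L1 T \<inter> L_infinity T \<and>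
     (AE x in lebesgue. x \<in> {0<..<1} \<longrightarrow> u 0 x = u0 x) \<and>
     (\<forall>k \<phi>. test_function T \<phi> \<longrightarrow>
        set_lebesgue_integral lebesgue (Pi_T T) (\<lambda>(t, x).
            eta (u t x) k * deriv (\<lambda>s. \<phi> s x) t
          + entropy_flux f x (u t x) k * deriv (\<lambda>y. \<phi> t y) x
          - sgn (u t x - k) * deriv (\<lambda>y. f y k) x * \<phi> t x
          + sgn (u t x - k) * P_op u t x * \<phi> t x)
        - ((LINT x:{0..1}|lebesgue. eta (u T x) k * \<phi> T x)
           - (LINT x:{0..1}|lebesgue. eta (u 0 x) k * \<phi> 0 x)) \<ge> 0)"

definition numerical_flux ::
  "(real \<Rightarrow> real \<Rightarrow> real) \<Rightarrow> (real \<Rightarrow> real \<Rightarrow> real \<Rightarrow> real) \<Rightarrow> bool" where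
  "numerical_flux f F \<longleftrightarrow>
     (\<forall>x u v. F (x + 1) u v = F x u v) \<and>
     (\<forall>x v. mono (\<lambda>u. F x u v)) \<and>
     (\<forall>x u. antimono (\<lambda>v. F x u v)) \<and>
     (\<forall>x u. F x u u = f x u) \<and>
     (\<forall>x u v. (\<lambda>y. F y u v) differentiable (at x)) \<and>
     (\<exists>L. \<forall>x. L-lipschitz_on UNIV (\<lambda>(u, v). F x u v)) \<and>
     (\<exists>L. \<forall>x. L-lipschitz_on UNIV (\<lambda>(u, v). deriv (\<lambda>y. F y u v) x))"

definition mesh_dx :: "nat \<Rightarrow> real" where
  "mesh_dx N = 1 / real N"

definition mesh_dt :: "real \<Rightarrow> nat \<Rightarrow> real" where
  "mesh_dt T M = T / (real M + 1)"

definition mesh_ratio :: "real \<Rightarrow> nat \<Rightarrow> nat \<Rightarrow> real" where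
  "mesh_ratio T N M = mesh_dt T M / mesh_dx N"

(* x_half N j is the right end point x_{j+1/2} of the cell I_j; for j \<ge> 1 its left end point
   x_{j-1/2} is x_half N (j - 1). *)
definition x_half :: "nat \<Rightarrow> nat \<Rightarrow> real" where
  "x_half N j = real j * mesh_dx N"

(* Grid functions live on the indices 1..N; this adds the ghost values at 0 and N + 1. *)
definition periodic_ext :: "nat \<Rightarrow> (nat \<Rightarrow> real) \<Rightarrow> nat \<Rightarrow> real" where
  "periodic_ext N v j = (if j = 0 then v N else if j = N + 1 then v 1 else v j)"

definition num_flux ::
  "(real \<Rightarrow> real \<Rightarrow> real \<Rightarrow> real) \<Rightarrow> nat \<Rightarrow> (nat \<Rightarrow> real) \<Rightarrow> nat \<Rightarrow> real" where
  "num_flux F N v j = F (x_half N j) (periodic_ext N v j) (periodic_ext N v (j + 1))"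

definition P_disc :: "nat \<Rightarrow> (nat \<Rightarrow> real) \<Rightarrow> nat \<Rightarrow> real" where
  "P_disc N v j =
     mesh_dx N * ((\<Sum>i=1..<j. v i) + v j / 2)
     - (mesh_dx N)\<^sup>2 * (\<Sum>l=1..N. (\<Sum>i=1..<l. v i) + v l / 2)"

(* Only the entries with index j in 1..N are meaningful. *)
primrec scheme ::
  "(real \<Rightarrow> real \<Rightarrow> real \<Rightarrow> real) \<Rightarrow> (real \<Rightarrow> real) \<Rightarrow> real \<Rightarrow> nat \<Rightarrow> nat \<Rightarrow> nat \<Rightarrow> nat \<Rightarrow> real"
where
  "scheme F u0 T N M 0 =
     (\<lambda>j. 1 / mesh_dx N * (LINT x:{x_half N (j - 1)..<x_half N j}|lebesgue. u0 x))"
| "scheme F u0 T N M (Suc n) =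
     (\<lambda>j. scheme F u0 T N M n j
        - mesh_ratio T N M *
            (num_flux F N (scheme F u0 T N M n) j - num_flux F N (scheme F u0 T N M n) (j - 1))
        + mesh_dt T M * P_disc N (scheme F u0 T N M n) j)"

(* For t \<ge> 0 and 0 \<le> x < 1 the floors select the unique n and j with (t,x) in I^n x I_j. *)
definition fv_approx ::
  "(real \<Rightarrow> real \<Rightarrow> real \<Rightarrow> real) \<Rightarrow> (real \<Rightarrow> real) \<Rightarrow> real \<Rightarrow> nat \<Rightarrow> nat \<Rightarrow> real \<Rightarrow> real \<Rightarrow> real" where
  "fv_approx F u0 T N M t x =
     scheme F u0 T N M (nat \<lfloor>t / mesh_dt T M\<rfloor>) (nat \<lfloor>x / mesh_dx N\<rfloor> + 1)"

definition Psi ::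
  "(real \<Rightarrow> real \<Rightarrow> real \<Rightarrow> real) \<Rightarrow> real \<Rightarrow> nat \<Rightarrow> nat \<Rightarrow> real \<Rightarrow> real \<Rightarrow> real \<Rightarrow> real" where
  "Psi F r N j u v w = v - r * (F (x_half N j) v w - F (x_half N (j - 1)) u v)"

definition CFL_condition ::
  "(real \<Rightarrow> real \<Rightarrow> real \<Rightarrow> real) \<Rightarrow> real \<Rightarrow> real \<Rightarrow> nat \<Rightarrow> nat \<Rightarrow> bool" where
  "CFL_condition F c_f T N M \<longleftrightarrow>
     mesh_dt T M \<le> c_f * mesh_dx N \<and>
     (\<forall>j\<in>{1..N}.
        (\<forall>v w. mono (\<lambda>u. Psi F (mesh_ratio T N M) N j u v w)) \<and>
        (\<forall>u w. mono (\<lambda>v. Psi F (mesh_ratio T N M) N j u v w)) \<and>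
        (\<forall>u v. mono (\<lambda>w. Psi F (mesh_ratio T N M) N j u v w)))"

end

theory Submission
  imports Defs
begin

text \<open>
  A monotone conservative scheme satisfies a discrete form of Kruzkov's entropy inequality, cell by
  cell, and this inequality survives the limit of vanishing mesh size.

  For a level \<open>\<kappa>\<close>, compare the scheme started from \<open>u\<^sup>n\<close> with the scheme started from the
  constant \<open>\<kappa>\<close>. Monotonicity of the maps \<open>\<Psi>\<^sub>j\<close> squeezes both results between the images of
  \<open>max u\<^sup>n \<kappa>\<close> and \<open>min u\<^sup>n \<kappa>\<close>, whose difference is \<open>\<bar>u\<^sup>n - \<kappa>\<bar>\<close> plus a flux difference
  (lemma \<open>cell_entropy_inequality\<close>). Multiplication by a sampled test function and summation by
  parts in time and space turn this into one inequality for integrals of step functions over the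
  strip (\<open>discrete_entropy_inequality\<close>, \<open>discrete_entropy_balance\<close>). Monotonicity, with constants
  as barriers and a discrete Gronwall argument, also bounds the scheme uniformly
  (\<open>scheme_bounded\<close>).

  The step functions in that inequality depend on \<open>u\<^sup>n\<close> in the cell, on \<open>u\<^sup>n\<close> in the right
  neighbour cell and on \<open>u\<^sup>n\<^sup>+\<^sup>1\<close>. All three converge to \<open>u\<close> in \<open>L\<^sup>1\<close> at every time: the first by
  assumption, the second because a cyclic shift by one cell is harmless in \<open>L\<^sup>1\<close>
  (\<open>cyclic_shift_tendsto\<close>), the third because \<open>u\<close> is continuous in time (\<open>L1_lim_next\<close>). One
  subsequence therefore converges almost everywhere for all three (\<open>common_ae_subsequence\<close>). The
  discrete nonlocal term converges at every point (\<open>P_disc_lim\<close>), which also yields the joint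
  measurability of \<open>P_op u\<close>. Bounded convergence then gives the entropy inequality.

  The only discontinuity is that of the sign: the limit of \<open>sgn (u\<^sup>n\<^sup>+\<^sup>1 - \<kappa>)\<close> is not determined
  where \<open>u = \<kappa>\<close>. For all but countably many \<open>\<kappa>\<close> this set is null, and the inequality follows
  (\<open>entropy_balance_nonneg_generic\<close>). An arbitrary level is approached by such generic levels
  from above and from below at once: on \<open>{u = \<kappa>}\<close> the two signs are \<open>-1\<close> and \<open>1\<close>, and their
  mean is \<open>sgn 0 = 0\<close> (\<open>entropy_balance_nonneg\<close>).

  Finally, the cell averages of a function of bounded variation differ from it in \<open>L\<^sup>1\<close> by at
  most the mesh size times its variation (\<open>BV_cell_averages\<close>), so \<open>u\<close> has the initial data
  \<open>u0\<close>.
\<close>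

section \<open>Partial derivatives and difference quotients\<close>

lemma C_k_continuous:
  assumes "C_k n g" shows "continuous_on UNIV g"
proof (cases n)
  case (Suc m)
  then have "\<And>x. g differentiable (at x)" using assms by simp
  then show ?thesis
    by (simp add: continuous_on_eq_continuous_within differentiable_imp_continuous_within)
qed (use assms in simp)

lemma
  fixes g :: "real \<Rightarrow> real \<Rightarrow> real"
  assumes "C_k (Suc n) (\<lambda>(t, x). g t x)"
  shows C_k_partial_fst: "((\<lambda>s. g s x) has_real_derivative deriv (\<lambda>s. g s x) t) (at t)"
    and C_k_continuous_partial_fst: "continuous_on UNIV (\<lambda>(t, x). deriv (\<lambda>s. g s x) t)"
    and C_k_partial_snd: "((\<lambda>y. g t y) has_real_derivative deriv (\<lambda>y. g t y) x) (at x)"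
    and C_k_continuous_partial_snd: "continuous_on UNIV (\<lambda>(t, x). deriv (\<lambda>y. g t y) x)"
proof -
  let ?G = "\<lambda>(t, x). g t x"
  let ?D = "\<lambda>p. frechet_derivative ?G (at p)"
  have D: "(?G has_derivative ?D p) (at p)" for p
    using assms frechet_derivative_works[of ?G] by (cases p) auto
  have lin: "?D p (c *\<^sub>R v) = c * ?D p v" for p c v
    using linear_scale[OF has_derivative_linear[OF D]] by simp
  have fst: "((\<lambda>s. g s x) has_real_derivative ?D (t, x) (1, 0)) (at t)" for t x
  proof -
    have "((\<lambda>s. (s, x)) has_derivative (\<lambda>h. (h, 0))) (at t)"
      by (auto intro!: derivative_eq_intros)
    from has_derivative_compose[OF this D[of "(t, x)"]]
    have "((\<lambda>s. g s x) has_derivative (\<lambda>h. ?D (t, x) (h, 0))) (at t)" by simp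
    moreover have "(\<lambda>h. ?D (t, x) (h, 0)) = (*) (?D (t, x) (1, 0))"
    proof
      fix h :: real
      have "(h, 0) = h *\<^sub>R ((1, 0) :: real \<times> real)" by simp
      then show "?D (t, x) (h, 0) = ?D (t, x) (1, 0) * h" by (metis lin mult.commute)
    qed
    ultimately show ?thesis unfolding has_field_derivative_def by simp
  qed
  have snd: "((\<lambda>y. g t y) has_real_derivative ?D (t, x) (0, 1)) (at x)" for t x
  proof -
    have "((\<lambda>y. (t, y)) has_derivative (\<lambda>h. (0, h))) (at x)"
      by (auto intro!: derivative_eq_intros)
    from has_derivative_compose[OF this D[of "(t, x)"]]
    have "((\<lambda>y. g t y) has_derivative (\<lambda>h. ?D (t, x) (0, h))) (at x)" by simp
    moreover have "(\<lambda>h. ?D (t, x) (0, h)) = (*) (?D (t, x) (0, 1))"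
    proof
      fix h :: real
      have "(0, h) = h *\<^sub>R ((0, 1) :: real \<times> real)" by simp
      then show "?D (t, x) (0, h) = ?D (t, x) (0, 1) * h" by (metis lin mult.commute)
    qed
    ultimately show ?thesis unfolding has_field_derivative_def by simp
  qed
  have cont: "continuous_on UNIV (\<lambda>p. ?D p v)" for v
    using assms by (intro C_k_continuous[of n]) (cases v, auto)
  show "((\<lambda>s. g s x) has_real_derivative deriv (\<lambda>s. g s x) t) (at t)"
    "((\<lambda>y. g t y) has_real_derivative deriv (\<lambda>y. g t y) x) (at x)"
    using fst[of x t] snd[of t x] DERIV_imp_deriv by metis+
  have "(\<lambda>(t, x). deriv (\<lambda>s. g s x) t) = (\<lambda>p. ?D p (1, 0))"
    "(\<lambda>(t, x). deriv (\<lambda>y. g t y) x) = (\<lambda>p. ?D p (0, 1))"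
    using fst snd by (auto simp: fun_eq_iff intro!: DERIV_imp_deriv)
  then show "continuous_on UNIV (\<lambda>(t, x). deriv (\<lambda>s. g s x) t)"
    "continuous_on UNIV (\<lambda>(t, x). deriv (\<lambda>y. g t y) x)"
    using cont by auto
qed

text \<open>The quotient equals the partial derivative at an intermediate point. Both end points and the
  parameter may move with the index, as grid points and time levels do.\<close>

lemma difference_quotient_tendsto:
  fixes h D :: "real \<Rightarrow> real \<Rightarrow> real"
  assumes der: "\<And>y s. ((\<lambda>y. h y s) has_real_derivative D y s) (at y)"
    and cont: "continuous_on UNIV (\<lambda>(y, s). D y s)"
    and a: "a \<longlonglongrightarrow> y" and b: "b \<longlonglongrightarrow> y" and ab: "\<And>k. a k < b k" and s: "s \<longlonglongrightarrow> s0"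
  shows "(\<lambda>k. (h (b k) (s k) - h (a k) (s k)) / (b k - a k)) \<longlonglongrightarrow> D y s0"
proof -
  have "\<exists>\<xi>. a k < \<xi> \<and> \<xi> < b k \<and> h (b k) (s k) - h (a k) (s k) = (b k - a k) * D \<xi> (s k)" for k
    using MVT2[OF ab[of k], of "\<lambda>y. h y (s k)" "\<lambda>y. D y (s k)"] der by auto
  then obtain \<xi> where \<xi>: "\<And>k. a k < \<xi> k" "\<And>k. \<xi> k < b k"
    "\<And>k. h (b k) (s k) - h (a k) (s k) = (b k - a k) * D (\<xi> k) (s k)" by metis
  have "\<xi> \<longlonglongrightarrow> y"
    using tendsto_sandwich[OF _ _ a b, of \<xi>] \<xi> by (auto intro!: always_eventually less_imp_le)
  then have "(\<lambda>k. (\<xi> k, s k)) \<longlonglongrightarrow> (y, s0)" using s by (rule tendsto_Pair)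
  then have "(\<lambda>k. D (\<xi> k) (s k)) \<longlonglongrightarrow> D y s0"
    using continuous_on_tendsto_compose[OF cont, of "\<lambda>k. (\<xi> k, s k)"] by fastforce
  moreover have "(h (b k) (s k) - h (a k) (s k)) / (b k - a k) = D (\<xi> k) (s k)" for k
    using \<xi>[of k] ab[of k] by simp
  ultimately show ?thesis by simp
qed

lemma continuous_bounded_rectangle:
  fixes g :: "real \<Rightarrow> real \<Rightarrow> real"
  assumes "continuous_on UNIV (\<lambda>(s, y). g s y)"
  obtains B where "B \<ge> 0" "\<And>s y. s \<in> {a..b} \<Longrightarrow> y \<in> {c..d} \<Longrightarrow> \<bar>g s y\<bar> \<le> B"
proof -
  have "compact ((\<lambda>(s, y). g s y) ` ({a..b} \<times> {c..d}))"
    using assms by (intro compact_continuous_image compact_Times compact_Icc) (auto intro: continuous_on_subset)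
  then obtain B where "\<forall>z\<in>(\<lambda>(s, y). g s y) ` ({a..b} \<times> {c..d}). \<bar>z\<bar> \<le> B"
    using bounded_real compact_imp_bounded by blast
  then show thesis by (intro that[of "\<bar>B\<bar>"]) force+
qed

lemma tendsto_continuous_2:
  fixes g :: "real \<Rightarrow> real \<Rightarrow> real"
  assumes "continuous_on UNIV (\<lambda>(s, y). g s y)" "a \<longlonglongrightarrow> s" "b \<longlonglongrightarrow> y"
  shows "(\<lambda>k. g (a k) (b k)) \<longlonglongrightarrow> g s y"
  using continuous_on_tendsto_compose[OF assms(1) tendsto_Pair[OF assms(2,3)]] by auto

lemma difference_quotient_bound:
  fixes h D :: "real \<Rightarrow> real"
  assumes der: "\<And>y. (h has_real_derivative D y) (at y)" and "a < b"
    and bd: "\<And>y. a \<le> y \<Longrightarrow> y \<le> b \<Longrightarrow> \<bar>D y\<bar> \<le> B"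
  shows "\<bar>(h b - h a) / (b - a)\<bar> \<le> B"
proof -
  obtain z where "a < z" "z < b" "h b - h a = (b - a) * D z"
    using MVT2[OF \<open>a < b\<close>, of h D] der by blast
  then show ?thesis using bd[of z] by simp
qed

section \<open>Bounded convergence and approximation by continuous functions\<close>

lemma bounded_convergence_on:
  fixes f :: "nat \<Rightarrow> 'a::euclidean_space \<Rightarrow> real"
  assumes S: "S \<in> lmeasurable"
    and f: "\<And>k. f k \<in> borel_measurable (lebesgue_on S)"
    and g: "g \<in> borel_measurable (lebesgue_on S)"
    and lim: "AE x in lebesgue_on S. (\<lambda>k. f k x) \<longlonglongrightarrow> g x"
    and bd: "\<And>k. AE x in lebesgue_on S. \<bar>f k x\<bar> \<le> C"
  shows "(\<lambda>k. integral\<^sup>L (lebesgue_on S) (f k)) \<longlonglongrightarrow> integral\<^sup>L (lebesgue_on S) g"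
proof -
  interpret finite_measure "lebesgue_on S" by (rule finite_measure_lebesgue_on[OF S])
  have C: "integrable (lebesgue_on S) (\<lambda>x. C)" by simp
  show "(\<lambda>k. integral\<^sup>L (lebesgue_on S) (f k)) \<longlonglongrightarrow> integral\<^sup>L (lebesgue_on S) g"
    by (rule integral_dominated_convergence[OF g f C lim]) (use bd in simp)
qed

lemma integrable_bounded_on:
  fixes f :: "'a::euclidean_space \<Rightarrow> real"
  assumes "S \<in> lmeasurable" "f \<in> borel_measurable (lebesgue_on S)"
    and "AE x in lebesgue_on S. \<bar>f x\<bar> \<le> C"
  shows "integrable (lebesgue_on S) f"
proof -
  interpret finite_measure "lebesgue_on S" by (rule finite_measure_lebesgue_on) fact
  show ?thesis by (rule integrable_const_bound[of _ C]) (use assms in auto)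
qed

text \<open>Lebesgue measurability provides continuous functions converging almost everywhere; truncating
  them at the bound of \<open>w\<close> makes bounded convergence applicable.\<close>

lemma continuous_dense_in_L1:
  fixes w :: "real \<Rightarrow> real"
  assumes S: "S \<in> lmeasurable" and w: "w \<in> borel_measurable (lebesgue_on S)"
    and K: "AE x in lebesgue_on S. \<bar>w x\<bar> \<le> K" and e: "e > 0"
  obtains g where "continuous_on UNIV g" "\<And>x. \<bar>g x\<bar> \<le> \<bar>K\<bar>"
    "(\<integral>x. \<bar>w x - g x\<bar> \<partial>lebesgue_on S) < e"
proof -
  have "w measurable_on S"
    using w S by (simp add: fmeasurableD measurable_on_iff_borel_measurable)
  then obtain N h where N: "negligible N" and h: "\<And>n::nat. continuous_on UNIV (h n)"
    and lim: "\<And>x. x \<notin> N \<Longrightarrow> (\<lambda>n. h n x) \<longlonglongrightarrow> (if x \<in> S then w x else 0)"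
    unfolding measurable_on_def by blast
  define g where "g n x = max (- \<bar>K\<bar>) (min \<bar>K\<bar> (h n x))" for n x
  have g: "continuous_on UNIV (g n)" for n
    unfolding g_def using h[of n] by (intro continuous_intros)
  have gm: "g n \<in> borel_measurable (lebesgue_on S)" for n
    using continuous_on_subset[OF g, of S] S 
    by (intro continuous_imp_measurable_on_sets_lebesgue) (auto simp: fmeasurableD)
  have gK: "\<bar>g n x\<bar> \<le> \<bar>K\<bar>" for n x unfolding g_def by auto
  have Nnull: "AE x in lebesgue_on S. x \<notin> N"
    using N S AE_not_in[of N lebesgue]
    by (subst AE_restrict_space_iff) (auto simp: fmeasurableD negligible_iff_null_sets)
  have "(\<lambda>n. \<integral>x. \<bar>w x - g n x\<bar> \<partial>lebesgue_on S) \<longlonglongrightarrow> (\<integral>x. 0 \<partial>lebesgue_on S)"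
  proof (rule bounded_convergence_on[OF S, where C="2 * \<bar>K\<bar>"])
    show "AE x in lebesgue_on S. (\<lambda>n. \<bar>w x - g n x\<bar>) \<longlonglongrightarrow> 0"
      using K Nnull AE_space
    proof eventually_elim
      fix x assume x: "\<bar>w x\<bar> \<le> K" "x \<notin> N" "x \<in> space (lebesgue_on S)"
      then have "(\<lambda>n. h n x) \<longlonglongrightarrow> w x" using lim[of x] by simp
      then have "(\<lambda>n. g n x) \<longlonglongrightarrow> max (- \<bar>K\<bar>) (min \<bar>K\<bar> (w x))"
        unfolding g_def by (intro tendsto_intros)
      moreover have "max (- \<bar>K\<bar>) (min \<bar>K\<bar> (w x)) = w x" using x(1) by auto
      ultimately have "(\<lambda>n. g n x) \<longlonglongrightarrow> w x" by simp
      then have "(\<lambda>n. \<bar>w x - g n x\<bar>) \<longlonglongrightarrow> \<bar>w x - w x\<bar>" by (intro tendsto_intros)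
      then show "(\<lambda>n. \<bar>w x - g n x\<bar>) \<longlonglongrightarrow> 0" by simp
    qed
    show "AE x in lebesgue_on S. \<bar>\<bar>w x - g n x\<bar>\<bar> \<le> 2 * \<bar>K\<bar>" for n
      using K
    proof eventually_elim
      fix x assume "\<bar>w x\<bar> \<le> K" then show "\<bar>\<bar>w x - g n x\<bar>\<bar> \<le> 2 * \<bar>K\<bar>" using gK[of n x] by auto
    qed
  qed (use w gm in auto)
  then have "eventually (\<lambda>n. (\<integral>x. \<bar>w x - g n x\<bar> \<partial>lebesgue_on S) < e) sequentially"
    using e by (intro order_tendstoD(2)) auto
  then obtain n where "(\<integral>x. \<bar>w x - g n x\<bar> \<partial>lebesgue_on S) < e"
    by (auto simp: eventually_sequentially)
  then show thesis using that[of "g n"] g gK by auto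
qed

section \<open>Integrals of step functions\<close>

text \<open>Cells are numbered from 0 here, so \<open>cell h s\<close> is the time index \<open>n\<close>, whereas the scheme
  stores the value of the spatial cell \<open>cell h x\<close> at the index \<open>Suc (cell h x)\<close>.\<close>

definition cell :: "real \<Rightarrow> real \<Rightarrow> nat" where
  "cell h s = nat \<lfloor>s / h\<rfloor>"

lemma cell_measurable [measurable]: "cell h \<in> borel \<rightarrow>\<^sub>M count_space UNIV"
  unfolding cell_def by measurable

lemma cell_bounds:
  assumes "h > 0" "s \<ge> 0"
  shows "real (cell h s) * h \<le> s" "s < real (Suc (cell h s)) * h"
proof -
  have "real (cell h s) = real_of_int \<lfloor>s / h\<rfloor>" unfolding cell_def using assms by simp
  then have "real (cell h s) \<le> s / h" "s / h < real (cell h s) + 1" by linarith+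
  then show "real (cell h s) * h \<le> s" "s < real (Suc (cell h s)) * h"
    using assms by (simp_all add: field_simps)
qed

lemma cell_eq:
  assumes "h > 0" "real i * h \<le> s" "s < real (Suc i) * h"
  shows "cell h s = i"
proof -
  have "\<lfloor>s / h\<rfloor> = int i" using assms by (intro floor_unique) (simp_all add: field_simps)
  then show ?thesis by (simp add: cell_def)
qed

lemma mem_cell_iff:
  assumes "h > 0" "s \<ge> 0"
  shows "s \<in> {real i * h..<real (Suc i) * h} \<longleftrightarrow> i = cell h s"
  using cell_bounds[OF assms] cell_eq[OF assms(1), of i s] by (metis atLeastLessThan_iff)

lemma cell_less:
  assumes "h > 0" "s \<ge> 0" "s < real m * h" shows "cell h s < m"
proof -
  have "real (cell h s) * h < real m * h" using cell_bounds(1)[OF assms(1,2)] assms(3) by linarith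
  then show ?thesis using assms(1) by simp
qed

lemma set_integral_const_Ico:
  "a \<le> b \<Longrightarrow> (LINT x:{a..<b}|lebesgue. c) = (b - a) * c" for a b c :: real
  by (simp add: set_lebesgue_integral_def)

lemma set_integral_cells:
  fixes g :: "real \<Rightarrow> real"
  assumes h: "h > 0" and g: "set_integrable lebesgue {0..<real m * h} g"
  shows "(LINT x:{0..<real m * h}|lebesgue. g x)
       = (\<Sum>i<m. LINT x:{real i * h..<real (Suc i) * h}|lebesgue. g x)"
  using g
proof (induction m)
  case (Suc m)
  have eq: "{0..<real (Suc m) * h} = {0..<real m * h} \<union> {real m * h..<real (Suc m) * h}"
    using h by (auto simp: field_simps) (smt (verit) mult_nonneg_nonneg of_nat_0_le_iff)
  have 1: "set_integrable lebesgue {0..<real m * h} g"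
    "set_integrable lebesgue {real m * h..<real (Suc m) * h} g"
    by (rule set_integrable_subset[OF Suc.prems]; use eq in auto)+
  have "(LINT x:{0..<real (Suc m) * h}|lebesgue. g x)
    = (LINT x:{0..<real m * h}|lebesgue. g x) + (LINT x:{real m * h..<real (Suc m) * h}|lebesgue. g x)"
    unfolding eq by (rule set_integral_Un[OF _ 1]) auto
  then show ?case using Suc.IH[OF 1(1)] by simp
qed (simp add: set_lebesgue_integral_def)

lemma lmeasurable_Ico [simp]: "{a..<b::real} \<in> lmeasurable"
  by (rule bounded_set_imp_lmeasurable) auto

lemma step_measurable:
  "(\<lambda>x. v (cell h x)) \<in> borel_measurable borel" for v :: "nat \<Rightarrow> real"
  by measurable

lemma borel_imp_lebesgue_on: "f \<in> borel_measurable borel \<Longrightarrow> f \<in> borel_measurable (lebesgue_on S)"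
  by (simp add: measurable_completion measurable_restrict_space1)

lemma step_integrable:
  fixes v :: "nat \<Rightarrow> real"
  assumes h: "h > 0"
  shows "integrable (lebesgue_on {0..<real m * h}) (\<lambda>x. v (cell h x))"
proof (rule integrable_bounded_on[where C="\<Sum>i<m. \<bar>v i\<bar>"])
  show "(\<lambda>x. v (cell h x)) \<in> borel_measurable (lebesgue_on {0..<real m * h})"
    by (rule borel_imp_lebesgue_on[OF step_measurable])
  show "AE x in lebesgue_on {0..<real m * h}. \<bar>v (cell h x)\<bar> \<le> (\<Sum>i<m. \<bar>v i\<bar>)"
    using cell_less[OF h, of _ m] by (intro AE_I2) (auto intro!: member_le_sum)
qed auto

lemma step_integral:
  fixes v :: "nat \<Rightarrow> real"
  assumes h: "h > 0"
  shows "(\<integral>x. v (cell h x) \<partial>lebesgue_on {0..<real m * h}) = (\<Sum>i<m. h * v i)"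
proof -
  have "set_integrable lebesgue {0..<real m * h} (\<lambda>x. v (cell h x))"
    using step_integrable[OF h, of m v] by (simp add: integrable_restrict_space set_integrable_def)
  from set_integral_cells[OF h this]
  have "(\<integral>x. v (cell h x) \<partial>lebesgue_on {0..<real m * h})
    = (\<Sum>i<m. LINT x:{real i * h..<real (Suc i) * h}|lebesgue. v (cell h x))"
    by (simp add: integral_restrict_space set_lebesgue_integral_def)
  also have "\<dots> = (\<Sum>i<m. LINT x:{real i * h..<real (Suc i) * h}|lebesgue. v i)"
    by (intro sum.cong refl set_lebesgue_integral_cong) (auto simp: cell_eq[OF h])
  also have "\<dots> = (\<Sum>i<m. h * v i)"
    using h by (intro sum.cong refl) (simp add: set_integral_const_Ico algebra_simps)
  finally show ?thesis .
qed

lemma step_measurable_2: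
  "(\<lambda>p. H (cell h (fst p)) (cell h' (snd p))) \<in> borel_measurable (borel :: (real \<times> real) measure)"
  for H :: "nat \<Rightarrow> nat \<Rightarrow> real"
proof -
  have [measurable]: "fst \<in> borel_measurable (borel :: (real \<times> real) measure)"
    "snd \<in> borel_measurable (borel :: (real \<times> real) measure)"
    by (auto simp: borel_prod[symmetric])
  show ?thesis by measurable
qed

lemma lmeasurable_rectangle [simp]:
  "{a..<b::real} \<times> {c..<d::real} \<in> lmeasurable"
proof (rule bounded_set_imp_lmeasurable)
  show "bounded ({a..<b} \<times> {c..<d})" by (intro bounded_Times) auto
  have "{a..<b} \<times> {c..<d} \<in> sets (lborel \<Otimes>\<^sub>M lborel)" by (intro pair_measureI) auto
  then show "{a..<b} \<times> {c..<d} \<in> sets lebesgue"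
    unfolding lborel_prod by (rule sets_completionI_sets)
qed

lemma measure_rectangle:
  assumes "a \<le> b" "c \<le> d"
  shows "measure lebesgue ({a..<b::real} \<times> {c..<d::real}) = (b - a) * (d - c)"
proof -
  have "{a..<b} \<times> {c..<d} \<in> sets (lborel \<Otimes>\<^sub>M lborel)" by (intro pair_measureI) auto
  then have s: "{a..<b} \<times> {c..<d} \<in> sets lborel" unfolding lborel_prod .
  have "emeasure lborel ({a..<b} \<times> {c..<d}) = emeasure lborel {a..<b} * emeasure lborel {c..<d}"
    unfolding lborel_prod[symmetric] by (rule lborel.emeasure_pair_measure_Times) auto
  also have "\<dots> = ennreal ((b - a) * (d - c))"
    using assms by (simp add: ennreal_mult)
  finally show ?thesis using s assms by (simp add: measure_def)
qed

text \<open>Grid sums over space and time are integrals of step functions: this is how the discrete entropy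
  inequality becomes a statement about functions on the strip.\<close>

lemma step_integral_2:
  fixes H :: "nat \<Rightarrow> nat \<Rightarrow> real"
  assumes h: "h > 0" and h': "h' > 0"
  shows "(\<integral>p. H (cell h (fst p)) (cell h' (snd p))
            \<partial>lebesgue_on ({0..<real m * h} \<times> {0..<real n * h'}))
       = (\<Sum>i<m. \<Sum>j<n. h * h' * H i j)"
proof -
  let ?D = "{0..<real m * h} \<times> {0..<real n * h'}"
  let ?R = "\<lambda>i j. {real i * h..<real (Suc i) * h} \<times> {real j * h'..<real (Suc j) * h'}"
  have sub: "?R i j \<subseteq> ?D" if "i < m" "j < n" for i j
  proof -
    have "real (Suc i) * h \<le> real m * h" "real (Suc j) * h' \<le> real n * h'"
      "0 \<le> real i * h" "0 \<le> real j * h'"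
      using that h h' by (intro mult_right_mono mult_nonneg_nonneg; simp)+
    then show ?thesis by (auto simp del: of_nat_Suc)
  qed
  have ind: "(\<Sum>i<m. \<Sum>j<n. indicator (?R i j) p * H i j) = H (cell h (fst p)) (cell h' (snd p))"
    if "p \<in> ?D" for p
  proof -
    obtain t x where p: "p = (t, x)" by (cases p)
    have tx: "0 \<le> t" "t < real m * h" "0 \<le> x" "x < real n * h'" using that p by auto
    have "indicator (?R i j) p * H i j
        = (if i = cell h t then if j = cell h' x then H i j else 0 else 0)" for i j
      unfolding p indicator_def mem_Times_iff fst_conv snd_conv
        mem_cell_iff[OF h tx(1)] mem_cell_iff[OF h' tx(3)] by simp
    then have "(\<Sum>i<m. \<Sum>j<n. indicator (?R i j) p * H i j)
        = (\<Sum>i<m. \<Sum>j<n. if i = cell h t then if j = cell h' x then H i j else 0 else 0)"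
      by (simp only:)
    also have "\<dots> = (\<Sum>i<m. if i = cell h t then H i (cell h' x) else 0)"
      using cell_less[OF h' tx(3,4)] by (intro sum.cong refl) simp
    also have "\<dots> = H (cell h t) (cell h' x)"
      using cell_less[OF h tx(1,2)] by simp
    finally show ?thesis by (simp add: p)
  qed
  have int: "integrable (lebesgue_on ?D) (\<lambda>p. indicator (?R i j) p * H i j)" for i j
  proof (rule integrable_bounded_on[where C="\<bar>H i j\<bar>"])
    show "(\<lambda>p. indicator (?R i j) p * H i j) \<in> borel_measurable (lebesgue_on ?D)"
      by (intro borel_measurable_times borel_measurable_const measurable_restrict_space1
          borel_measurable_indicator fmeasurableD lmeasurable_rectangle)
  qed (auto simp: indicator_def)
  have one: "(\<integral>p. indicator (?R i j) p * H i j \<partial>lebesgue_on ?D) = h * h' * H i j"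
    if "i < m" "j < n" for i j
  proof -
    have "(\<integral>p. indicator (?R i j) p * H i j \<partial>lebesgue_on ?D)
       = (\<integral>p. indicator ?D p *\<^sub>R (indicator (?R i j) p * H i j) \<partial>lebesgue)"
      by (rule integral_restrict_space) (auto simp: fmeasurableD)
    also have "\<dots> = (\<integral>p. indicator (?R i j) p * H i j \<partial>lebesgue)"
      using sub[OF that] by (intro Bochner_Integration.integral_cong) (auto simp: indicator_def)
    also have "\<dots> = measure lebesgue (?R i j) * H i j" by simp
    also have "\<dots> = h * h' * H i j"
      using h h' by (subst measure_rectangle) (auto simp: algebra_simps)
    finally show ?thesis .
  qed
  have "(\<integral>p. H (cell h (fst p)) (cell h' (snd p)) \<partial>lebesgue_on ?D)
     = (\<integral>p. (\<Sum>i<m. \<Sum>j<n. indicator (?R i j) p * H i j) \<partial>lebesgue_on ?D)"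
    by (intro Bochner_Integration.integral_cong refl ind[symmetric]) simp
  also have "\<dots> = (\<Sum>i<m. \<Sum>j<n. \<integral>p. indicator (?R i j) p * H i j \<partial>lebesgue_on ?D)"
    by (subst Bochner_Integration.integral_sum; (intro Bochner_Integration.integrable_sum int sum.cong refl)?)
       (intro Bochner_Integration.integral_sum int)
  also have "\<dots> = (\<Sum>i<m. \<Sum>j<n. h * h' * H i j)"
    by (intro sum.cong refl one) simp_all
  finally show ?thesis .
qed

section \<open>Limits of bounded functions in the mean\<close>

text \<open>The excess \<open>max 0 (\<bar>w\<bar> - K)\<close> is at most \<open>\<bar>W k - w\<bar>\<close>, so its integral vanishes.\<close>

lemma L1_limit_bounded:
  fixes w :: "'a::euclidean_space \<Rightarrow> real"
  assumes S: "S \<in> lmeasurable" and w: "integrable (lebesgue_on S) w"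
    and W: "\<And>k::nat. integrable (lebesgue_on S) (W k)"
    and WK: "\<And>k x. x \<in> S \<Longrightarrow> \<bar>W k x\<bar> \<le> K"
    and lim: "(\<lambda>k. \<integral>x. \<bar>W k x - w x\<bar> \<partial>lebesgue_on S) \<longlonglongrightarrow> 0"
  shows "AE x in lebesgue_on S. \<bar>w x\<bar> \<le> K"
proof -
  interpret finite_measure "lebesgue_on S" by (rule finite_measure_lebesgue_on[OF S])
  let ?m = "\<lambda>x. max 0 (\<bar>w x\<bar> - K)"
  have int: "integrable (lebesgue_on S) ?m" using w by (intro integrable_max) auto
  have "(\<integral>x. ?m x \<partial>lebesgue_on S) \<le> (\<integral>x. \<bar>W k x - w x\<bar> \<partial>lebesgue_on S)" for k
  proof (rule integral_mono[OF int])
    show "integrable (lebesgue_on S) (\<lambda>x. \<bar>W k x - w x\<bar>)" using w W by auto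
    fix x assume "x \<in> space (lebesgue_on S)"
    then show "?m x \<le> \<bar>W k x - w x\<bar>" using WK[of x k] by auto
  qed
  then have "(\<integral>x. ?m x \<partial>lebesgue_on S) \<le> 0"
    by (intro LIMSEQ_le_const[OF lim]) auto
  then have "(\<integral>x. ?m x \<partial>lebesgue_on S) = 0"
    by (intro antisym integral_nonneg) auto
  then have "AE x in lebesgue_on S. ?m x = 0"
    by (subst (asm) integral_nonneg_eq_0_iff_AE[OF int]) auto
  then show ?thesis by eventually_elim auto
qed

text \<open>Convergence in \<open>L\<^sup>1(B)\<close> for every fixed \<open>t\<close> improves, by domination in \<open>t\<close> and Tonelli's
  theorem, to convergence in \<open>L\<^sup>1(A \<times> B)\<close>, which has an almost everywhere convergent
  subsequence. Since \<open>w\<close> is only Lebesgue measurable on the plane, its sections are accessible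
  only almost everywhere, through a Borel representative.\<close>

lemma ae_convergent_subsequence:
  fixes w :: "real \<Rightarrow> real \<Rightarrow> real" and W :: "nat \<Rightarrow> real \<Rightarrow> real \<Rightarrow> real"
  assumes A: "A \<in> lmeasurable" "A \<in> sets borel" and B: "B \<in> lmeasurable" "B \<in> sets borel"
    and w: "(\<lambda>p. w (fst p) (snd p)) \<in> borel_measurable (lebesgue_on (A \<times> B))"
    and W: "\<And>k. (\<lambda>p. W k (fst p) (snd p)) \<in> borel_measurable borel"
    and wt: "\<And>t. t \<in> A \<Longrightarrow> integrable (lebesgue_on B) (w t)"
    and wK: "\<And>t. t \<in> A \<Longrightarrow> AE x in lebesgue_on B. \<bar>w t x\<bar> \<le> K"
    and WK: "\<And>k t x. t \<in> A \<Longrightarrow> x \<in> B \<Longrightarrow> \<bar>W k t x\<bar> \<le> K"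
    and lim: "\<And>t. t \<in> A \<Longrightarrow> (\<lambda>k. \<integral>x. \<bar>W k t x - w t x\<bar> \<partial>lebesgue_on B) \<longlonglongrightarrow> 0"
  obtains r where "strict_mono r"
    "AE p in lebesgue_on (A \<times> B). (\<lambda>k. W (r k) (fst p) (snd p)) \<longlonglongrightarrow> w (fst p) (snd p)"
proof -
  have [measurable]: "A \<in> sets lborel" "B \<in> sets lborel" using A B by auto
  have AB2: "A \<times> B \<in> sets (lborel \<Otimes>\<^sub>M lborel)" using A B by auto
  have AB: "A \<times> B \<in> sets lborel" using AB2 unfolding lborel_prod .
  have ABl: "A \<times> B \<in> sets lebesgue" using AB by simp
  have Bl: "B \<in> sets lebesgue" using B by (simp add: fmeasurableD)
  have "(\<lambda>p. indicator (A \<times> B) p *\<^sub>R w (fst p) (snd p)) \<in> borel_measurable lebesgue"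
    using w by (subst (asm) borel_measurable_restrict_space_iff) (use ABl in auto)
  from completion_ex_borel_measurable_real[OF this]
  obtain w' where w': "w' \<in> borel_measurable lborel"
    and ae: "AE p in lborel. indicator (A \<times> B) p *\<^sub>R w (fst p) (snd p) = w' p" by auto
  have ae2: "AE t in lborel. AE x in lborel. indicator (A \<times> B) (t, x) *\<^sub>R w t x = w' (t, x)"
    using lborel_pair.AE_pair[of "\<lambda>p. indicator (A \<times> B) p *\<^sub>R w (fst p) (snd p) = w' p"] ae
    unfolding lborel_prod by simp
  define g where "g k p = indicator (A \<times> B) p * \<bar>W k (fst p) (snd p) - w' p\<bar>" for k p
  have gm: "g k \<in> borel_measurable lborel" for k
    unfolding g_def using W[of k] w' AB by (auto intro!: borel_measurable_times borel_measurable_abs borel_measurable_diff borel_measurable_indicator)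
  have gm2: "(\<lambda>p. ennreal (g k p)) \<in> borel_measurable (lborel \<Otimes>\<^sub>M lborel)" for k
    using gm[of k] by (simp add: lborel_prod)
  have g0: "0 \<le> g k p" for k p unfolding g_def by auto
  define h where "h k t = (\<integral>\<^sup>+x. ennreal (g k (t, x)) \<partial>lborel)" for k t
  have hm: "h k \<in> borel_measurable lborel" for k
    unfolding h_def by (rule lborel.borel_measurable_nn_integral_fst[OF gm2])
  let ?I = "\<lambda>k t. \<integral>x. \<bar>W k t x - w t x\<bar> \<partial>lebesgue_on B"
  have Wm: "(\<lambda>x. W k t x) \<in> borel_measurable (lebesgue_on B)" for k t
  proof -
    have "(\<lambda>x. (t, x)) \<in> borel_measurable borel"
      by (intro borel_measurable_continuous_onI continuous_intros)
    from measurable_compose[OF this W[of k]] show ?thesis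
      by (intro borel_imp_lebesgue_on) simp
  qed
  have bd: "AE x in lebesgue_on B. \<bar>W k t x - w t x\<bar> \<le> 2 * K" if "t \<in> A" for k t
    using wK[OF that] AE_space
  proof eventually_elim
    fix x assume "\<bar>w t x\<bar> \<le> K" "x \<in> space (lebesgue_on B)"
    then show "\<bar>W k t x - w t x\<bar> \<le> 2 * K" using WK[OF that, of x k] by auto
  qed
  have int: "integrable (lebesgue_on B) (\<lambda>x. \<bar>W k t x - w t x\<bar>)" if "t \<in> A" for k t
    by (rule integrable_bounded_on[OF B(1), where C="2 * K"]) (use bd[OF that, of k] Wm wt[OF that] in auto)
  have hI: "AE t in lborel. h k t = indicator A t * ennreal (?I k t)" for k
    using ae2
  proof eventually_elim
    fix t assume t: "AE x in lborel. indicator (A \<times> B) (t, x) *\<^sub>R w t x = w' (t, x)"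
    show "h k t = indicator A t * ennreal (?I k t)"
    proof (cases "t \<in> A")
      case True
      have "h k t = (\<integral>\<^sup>+x. ennreal \<bar>W k t x - w t x\<bar> * indicator B x \<partial>lborel)"
        unfolding h_def g_def
        by (rule nn_integral_cong_AE, use t in eventually_elim) (auto simp: indicator_def True)
      also have "\<dots> = (\<integral>\<^sup>+x. ennreal \<bar>W k t x - w t x\<bar> \<partial>lebesgue_on B)"
        by (subst nn_integral_restrict_space) (use Bl in \<open>auto simp: nn_integral_completion\<close>)
      also have "\<dots> = ennreal (?I k t)"
        by (rule nn_integral_eq_integral[OF int[OF True]]) auto
      finally show ?thesis using True by simp
    next
      case False
      then show ?thesis by (simp add: h_def g_def)
    qed
  qed
  have Ib: "?I k t \<le> 2 * K * measure lebesgue B" if "t \<in> A" for k t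
  proof -
    interpret finite_measure "lebesgue_on B" by (rule finite_measure_lebesgue_on) fact
    have "?I k t \<le> (\<integral>x. 2 * K \<partial>lebesgue_on B)"
      by (rule integral_mono_AE[OF int[OF that]]) (use bd[OF that, of k] in auto)
    then show ?thesis using Bl by (simp add: measure_restrict_space mult_ac)
  qed
  have emA: "emeasure lborel A < \<infinity>"
    using A fmeasurableD2[OF A(1)] by (simp add: less_top)
  have dom: "(\<lambda>k. \<integral>\<^sup>+t. h k t \<partial>lborel) \<longlonglongrightarrow> (\<integral>\<^sup>+t. 0 \<partial>(lborel::real measure))"
  proof (rule nn_integral_dominated_convergence)
    show "AE t in lborel. h k t \<le> ennreal (2 * K * measure lebesgue B) * indicator A t" for k
      using hI[of k] by eventually_elim (auto simp: indicator_def Ib intro: ennreal_leI)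
    show "(\<integral>\<^sup>+t. ennreal (2 * K * measure lebesgue B) * indicator A t \<partial>lborel) < \<infinity>"
      using emA A(2) by (subst nn_integral_cmult_indicator) (auto simp: ennreal_mult_less_top)
    have "AE t in lborel. \<forall>k. h k t = indicator A t * ennreal (?I k t)"
      using hI by (simp add: AE_all_countable)
    then show "AE t in lborel. (\<lambda>k. h k t) \<longlonglongrightarrow> 0"
    proof eventually_elim
      fix t assume t: "\<forall>k. h k t = indicator A t * ennreal (?I k t)"
      show "(\<lambda>k. h k t) \<longlonglongrightarrow> 0"
      proof (cases "t \<in> A")
        case True
        then have "(\<lambda>k. ennreal (?I k t)) \<longlonglongrightarrow> ennreal 0" using lim by (intro tendsto_ennrealI)
        then show ?thesis using t True by simp
      qed (use t in simp)
    qed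
  qed (use hm in auto)
  have fub: "(\<integral>\<^sup>+p. ennreal (g k p) \<partial>lborel) = (\<integral>\<^sup>+t. h k t \<partial>lborel)" for k
    unfolding h_def using lborel.nn_integral_fst[OF gm2[of k]] by (simp add: lborel_prod)
  have fin: "(\<integral>\<^sup>+t. h k t \<partial>lborel) < \<infinity>" for k
  proof -
    have "(\<integral>\<^sup>+t. h k t \<partial>lborel) \<le> (\<integral>\<^sup>+t. ennreal (2 * K * measure lebesgue B) * indicator A t \<partial>lborel)"
      by (rule nn_integral_mono_AE) (use hI[of k] in eventually_elim, auto simp: indicator_def Ib intro: ennreal_leI)
    also have "\<dots> < \<infinity>"
      using emA A(2) by (subst nn_integral_cmult_indicator) (auto simp: ennreal_mult_less_top)
    finally show ?thesis .
  qed
  have gint: "integrable lborel (g k)" for k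
    by (rule integrableI_nonneg) (use gm g0 fin fub in auto)
  have "(\<lambda>k. ennreal (\<integral>p. norm (g k p) \<partial>lborel)) \<longlonglongrightarrow> ennreal 0"
    using dom by (simp add: fub[symmetric] nn_integral_eq_integral[OF gint] g0)
  then have "(\<lambda>k. \<integral>p. norm (g k p) \<partial>lborel) \<longlonglongrightarrow> 0"
    by (rule tendsto_ennrealD) auto
  from tendsto_L1_AE_subseq[OF gint this] obtain r where r: "strict_mono r"
    and rlim: "AE p in lborel. (\<lambda>k. g (r k) p) \<longlonglongrightarrow> 0" by auto
  have "AE p in lborel. p \<in> A \<times> B \<longrightarrow> (\<lambda>k. W (r k) (fst p) (snd p)) \<longlonglongrightarrow> w (fst p) (snd p)"
    using rlim ae
  proof eventually_elim
    fix p assume p: "(\<lambda>k. g (r k) p) \<longlonglongrightarrow> 0"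
      "indicator (A \<times> B) p *\<^sub>R w (fst p) (snd p) = w' p"
    show "p \<in> A \<times> B \<longrightarrow> (\<lambda>k. W (r k) (fst p) (snd p)) \<longlonglongrightarrow> w (fst p) (snd p)"
    proof
      assume "p \<in> A \<times> B"
      then have "(\<lambda>k. \<bar>W (r k) (fst p) (snd p) - w (fst p) (snd p)\<bar>) \<longlonglongrightarrow> 0"
        using p unfolding g_def by simp
      then show "(\<lambda>k. W (r k) (fst p) (snd p)) \<longlonglongrightarrow> w (fst p) (snd p)"
        using LIM_zero_cancel tendsto_rabs_zero_iff by blast
    qed
  qed
  then have "AE p in lebesgue_on (A \<times> B). (\<lambda>k. W (r k) (fst p) (snd p)) \<longlonglongrightarrow> w (fst p) (snd p)"
    by (subst AE_restrict_space_iff) (use ABl AE_completion in auto)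
  with r show thesis by (rule that)
qed

lemma sum_cyclic_shift: "(\<Sum>i<N. a (Suc i mod N)) = (\<Sum>i<N. a i :: real)"
proof (cases N)
  case (Suc m)
  have "(\<Sum>i<m. a (Suc i mod Suc m)) = (\<Sum>i<m. a (Suc i))"
    by (intro sum.cong) auto
  then show ?thesis unfolding Suc by (simp add: sum.lessThan_Suc_shift[of a m] del: sum.lessThan_Suc) (simp add: add.commute)
qed simp

text \<open>If the step functions converge to \<open>w\<close> in \<open>L\<^sup>1\<close>, neighbouring cell values are close on average.
  It suffices to compare the cell values with those of a continuous function \<open>g\<close> near \<open>w\<close>: the
  shift changes samples of \<open>g\<close> by its modulus of continuity, except across the end of the period,
  where a single cell contributes at most the mesh size times \<open>2 \<bar>K\<bar>\<close>.\<close>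

lemma cyclic_shift_tendsto:
  fixes v :: "nat \<Rightarrow> nat \<Rightarrow> real" and N :: "nat \<Rightarrow> nat" and w :: "real \<Rightarrow> real"
  defines "J \<equiv> lebesgue_on {0..<1::real}"
  assumes N: "\<And>k. N k > 0" and mesh: "(\<lambda>k. 1 / real (N k)) \<longlonglongrightarrow> 0"
    and vK: "\<And>k i. i < N k \<Longrightarrow> \<bar>v k i\<bar> \<le> K"
    and w: "integrable J w"
    and lim: "(\<lambda>k. \<integral>x. \<bar>v k (cell (1 / real (N k)) x) - w x\<bar> \<partial>J) \<longlonglongrightarrow> 0"
  shows "(\<lambda>k. \<integral>x. \<bar>v k (Suc (cell (1 / real (N k)) x) mod N k) - w x\<bar> \<partial>J) \<longlonglongrightarrow> 0"
proof (rule LIMSEQ_I)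
  define h where "h k = 1 / real (N k)" for k
  have h: "h k > 0" for k using N[of k] by (simp add: h_def)
  have Nh: "real (N k) * h k = 1" for k using N[of k] by (simp add: h_def)
  have step_int: "integrable J (\<lambda>x. a (cell (h k) x))" for a :: "nat \<Rightarrow> real" and k
    using step_integrable[OF h[of k], where v=a and m="N k"] by (simp add: Nh J_def)
  have step_eq: "(\<integral>x. a (cell (h k) x) \<partial>J) = (\<Sum>i<N k. h k * a i)" for a :: "nat \<Rightarrow> real" and k
    using step_integral[OF h[of k], where v=a and m="N k"] by (simp add: Nh J_def)
  have wK: "AE x in J. \<bar>w x\<bar> \<le> K"
    unfolding J_def
  proof (rule L1_limit_bounded[OF _ w[unfolded J_def]])
    show "integrable (lebesgue_on {0..<1}) (\<lambda>x. v k (cell (h k) x))" for k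
      using step_int[of "v k" k] by (simp add: J_def)
    show "\<bar>v k (cell (h k) x)\<bar> \<le> K" if "x \<in> {0..<1}" for k x
      using cell_less[OF h, of x "N k" k] that by (intro vK) (simp add: Nh)
    show "(\<lambda>k. \<integral>x. \<bar>v k (cell (h k) x) - w x\<bar> \<partial>lebesgue_on {0..<1}) \<longlonglongrightarrow> 0"
      using lim by (simp add: J_def h_def)
  qed auto
  fix e :: real assume "e > 0"
  \<comment> \<open>nine error terms of size at most \<open>d\<close> arise below\<close>
  define d where "d = e / 10"
  have d: "d > 0" using \<open>e > 0\<close> by (simp add: d_def)
  obtain g where g: "continuous_on UNIV g" "\<And>x. \<bar>g x\<bar> \<le> \<bar>K\<bar>"
    and wg: "(\<integral>x. \<bar>w x - g x\<bar> \<partial>J) < d"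
    using continuous_dense_in_L1[of "{0..<1}" w K d] wK w d unfolding J_def by auto
  have "uniformly_continuous_on {0..1} g"
    using g(1) by (intro compact_uniformly_continuous) (auto intro: continuous_on_subset)
  then obtain \<delta> where \<delta>: "\<delta> > 0"
    and gu: "\<And>x y. x \<in> {0..1} \<Longrightarrow> y \<in> {0..1} \<Longrightarrow> \<bar>x - y\<bar> < \<delta> \<Longrightarrow> \<bar>g x - g y\<bar> < d"
    using d unfolding uniformly_continuous_on_def dist_real_def by metis
  let ?S = "\<lambda>k. \<integral>x. \<bar>v k (cell (h k) x) - w x\<bar> \<partial>J"
  have "eventually (\<lambda>k. ?S k < d) sequentially"
    using lim d unfolding h_def by (intro order_tendstoD(2)) auto
  moreover have "eventually (\<lambda>k. h k < \<delta>) sequentially"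
    using mesh \<delta> unfolding h_def by (intro order_tendstoD(2)) auto
  moreover have "eventually (\<lambda>k. h k * (2 * \<bar>K\<bar>) < d) sequentially"
    using tendsto_mult_left_zero[OF mesh, of "2 * \<bar>K\<bar>"] d unfolding h_def
    by (intro order_tendstoD(2)) auto
  ultimately have "eventually (\<lambda>k. norm ((\<integral>x. \<bar>v k (Suc (cell (1 / real (N k)) x) mod N k) - w x\<bar> \<partial>J) - 0) < e) sequentially"
  proof eventually_elim
    fix k assume k: "?S k < d" "h k < \<delta>" "h k * (2 * \<bar>K\<bar>) < d"
    let ?c = "cell (h k)" and ?n = "N k"
    let ?g = "\<lambda>i. g (real i * h k)"
    let ?E = "\<lambda>i. \<bar>v k i - ?g i\<bar>"
    have gJ: "integrable J g"
      unfolding J_def using g by (intro integrable_bounded_on[where C="\<bar>K\<bar>"])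
        (auto intro: borel_imp_lebesgue_on borel_measurable_continuous_onI)
    have dJ: "integrable J (\<lambda>x. d)"
      unfolding J_def by (rule integrable_bounded_on[where C=d]) (use d in auto)
    have 1: "(\<Sum>i<?n. h k * ?E i) \<le> 3 * d"
    proof -
      have "(\<Sum>i<?n. h k * ?E i) = (\<integral>x. ?E (?c x) \<partial>J)" by (rule step_eq[symmetric])
      also have "\<dots> \<le> (\<integral>x. \<bar>v k (?c x) - w x\<bar> + \<bar>w x - g x\<bar> + d \<partial>J)"
      proof (rule integral_mono)
        show "integrable J (\<lambda>x. ?E (?c x))" using step_int[of ?E k] by simp
        show "integrable J (\<lambda>x. \<bar>v k (?c x) - w x\<bar> + \<bar>w x - g x\<bar> + d)"
          using step_int[of "v k" k] w gJ dJ
          by (intro Bochner_Integration.integrable_add integrable_abs Bochner_Integration.integrable_diff)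
        fix x assume "x \<in> space J"
        then have x: "0 \<le> x" "x < 1" by (auto simp: J_def)
        have b: "real (?c x) * h k \<le> x" "x < real (?c x) * h k + h k"
          using cell_bounds[OF h x(1), of k] by (auto simp: algebra_simps)
        have "0 \<le> real (?c x) * h k" using h[of k] by simp
        then have "\<bar>g x - ?g (?c x)\<bar> < d" using b x k(2) by (intro gu) auto
        then show "?E (?c x) \<le> \<bar>v k (?c x) - w x\<bar> + \<bar>w x - g x\<bar> + d" by linarith
      qed
      also have "\<dots> = ?S k + (\<integral>x. \<bar>w x - g x\<bar> \<partial>J) + (\<integral>x. d \<partial>J)"
        using step_int[of "v k" k] w gJ dJ by (subst Bochner_Integration.integral_add; simp?)+
      also have "(\<integral>x. d \<partial>J) = d" by (simp add: J_def measure_restrict_space)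
      finally show ?thesis using k wg by linarith
    qed
    have 2: "(\<Sum>i<?n. h k * \<bar>?g (Suc i mod ?n) - ?g i\<bar>) \<le> 2 * d"
    proof -
      have "h k * \<bar>?g (Suc i mod ?n) - ?g i\<bar> \<le> h k * d + (if i = ?n - 1 then h k * (2 * \<bar>K\<bar>) else 0)"
        if "i < ?n" for i
      proof (cases "i = ?n - 1")
        case True
        have "\<bar>?g (Suc i mod ?n) - ?g i\<bar> \<le> 2 * \<bar>K\<bar>"
          using g(2)[of "real (Suc i mod ?n) * h k"] g(2)[of "real i * h k"] by linarith
        then have "h k * \<bar>?g (Suc i mod ?n) - ?g i\<bar> \<le> h k * (2 * \<bar>K\<bar>)"
          using h[of k] by (intro mult_left_mono) auto
        moreover have "0 \<le> h k * d" using h[of k] d by simp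
        ultimately show ?thesis using True by (simp only: simp_thms if_True)
      next
        case False
        then have i: "Suc i < ?n" using that by simp
        have "real (Suc i) * h k \<le> real ?n * h k" using i h[of k] by (intro mult_right_mono) auto
        then have "real (Suc i) * h k \<in> {0..1}" "real i * h k \<in> {0..1}"
          using h[of k] Nh[of k] by (auto simp: algebra_simps add_nonneg_nonneg) 
        moreover have "\<bar>real (Suc i) * h k - real i * h k\<bar> < \<delta>" using k(2) h[of k] by (simp add: algebra_simps)
        ultimately have "\<bar>?g (Suc i) - ?g i\<bar> < d" by (rule gu)
        then show ?thesis using i False h[of k] by simp
      qed
      then have "(\<Sum>i<?n. h k * \<bar>?g (Suc i mod ?n) - ?g i\<bar>)
        \<le> (\<Sum>i<?n. h k * d + (if i = ?n - 1 then h k * (2 * \<bar>K\<bar>) else 0))"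
        by (intro sum_mono) auto
      also have "\<dots> = d + h k * (2 * \<bar>K\<bar>)"
        using N[of k] Nh[of k] by (simp add: sum.distrib sum.delta mult.assoc[symmetric])
      finally show ?thesis using k by linarith
    qed
    have "(\<Sum>i<?n. h k * \<bar>v k (Suc i mod ?n) - v k i\<bar>)
        \<le> (\<Sum>i<?n. h k * ?E (Suc i mod ?n) + h k * \<bar>?g (Suc i mod ?n) - ?g i\<bar> + h k * ?E i)"
    proof (rule sum_mono)
      fix i
      have "\<bar>v k (Suc i mod ?n) - v k i\<bar> \<le> ?E (Suc i mod ?n) + \<bar>?g (Suc i mod ?n) - ?g i\<bar> + ?E i" by linarith
      then have "h k * \<bar>v k (Suc i mod ?n) - v k i\<bar> \<le> h k * (?E (Suc i mod ?n) + \<bar>?g (Suc i mod ?n) - ?g i\<bar> + ?E i)"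
        using h[of k] by (intro mult_left_mono) auto
      then show "h k * \<bar>v k (Suc i mod ?n) - v k i\<bar> \<le> h k * ?E (Suc i mod ?n) + h k * \<bar>?g (Suc i mod ?n) - ?g i\<bar> + h k * ?E i"
        by (simp add: algebra_simps)
    qed
    also have "\<dots> \<le> 8 * d"
      using 1 2 sum_cyclic_shift[of "\<lambda>i. h k * ?E i" ?n] by (simp add: sum.distrib)
    finally have 3: "(\<integral>x. \<bar>v k (Suc (?c x) mod ?n) - v k (?c x)\<bar> \<partial>J) \<le> 8 * d"
      using step_eq[of "\<lambda>i. \<bar>v k (Suc i mod ?n) - v k i\<bar>" k] by simp
    have "(\<integral>x. \<bar>v k (Suc (?c x) mod ?n) - w x\<bar> \<partial>J)
        \<le> (\<integral>x. \<bar>v k (Suc (?c x) mod ?n) - v k (?c x)\<bar> + \<bar>v k (?c x) - w x\<bar> \<partial>J)"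
      using step_int[of "v k" k] w step_int[of "\<lambda>i. v k (Suc i mod ?n)" k]
      by (intro integral_mono) auto
    also have "\<dots> = (\<integral>x. \<bar>v k (Suc (?c x) mod ?n) - v k (?c x)\<bar> \<partial>J) + ?S k"
      using step_int[of "v k" k] w step_int[of "\<lambda>i. v k (Suc i mod ?n)" k]
      by (intro Bochner_Integration.integral_add) auto
    also have "\<dots> < e" using 3 k(1) d unfolding d_def by linarith
    finally show "norm ((\<integral>x. \<bar>v k (Suc (cell (1 / real (N k)) x) mod N k) - w x\<bar> \<partial>J) - 0) < e"
      by (simp add: h_def)
  qed
  then show "\<exists>no. \<forall>n\<ge>no. norm ((\<integral>x. \<bar>v n (Suc (cell (1 / real (N n)) x) mod N n) - w x\<bar> \<partial>J) - 0) < e"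
    by (auto simp: eventually_sequentially)
qed

section \<open>Uniform bound for the scheme\<close>

lemma lipschitz_on_pair_bound:
  fixes g :: "real \<Rightarrow> real \<Rightarrow> real"
  assumes "L-lipschitz_on UNIV (\<lambda>(u, v). g u v)"
  shows "\<bar>g a b - g c d\<bar> \<le> L * (\<bar>a - c\<bar> + \<bar>b - d\<bar>)"
proof -
  have "dist (g a b) (g c d) \<le> L * dist (a, b) (c, d)"
    using lipschitz_onD[OF assms, of "(a, b)" "(c, d)"] by simp
  moreover have "dist (a, b) (c, d) \<le> \<bar>a - c\<bar> + \<bar>b - d\<bar>"
    using sqrt_sum_squares_le_sum_abs[of "a - c" "b - d"] by (simp add: dist_Pair_Pair dist_real_def)
  moreover have "L \<ge> 0" using assms by (rule lipschitz_on_nonneg)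
  ultimately show ?thesis
    by (smt (verit) dist_real_def mult_left_mono)
qed

text \<open>The derivative of \<open>f\<close> in \<open>x\<close> is that of \<open>F\<close> on the diagonal, hence Lipschitz in the state. The
  growth is therefore at most linear in \<open>m\<close>, uniformly in \<open>x\<close>; this is what makes the discrete
  Gronwall argument global.\<close>

lemma flux_increment_bound:
  assumes C2: "C_k 2 (\<lambda>(x, v). f x v)" and nf: "numerical_flux f F"
  obtains C a where "C \<ge> 0" "a \<ge> 0"
    "\<And>x y m. x \<in> {0..1} \<Longrightarrow> y \<in> {0..1} \<Longrightarrow> \<bar>f x m - f y m\<bar> \<le> (C + a * \<bar>m\<bar>) * \<bar>x - y\<bar>"
proof -
  obtain L where L: "\<And>x. L-lipschitz_on UNIV (\<lambda>(u, v). deriv (\<lambda>y. F y u v) x)"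
    using nf unfolding numerical_flux_def by blast
  have L0: "L \<ge> 0" using L[of 0] by (rule lipschitz_on_nonneg)
  have C2': "C_k (Suc (Suc 0)) (\<lambda>(x, v). f x v)" using C2 by (simp add: numeral_2_eq_2)
  let ?D = "\<lambda>x m. deriv (\<lambda>y. f y m) x"
  have FD: "deriv (\<lambda>y. F y m m) x = ?D x m" for x m
    using nf unfolding numerical_flux_def by simp
  have "continuous_on UNIV (\<lambda>x. ?D x 0)"
    using continuous_on_compose2[OF C_k_continuous_partial_fst[OF C2'], of UNIV "\<lambda>x. (x, 0)"]
    by (simp add: continuous_on_Pair)
  then have "compact ((\<lambda>x. ?D x 0) ` {0..1})"
    by (intro compact_continuous_image) (auto intro: continuous_on_subset)
  then obtain C where C: "\<And>x. x \<in> {0..1} \<Longrightarrow> \<bar>?D x 0\<bar> \<le> C"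
    by (meson bounded_real compact_imp_bounded imageI)
  have bd: "\<bar>?D x m\<bar> \<le> \<bar>C\<bar> + 2 * L * \<bar>m\<bar>" if "x \<in> {0..1}" for x m
    using lipschitz_on_pair_bound[OF L[of x], of m m 0 0] C[OF that] by (simp add: FD)
  have "\<bar>f x m - f y m\<bar> \<le> (\<bar>C\<bar> + 2 * L * \<bar>m\<bar>) * \<bar>x - y\<bar>" if "x \<in> {0..1}" "y \<in> {0..1}" for x y m
  proof -
    have "norm (f x m - f y m) \<le> (\<bar>C\<bar> + 2 * L * \<bar>m\<bar>) * norm (x - y)"
    proof (rule field_differentiable_bound[where S="{0..1}" and f'="\<lambda>x. ?D x m" and f="\<lambda>x. f x m"])
      show "((\<lambda>x. f x m) has_field_derivative ?D z m) (at z within {0..1})" for z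
        using C_k_partial_fst[OF C2'] by (rule DERIV_subset) auto
      show "norm (?D z m) \<le> \<bar>C\<bar> + 2 * L * \<bar>m\<bar>" if "z \<in> {0..1}" for z
        using bd[OF that, of m] by simp
    qed (use that in auto)
    then show ?thesis by simp
  qed
  then show thesis using that[of "\<bar>C\<bar>" "2 * L"] L0 by auto
qed

lemma mesh_pos: "N > 0 \<Longrightarrow> mesh_dx N > 0" "T > 0 \<Longrightarrow> mesh_dt T M > 0"
  by (simp_all add: mesh_dx_def mesh_dt_def)

lemma mesh_ratio_dx: "N > 0 \<Longrightarrow> mesh_ratio T N M * mesh_dx N = mesh_dt T M"
  by (simp add: mesh_ratio_def mesh_dx_def)

lemma Psi_mono:
  assumes "CFL_condition F c T N M" "j \<in> {1..N}" "a \<le> a'" "b \<le> b'" "d \<le> d'"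
  shows "Psi F (mesh_ratio T N M) N j a b d \<le> Psi F (mesh_ratio T N M) N j a' b' d'"
proof -
  let ?P = "Psi F (mesh_ratio T N M) N j"
  have "mono (\<lambda>u. ?P u b d)" "mono (\<lambda>v. ?P a' v d)" "mono (\<lambda>w. ?P a' b' w)"
    using assms(1,2) unfolding CFL_condition_def by blast+
  then have "?P a b d \<le> ?P a' b d" "?P a' b d \<le> ?P a' b' d" "?P a' b' d \<le> ?P a' b' d'"
    using assms(3-) by (auto dest: monoD)
  then show ?thesis by linarith
qed

lemma Psi_diagonal:
  assumes "numerical_flux f F"
  shows "Psi F r N j m m m = m - r * (f (x_half N j) m - f (x_half N (j - 1)) m)"
  using assms unfolding Psi_def numerical_flux_def by simp

lemma scheme_Suc_Psi:
  fixes F :: "real \<Rightarrow> real \<Rightarrow> real \<Rightarrow> real" and u0 :: "real \<Rightarrow> real" and T :: real and M :: nat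
  assumes "j \<in> {1..N}"
  defines "e \<equiv> \<lambda>n. periodic_ext N (scheme F u0 T N M n)"
  shows "scheme F u0 T N M (Suc n) j
       = Psi F (mesh_ratio T N M) N j (e n (j - 1)) (e n j) (e n (j + 1))
         + mesh_dt T M * P_disc N (scheme F u0 T N M n) j"
proof -
  have "e n j = scheme F u0 T N M n j" using assms(1) by (simp add: e_def periodic_ext_def)
  then show ?thesis using assms(1) by (simp add: Psi_def num_flux_def e_def)
qed

text \<open>The first part of the nonlocal term integrates values bounded by \<open>m\<close> over a piece of the unit
  interval, and the second is a mean of such integrals.\<close>

lemma abs_P_disc_le:
  assumes N: "N > 0" and v: "\<And>j. j \<in> {1..N} \<Longrightarrow> \<bar>v j\<bar> \<le> m" and j: "j \<in> {1..N}"
  shows "\<bar>P_disc N v j\<bar> \<le> 2 * m"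
proof -
  let ?S = "\<lambda>j. (\<Sum>i=1..<j. v i) + v j / 2"
  have m: "m \<ge> 0" using v[OF j] by linarith
  have S: "\<bar>?S l\<bar> \<le> real N * m" if l: "l \<in> {1..N}" for l
  proof -
    have "\<bar>\<Sum>i=1..<l. v i\<bar> \<le> (\<Sum>i=1..<l. \<bar>v i\<bar>)" by (rule sum_abs)
    also have "\<dots> \<le> (\<Sum>i=1..<l. m)" using l by (intro sum_mono v) auto
    also have "\<dots> = real (l - 1) * m" by simp
    finally have "\<bar>?S l\<bar> \<le> real (l - 1) * m + m" using v[OF l] m by linarith
    also have "\<dots> = real l * m" using l by (simp add: of_nat_diff algebra_simps)
    also have "\<dots> \<le> real N * m" using l m by (intro mult_right_mono) auto
    finally show ?thesis .
  qed
  have d: "mesh_dx N > 0" "mesh_dx N * real N = 1" using N by (auto simp: mesh_dx_def)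
  have dS: "\<bar>mesh_dx N * ?S l\<bar> \<le> m" if l: "l \<in> {1..N}" for l
  proof -
    have "\<bar>mesh_dx N * ?S l\<bar> \<le> mesh_dx N * (real N * m)"
      using S[OF l] d(1) by (simp add: abs_mult mult_left_mono)
    then show ?thesis using d(2) by (simp add: mult.assoc[symmetric])
  qed
  have "\<bar>mesh_dx N * (\<Sum>l=1..N. mesh_dx N * ?S l)\<bar> \<le> m"
  proof -
    have "\<bar>\<Sum>l=1..N. mesh_dx N * ?S l\<bar> \<le> (\<Sum>l=1..N. \<bar>mesh_dx N * ?S l\<bar>)" by (rule sum_abs)
    also have "\<dots> \<le> (\<Sum>l=1..N. m)" by (intro sum_mono dS)
    also have "\<dots> = real N * m" by simp
    finally have "\<bar>mesh_dx N * (\<Sum>l=1..N. mesh_dx N * ?S l)\<bar> \<le> mesh_dx N * (real N * m)"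
      using d(1) by (simp add: abs_mult mult_left_mono)
    then show ?thesis using d(2) by (simp add: mult.assoc[symmetric])
  qed
  moreover have "P_disc N v j = mesh_dx N * ?S j - mesh_dx N * (\<Sum>l=1..N. mesh_dx N * ?S l)"
    unfolding P_disc_def by (simp add: sum_distrib_left[symmetric] power2_eq_square)
  ultimately show ?thesis using dS[OF j] by linarith
qed

lemma periodic_ext_bound:
  assumes "N > 0" "\<And>j. j \<in> {1..N} \<Longrightarrow> \<bar>v j\<bar> \<le> m" "j \<le> N + 1"
  shows "\<bar>periodic_ext N v j\<bar> \<le> m"
  using assms by (auto simp: periodic_ext_def)

text \<open>The constants \<open>m n\<close> and \<open>- m n\<close> are barriers: if they enclose the values at time level \<open>n\<close>,
  monotonicity encloses the next level between the images of the two constants, which move by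
  \<open>O(\<Delta>t (1 + m n))\<close>. The closed form of \<open>m\<close> in the proof is chosen to absorb exactly these
  increments.\<close>

lemma scheme_bounded:
  assumes C2: "C_k 2 (\<lambda>(x, v). f x v)" and nf: "numerical_flux f F" and T: "T > 0" and K0: "K0 \<ge> 0"
  obtains K where "\<And>N M n j. N > 0 \<Longrightarrow> CFL_condition F c T N M \<Longrightarrow>
      (\<And>j. j \<in> {1..N} \<Longrightarrow> \<bar>scheme F u0 T N M 0 j\<bar> \<le> K0) \<Longrightarrow> n \<le> Suc M \<Longrightarrow> j \<in> {1..N} \<Longrightarrow>
      \<bar>scheme F u0 T N M n j\<bar> \<le> K"
proof -
  obtain C a where C: "C \<ge> 0" and a: "a \<ge> 0" and
    grow: "\<And>x y m. x \<in> {0..1} \<Longrightarrow> y \<in> {0..1} \<Longrightarrow> \<bar>f x m - f y m\<bar> \<le> (C + a * \<bar>m\<bar>) * \<bar>x - y\<bar>"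
    using flux_increment_bound[OF C2 nf] by metis
  \<comment> \<open>the summand 2 accounts for the nonlocal term, by \<open>abs_P_disc_le\<close>\<close>
  define b where "b = a + 2"
  have "\<bar>scheme F u0 T N M n j\<bar> \<le> (K0 + C) * exp (b * T)"
    if N: "N > 0" and CFL: "CFL_condition F c T N M"
      and init: "\<And>j. j \<in> {1..N} \<Longrightarrow> \<bar>scheme F u0 T N M 0 j\<bar> \<le> K0"
      and n: "n \<le> Suc M" and j: "j \<in> {1..N}" for N M n j
  proof -
    let ?dt = "mesh_dt T M" and ?dx = "mesh_dx N" and ?r = "mesh_ratio T N M"
    let ?V = "scheme F u0 T N M"
    have dt: "?dt > 0" and dx: "?dx > 0" using mesh_pos N T by auto
    have r: "?r * ?dx = ?dt" by (rule mesh_ratio_dx[OF N])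
    have r0: "?r > 0" using dt dx by (simp add: mesh_ratio_def)
    define q where "q = 1 + b * ?dt"
    have q1: "q \<ge> 1" using a dt by (simp add: q_def b_def)
    define m where "m n = (K0 + C) * q ^ n - C" for n
    have m0: "m n \<ge> 0" for n
    proof -
      have "(K0 + C) * 1 \<le> (K0 + C) * q ^ n"
        using q1 K0 C by (intro mult_left_mono one_le_power) auto
      then show ?thesis using K0 by (simp add: m_def)
    qed
    have mS: "m n + ?dt * (C + b * m n) \<le> m (Suc n)" for n
    proof -
      have "m (Suc n) = q * (m n + C) - C" by (simp add: m_def)
      also have "\<dots> = m n + ?dt * (b * C + b * m n)" by (simp add: q_def algebra_simps)
      finally have "m (Suc n) = m n + ?dt * (b * C + b * m n)" .
      moreover have "C \<le> b * C" using C a mult_right_mono[of 1 b C] by (simp add: b_def)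
      ultimately show ?thesis using dt by simp
    qed
    have "\<bar>?V n j\<bar> \<le> m n" if "j \<in> {1..N}" for n j
      using that
    proof (induction n arbitrary: j)
      case 0
      then show ?case using init by (simp add: m_def)
    next
      case (Suc n)
      let ?e = "periodic_ext N (?V n)"
      have e: "\<bar>?e i\<bar> \<le> m n" if "i \<le> N + 1" for i
        using periodic_ext_bound[OF N Suc.IH that] by simp
      have xs: "x_half N j \<in> {0..1}" "x_half N (j - 1) \<in> {0..1}" "x_half N j - x_half N (j - 1) = ?dx"
        using Suc.prems N by (auto simp: x_half_def mesh_dx_def of_nat_diff field_simps)
      have diag: "\<bar>Psi F ?r N j s s s - s\<bar> \<le> ?dt * (C + a * \<bar>s\<bar>)" for s
      proof -
        have "\<bar>Psi F ?r N j s s s - s\<bar> = ?r * \<bar>f (x_half N j) s - f (x_half N (j - 1)) s\<bar>"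
          using r0 by (simp add: Psi_diagonal[OF nf] abs_mult)
        also have "\<dots> \<le> ?r * ((C + a * \<bar>s\<bar>) * ?dx)"
          using grow[OF xs(1,2), of s] xs(3) dx r0 by (intro mult_left_mono) auto
        also have "\<dots> = ?dt * (C + a * \<bar>s\<bar>)" by (simp add: r[symmetric])
        finally show ?thesis .
      qed
      let ?P = "Psi F ?r N j (?e (j - 1)) (?e j) (?e (j + 1))"
      have ej: "\<bar>?e (j - 1)\<bar> \<le> m n" "\<bar>?e j\<bar> \<le> m n" "\<bar>?e (j + 1)\<bar> \<le> m n"
        using Suc.prems by (auto intro!: e)
      have "?P \<le> Psi F ?r N j (m n) (m n) (m n)" "Psi F ?r N j (- m n) (- m n) (- m n) \<le> ?P"
        using ej by (auto intro!: Psi_mono[OF CFL Suc.prems])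
      then have "\<bar>?P\<bar> \<le> m n + ?dt * (C + a * m n)"
        using diag[of "m n"] diag[of "- m n"] m0[of n] by auto
      moreover have "\<bar>?dt * P_disc N (?V n) j\<bar> \<le> ?dt * (2 * m n)"
        using abs_P_disc_le[OF N Suc.IH Suc.prems] dt by (simp add: abs_mult)
      ultimately have "\<bar>?V (Suc n) j\<bar> \<le> m n + ?dt * (C + a * m n) + ?dt * (2 * m n)"
        unfolding scheme_Suc_Psi[OF Suc.prems] by linarith
      also have "\<dots> = m n + ?dt * (C + b * m n)" by (simp add: b_def algebra_simps)
      also have "\<dots> \<le> m (Suc n)" by (rule mS)
      finally show ?case .
    qed
    then have "\<bar>?V n j\<bar> \<le> m n" using j by blast
    also have "\<dots> \<le> (K0 + C) * q ^ n" using C by (simp add: m_def)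
    also have "\<dots> \<le> (K0 + C) * exp (b * T)"
    proof (intro mult_left_mono)
      have "q ^ n \<le> q ^ Suc M" using q1 n by (rule power_increasing[rotated])
      also have "\<dots> \<le> exp (b * ?dt) ^ Suc M"
        using q1 exp_ge_add_one_self[of "b * ?dt"] unfolding q_def by (intro power_mono) auto
      also have "\<dots> = exp (real (Suc M) * (b * ?dt))" by (rule exp_of_nat_mult[symmetric])
      also have "real (Suc M) * (b * ?dt) = b * T" by (simp add: mesh_dt_def field_simps)
      finally show "q ^ n \<le> exp (b * T)" .
    qed (use K0 C in auto)
    finally show ?thesis .
  qed
  then show thesis by (rule that)
qed

section \<open>Discrete entropy inequality\<close>

text \<open>The Crandall-Majda numerical entropy flux; on the diagonal it is Kruzkov's entropy flux.\<close>

definition num_entropy_flux ::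
  "(real \<Rightarrow> real \<Rightarrow> real \<Rightarrow> real) \<Rightarrow> real \<Rightarrow> real \<Rightarrow> real \<Rightarrow> real \<Rightarrow> real" where
  "num_entropy_flux F k x a b = F x (max a k) (max b k) - F x (min a k) (min b k)"

text \<open>Both \<open>\<Psi>\<^sub>j(a, b, d)\<close> and \<open>\<Psi>\<^sub>j(k, k, k)\<close> lie between the images of the componentwise minima
  and maxima with \<open>k\<close>, so the distance of the former two is at most that of the latter two. The
  sign is taken of the new value \<open>b' - k\<close>, with the source \<open>p\<close> already added, because this
  choice produces \<open>\<bar>b' - k\<bar>\<close> in the lower bound for the distance.\<close>

lemma cell_entropy_inequality:
  fixes a b d p k T :: real and F :: "real \<Rightarrow> real \<Rightarrow> real \<Rightarrow> real" and N M :: nat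
  assumes CFL: "CFL_condition F c T N M" and nf: "numerical_flux f F" and j: "j \<in> {1..N}"
  defines "r \<equiv> mesh_ratio T N M" and "x \<equiv> x_half N j" and "x' \<equiv> x_half N (j - 1)"
  defines "b' \<equiv> Psi F r N j a b d + p"
  shows "\<bar>b' - k\<bar> \<le> \<bar>b - k\<bar> - r * (num_entropy_flux F k x b d - num_entropy_flux F k x' a b)
      - sgn (b' - k) * (r * (f x k - f x' k) - p)"
proof -
  let ?P = "Psi F r N j"
  have diag: "?P k k k = k - r * (f x k - f x' k)"
    using Psi_diagonal[OF nf] by (simp add: x_def x'_def)
  have "?P a b d \<le> ?P (max a k) (max b k) (max d k)" "?P k k k \<le> ?P (max a k) (max b k) (max d k)"
    "?P (min a k) (min b k) (min d k) \<le> ?P a b d" "?P (min a k) (min b k) (min d k) \<le> ?P k k k"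
    unfolding r_def by (intro Psi_mono[OF CFL j]; simp)+
  then have "\<bar>?P a b d - ?P k k k\<bar> \<le> ?P (max a k) (max b k) (max d k) - ?P (min a k) (min b k) (min d k)"
    by linarith
  also have "\<dots> = \<bar>b - k\<bar> - r * (num_entropy_flux F k x b d - num_entropy_flux F k x' a b)"
    by (simp add: Psi_def num_entropy_flux_def x_def x'_def max_def min_def algebra_simps)
  finally have 1: "\<bar>?P a b d - ?P k k k\<bar> \<le> \<dots>" .
  have "sgn (b' - k) * (?P a b d - ?P k k k) \<le> \<bar>?P a b d - ?P k k k\<bar>"
    by (auto simp: sgn_if)
  moreover have "?P a b d - ?P k k k = (b' - k) + (r * (f x k - f x' k) - p)"
    by (simp add: diag b'_def)
  ultimately have "sgn (b' - k) * (b' - k) + sgn (b' - k) * (r * (f x k - f x' k) - p) \<le> \<bar>?P a b d - ?P k k k\<bar>"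
    by (simp only: distrib_left)
  moreover have "sgn (b' - k) * (b' - k) = \<bar>b' - k\<bar>" by (simp add: sgn_if abs_if)
  ultimately show ?thesis using 1 by linarith
qed

lemma summation_by_parts_periodic:
  fixes Q \<psi> :: "nat \<Rightarrow> real"
  assumes "Q N = Q 0" "\<psi> N = \<psi> 0"
  shows "(\<Sum>i<N. \<psi> i * (Q (Suc i) - Q i)) = - (\<Sum>i<N. Q (Suc i) * (\<psi> (Suc i) - \<psi> i))"
proof -
  have "(\<Sum>i<N. \<psi> i * (Q (Suc i) - Q i)) + (\<Sum>i<N. Q (Suc i) * (\<psi> (Suc i) - \<psi> i))
     = (\<Sum>i<N. \<psi> (Suc i) * Q (Suc i) - \<psi> i * Q i)"
    by (simp add: sum.distrib[symmetric] algebra_simps)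
  also have "\<dots> = 0" using assms by (simp add: sum_lessThan_telescope[of "\<lambda>i. \<psi> i * Q i"])
  finally show ?thesis by linarith
qed

text \<open>The value on one cell of the integrand of the discrete entropy inequality. Time differences fall
  on the test function at the two time levels, whereas the spatial differences and the sources are
  weighted by its value at the new level.\<close>

definition discrete_entropy_density where
  "discrete_entropy_density f F u0 T N M k \<psi> n i =
    (let V = scheme F u0 T N M; e = periodic_ext N (V n); dt = mesh_dt T M; dx = mesh_dx N in
       \<bar>V n (Suc i) - k\<bar> * ((\<psi> (Suc n) i - \<psi> n i) / dt)
     + num_entropy_flux F k (x_half N (Suc i)) (V n (Suc i)) (e (Suc (Suc i)))
         * ((\<psi> (Suc n) (Suc i) - \<psi> (Suc n) i) / dx)
     - sgn (V (Suc n) (Suc i) - k) * ((f (x_half N (Suc i)) k - f (x_half N i) k) / dx) * \<psi> (Suc n) i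
     + sgn (V (Suc n) (Suc i) - k) * P_disc N (V n) (Suc i) * \<psi> (Suc n) i)"

text \<open>The cell inequality, weighted by \<open>\<psi>\<close> at the new time level, is summed over the cells; summation
  by parts in space leaves no boundary term because everything is periodic, and in time it leaves
  the first and last level.\<close>

lemma discrete_entropy_inequality:
  fixes \<psi> :: "nat \<Rightarrow> nat \<Rightarrow> real"
  assumes CFL: "CFL_condition F c T N M" and nf: "numerical_flux f F" and N: "N > 0" and T: "T > 0"
    and \<psi>0: "\<And>n i. n \<le> m \<Longrightarrow> \<psi> n i \<ge> 0" and \<psi>per: "\<And>n. \<psi> n N = \<psi> n 0"
  shows "(\<Sum>i<N. mesh_dx N * (\<bar>scheme F u0 T N M m (Suc i) - k\<bar> * \<psi> m i))
       - (\<Sum>i<N. mesh_dx N * (\<bar>scheme F u0 T N M 0 (Suc i) - k\<bar> * \<psi> 0 i))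
     \<le> (\<Sum>n<m. \<Sum>i<N. mesh_dt T M * mesh_dx N * discrete_entropy_density f F u0 T N M k \<psi> n i)"
  using \<psi>0
proof (induction m)
  case (Suc n)
  let ?dt = "mesh_dt T M" and ?dx = "mesh_dx N" and ?r = "mesh_ratio T N M"
  let ?V = "scheme F u0 T N M"
  let ?e = "periodic_ext N (?V n)"
  have dt: "?dt > 0" and dx: "?dx > 0" using mesh_pos N T by auto
  define Q where "Q i = num_entropy_flux F k (x_half N i) (?e i) (?e (Suc i))" for i
  define s where "s i = sgn (?V (Suc n) (Suc i) - k)" for i
  define \<Delta> where "\<Delta> i = f (x_half N (Suc i)) k - f (x_half N i) k" for i
  define P where "P i = P_disc N (?V n) (Suc i)" for i
  define A where "A n i = \<bar>?V n (Suc i) - k\<bar>" for n i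
  have eV: "?e (Suc i) = ?V n (Suc i)" if "i < N" for i using that by (simp add: periodic_ext_def)
  have QN: "Q N = Q 0"
  proof -
    have "F (x_half N N) = F (x_half N 0)"
    proof (intro ext)
      fix u v
      have "F (0 + 1) u v = F 0 u v" using nf unfolding numerical_flux_def by blast
      then show "F (x_half N N) u v = F (x_half N 0) u v" using N by (simp add: x_half_def mesh_dx_def)
    qed
    then show ?thesis using N by (simp add: Q_def num_entropy_flux_def periodic_ext_def)
  qed
  have cell: "A (Suc n) i \<le> A n i - ?r * (Q (Suc i) - Q i) - s i * (?r * \<Delta> i - ?dt * P i)" if i: "i < N" for i
  proof -
    have j: "Suc i \<in> {1..N}" using i by simp
    from cell_entropy_inequality[OF CFL nf j, of "?e i" "?e (Suc i)" "?e (Suc (Suc i))" "?dt * P i" k]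
    show ?thesis
      using scheme_Suc_Psi[OF j, of F u0 T M n] eV[OF i] unfolding A_def Q_def s_def \<Delta>_def P_def by simp
  qed
  have "?dx * (A (Suc n) i * \<psi> (Suc n) i) - ?dx * (A n i * \<psi> n i)
     \<le> ?dt * ?dx * (A n i * ((\<psi> (Suc n) i - \<psi> n i) / ?dt)) - ?dt * (\<psi> (Suc n) i * (Q (Suc i) - Q i))
       - ?dt * ?dx * (s i * (\<Delta> i / ?dx) * \<psi> (Suc n) i - s i * P i * \<psi> (Suc n) i)" if i: "i < N" for i
  proof -
    have "?dx * \<psi> (Suc n) i * A (Suc n) i
        \<le> ?dx * \<psi> (Suc n) i * (A n i - ?r * (Q (Suc i) - Q i) - s i * (?r * \<Delta> i - ?dt * P i))"
      using cell[OF i] dx Suc.prems[of "Suc n" i] by (intro mult_left_mono) auto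
    also have "\<dots> = ?dx * \<psi> (Suc n) i * A n i - (?r * ?dx) * (\<psi> (Suc n) i * (Q (Suc i) - Q i))
       - s i * ((?r * ?dx) * \<Delta> i * \<psi> (Suc n) i - ?dx * ?dt * P i * \<psi> (Suc n) i)"
      by (simp add: algebra_simps)
    finally have "?dx * \<psi> (Suc n) i * A (Suc n) i \<le> \<dots>" .
    moreover have "?dt * ?dx * (A n i * ((\<psi> (Suc n) i - \<psi> n i) / ?dt))
        = ?dx * (A n i * \<psi> (Suc n) i) - ?dx * (A n i * \<psi> n i)"
      using dt by (simp add: field_simps)
    moreover have "?dt * ?dx * (s i * (\<Delta> i / ?dx) * \<psi> (Suc n) i - s i * P i * \<psi> (Suc n) i)
        = s i * (?dt * \<Delta> i * \<psi> (Suc n) i - ?dx * ?dt * P i * \<psi> (Suc n) i)"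
      using dx by (simp add: field_simps)
    ultimately show ?thesis
      unfolding mesh_ratio_dx[OF N] by (simp add: mult_ac)
  qed
  then have "(\<Sum>i<N. ?dx * (A (Suc n) i * \<psi> (Suc n) i) - ?dx * (A n i * \<psi> n i))
     \<le> (\<Sum>i<N. ?dt * ?dx * (A n i * ((\<psi> (Suc n) i - \<psi> n i) / ?dt)) - ?dt * (\<psi> (Suc n) i * (Q (Suc i) - Q i))
       - ?dt * ?dx * (s i * (\<Delta> i / ?dx) * \<psi> (Suc n) i - s i * P i * \<psi> (Suc n) i))"
    by (intro sum_mono) auto
  also have "\<dots> = (\<Sum>i<N. ?dt * ?dx * (A n i * ((\<psi> (Suc n) i - \<psi> n i) / ?dt)))
      - ?dt * (\<Sum>i<N. \<psi> (Suc n) i * (Q (Suc i) - Q i))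
      - (\<Sum>i<N. ?dt * ?dx * (s i * (\<Delta> i / ?dx) * \<psi> (Suc n) i - s i * P i * \<psi> (Suc n) i))"
    by (simp only: sum_subtractf sum_distrib_left)
  also have "\<dots> = (\<Sum>i<N. ?dt * ?dx * (A n i * ((\<psi> (Suc n) i - \<psi> n i) / ?dt)))
      + (\<Sum>i<N. ?dt * ?dx * (Q (Suc i) * ((\<psi> (Suc n) (Suc i) - \<psi> (Suc n) i) / ?dx)))
      - (\<Sum>i<N. ?dt * ?dx * (s i * (\<Delta> i / ?dx) * \<psi> (Suc n) i - s i * P i * \<psi> (Suc n) i))"
    using dx by (simp add: summation_by_parts_periodic[OF QN \<psi>per] sum_distrib_left sum_negf)
  also have "\<dots> = (\<Sum>i<N. ?dt * ?dx * discrete_entropy_density f F u0 T N M k \<psi> n i)"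
    unfolding sum.distrib[symmetric] sum_subtractf[symmetric]
    by (intro sum.cong refl)
       (simp add: discrete_entropy_density_def Let_def A_def Q_def s_def \<Delta>_def P_def eV algebra_simps)
  finally show ?case
    using Suc.IH Suc.prems unfolding A_def by (simp add: sum_subtractf)
qed simp

section \<open>Integrals up to null sets\<close>

text \<open>Lebesgue measure is complete, so two functions that agree almost everywhere are both measurable
  or both not, and in the latter case both integrals are 0. This permits changing the domains of
  the integrals in the definition of an entropy solution by null sets before anything is known
  about measurability.\<close>

lemma lebesgue_integral_cong_AE:
  fixes f g :: "'a::euclidean_space \<Rightarrow> real"
  assumes "AE x in lebesgue. f x = g x"
  shows "integral\<^sup>L lebesgue f = integral\<^sup>L lebesgue g"
proof (cases "f \<in> borel_measurable lebesgue")
  case True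
  then have "g \<in> borel_measurable lebesgue" using assms by (rule borel_measurable_AE)
  with True show ?thesis using assms by (intro integral_cong_AE)
next
  case False
  have "AE x in lebesgue. g x = f x" using assms by eventually_elim simp
  then have "g \<notin> borel_measurable lebesgue" using False borel_measurable_AE by blast
  then show ?thesis using False
    by (metis borel_measurable_integrable not_integrable_integral_eq)
qed

lemma set_integral_spike:
  fixes f :: "'a::euclidean_space \<Rightarrow> real"
  assumes "AE x in lebesgue. x \<in> A \<longleftrightarrow> x \<in> B" and B: "B \<in> sets lebesgue"
  shows "set_lebesgue_integral lebesgue A f = integral\<^sup>L (lebesgue_on B) f"
proof -
  have "set_lebesgue_integral lebesgue A f = set_lebesgue_integral lebesgue B f"
    unfolding set_lebesgue_integral_def
    by (rule lebesgue_integral_cong_AE) (use assms(1) in eventually_elim, auto simp: indicator_def)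
  then show ?thesis using B by (simp add: integral_restrict_space set_lebesgue_integral_def)
qed

lemma AE_lebesgue_neq: "AE x in lebesgue. x \<noteq> (c::real)"
  using AE_not_in[of "{c}" lebesgue] by simp

lemma unit_intervals_ae_eq:
  "AE x in lebesgue. x \<in> {0<..<1} \<longleftrightarrow> x \<in> {0..<1::real}"
  "AE x in lebesgue. x \<in> {0..1} \<longleftrightarrow> x \<in> {0..<1::real}"
  using AE_lebesgue_neq[of 0] AE_lebesgue_neq[of 1] by (auto elim: eventually_mono)

lemma L1_dist_eq: "L1_dist v w = (\<integral>x. \<bar>v x - w x\<bar> \<partial>lebesgue_on {0..<1})"
  unfolding L1_dist_def by (rule set_integral_spike[OF unit_intervals_ae_eq(1)]) simp

lemma AE_Pi_T: "AE p in lebesgue. p \<in> Pi_T T \<longleftrightarrow> p \<in> {0..<T} \<times> {0..<1}"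
proof -
  have "negligible {p :: real \<times> real. p \<bullet> (1, 0) = T}" "negligible {p :: real \<times> real. p \<bullet> (0, 1) = 1}"
    by (rule negligible_standard_hyperplane; simp add: Basis_prod_def)+
  then have "AE p in lebesgue. p \<notin> {p :: real \<times> real. p \<bullet> (1, 0) = T}"
    "AE p in lebesgue. p \<notin> {p :: real \<times> real. p \<bullet> (0, 1) = 1}"
    by (auto simp only: negligible_iff_null_sets intro!: AE_not_in)
  then show ?thesis
    by eventually_elim (auto simp: Pi_T_def)
qed

lemma integrable_unit_interval:
  fixes g :: "real \<Rightarrow> real"
  assumes "set_integrable lebesgue {0<..<1} g"
  shows "integrable (lebesgue_on {0..<1}) g"
proof -
  have "integrable lebesgue (\<lambda>x. indicator {0<..<1} x *\<^sub>R g x + indicator {0} x *\<^sub>R g 0)"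
    using assms unfolding set_integrable_def by (intro Bochner_Integration.integrable_add) auto
  also have "(\<lambda>x. indicator {0<..<1} x *\<^sub>R g x + indicator {0} x *\<^sub>R g 0)
     = (\<lambda>x. indicator {0..<1} x *\<^sub>R g x)"
    by (auto simp: fun_eq_iff indicator_def)
  finally show ?thesis by (subst integrable_restrict_space) auto
qed

section \<open>Limit of the discrete nonlocal term\<close>

lemma cell_point_tendsto:
  assumes h: "h \<longlonglongrightarrow> 0" "\<And>k::nat. h k > 0" and s: "s \<ge> 0"
  shows "(\<lambda>k. real (cell (h k) s) * h k) \<longlonglongrightarrow> s" "(\<lambda>k. real (Suc (cell (h k) s)) * h k) \<longlonglongrightarrow> s"
proof -
  have b: "real (cell (h k) s) * h k \<le> s" "s < real (Suc (cell (h k) s)) * h k" for k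
    using cell_bounds[OF h(2) s] by auto
  have lower: "s - h k < real (cell (h k) s) * h k" for k using b(2)[of k] by (simp add: algebra_simps)
  have "(\<lambda>k. s - h k) \<longlonglongrightarrow> s - 0" using h(1) by (intro tendsto_intros)
  show 1: "(\<lambda>k. real (cell (h k) s) * h k) \<longlonglongrightarrow> s"
  proof (rule tendsto_sandwich[where f="\<lambda>k. s - h k" and h="\<lambda>_. s", rotated 2])
    show "(\<lambda>k. s - h k) \<longlonglongrightarrow> s" using \<open>(\<lambda>k. s - h k) \<longlonglongrightarrow> s - 0\<close> by simp
  qed (use lower b(1) in \<open>simp_all add: less_imp_le\<close>)
  show "(\<lambda>k. real (Suc (cell (h k) s)) * h k) \<longlonglongrightarrow> s"
    using tendsto_add[OF 1 h(1)] by (simp add: algebra_simps)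
qed

text \<open>Up to half a cell, the first part of \<open>P_disc\<close> is the integral of the step function up to the left
  end point of the cell, and the second part is the mean over all cells of the first. Thus the
  limit of the second part follows from that of the first by bounded convergence; the inner
  integral is measurable as a limit of step functions.\<close>

lemma P_disc_tendsto:
  fixes v :: "nat \<Rightarrow> nat \<Rightarrow> real" and N :: "nat \<Rightarrow> nat" and w :: "real \<Rightarrow> real"
  assumes N: "\<And>k. N k > 0" and mesh: "(\<lambda>k. mesh_dx (N k)) \<longlonglongrightarrow> 0"
    and vK: "\<And>k j. j \<in> {1..N k} \<Longrightarrow> \<bar>v k j\<bar> \<le> K"
    and w: "integrable (lebesgue_on {0..<1}) w"
    and lim: "(\<lambda>k. \<integral>x. \<bar>v k (Suc (cell (mesh_dx (N k)) x)) - w x\<bar> \<partial>lebesgue_on {0..<1}) \<longlonglongrightarrow> 0"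
    and x: "0 \<le> x" "x < 1"
  shows "(\<lambda>k. P_disc (N k) (v k) (Suc (cell (mesh_dx (N k)) x)))
     \<longlonglongrightarrow> (LINT y:{0..x}|lebesgue. w y) - (LINT y:{0..1}|lebesgue. (LINT z:{0..y}|lebesgue. w z))"
proof -
  let ?h = "\<lambda>k. mesh_dx (N k)"
  let ?c = "\<lambda>k y. cell (?h k) y"
  let ?J = "lebesgue_on {0..<1::real}"
  define U where "U k y = v k (Suc (?c k y))" for k y
  define S where "S k i = ?h k * ((\<Sum>l=1..<Suc i. v k l) + v k (Suc i) / 2)" for k i
  have h: "?h k > 0" "real (N k) * ?h k = 1" for k using N[of k] by (auto simp: mesh_dx_def)
  have K: "K \<ge> 0" using vK[of 1 0] N[of 0] by auto
  have cN: "?c k y < N k" if "0 \<le> y" "y < 1" for k y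
    using cell_less[OF h(1) that(1), of "N k" k] that(2) by (simp add: h(2))
  have Uint: "integrable ?J (U k)" for k
    using step_integrable[OF h(1)[of k], where m="N k" and v="\<lambda>i. v k (Suc i)"] by (simp add: h(2) U_def[abs_def])
  have restr: "(\<integral>z. g z \<partial>lebesgue_on {0..<a}) = (\<integral>z. indicator {0..<a} z * g z \<partial>?J)"
    if "a \<le> 1" for a and g :: "real \<Rightarrow> real"
    using that by (simp add: integral_restrict_space) 
       (intro Bochner_Integration.integral_cong, auto simp: indicator_def)
  have S_lim: "(\<lambda>k. S k (?c k y)) \<longlonglongrightarrow> (LINT z:{0..y}|lebesgue. w z)" if y: "0 \<le> y" "y < 1" for y
  proof -
    let ?a = "\<lambda>k. real (?c k y) * ?h k"
    have a1: "?a k \<le> y" for k using cell_bounds(1)[OF h(1) y(1)] .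
    have a: "?a \<longlonglongrightarrow> y" by (rule cell_point_tendsto(1)[OF mesh h(1) y(1)])
    let ?I = "\<lambda>g k. \<integral>z. indicator {0..<?a k} z * g z \<partial>?J"
    have ind_int: "integrable ?J (\<lambda>z. indicator {0..<a} z * g z)" if "integrable ?J g" for a and g :: "real \<Rightarrow> real"
    proof (rule Bochner_Integration.integrable_bound[OF that])
      show "(\<lambda>z. indicator {0..<a} z * g z) \<in> borel_measurable ?J"
        using that by (intro borel_measurable_times borel_imp_lebesgue_on borel_measurable_indicator
            borel_measurable_integrable) auto
    qed (auto simp: indicator_def)
    have 1: "S k (?c k y) = ?I (U k) k + ?h k * v k (Suc (?c k y)) / 2" for k
    proof -
      have "?I (U k) k = (\<Sum>i<?c k y. ?h k * v k (Suc i))"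
        using step_integral[OF h(1)[of k], where m="?c k y" and v="\<lambda>i. v k (Suc i)"] a1[of k] y
        by (subst restr[symmetric]) (auto simp: U_def[abs_def])
      also have "\<dots> = ?h k * (\<Sum>l=1..<Suc (?c k y). v k l)"
        by (simp add: sum_distrib_left atLeastLessThanSuc_atLeastAtMost sum.atLeast1_atMost_eq)
      finally show ?thesis by (simp add: S_def algebra_simps)
    qed
    have "(\<lambda>k. ?h k * v k (Suc (?c k y)) / 2) \<longlonglongrightarrow> 0"
    proof (rule Lim_null_comparison)
      show "eventually (\<lambda>k. norm (?h k * v k (Suc (?c k y)) / 2) \<le> ?h k * K) sequentially"
      proof (intro always_eventually allI)
        fix k
        have "\<bar>v k (Suc (?c k y))\<bar> \<le> K" using cN[OF y, of k] by (intro vK) auto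
        then have "?h k * \<bar>v k (Suc (?c k y))\<bar> \<le> ?h k * K" using h(1)[of k] by (intro mult_left_mono) auto
        moreover have "0 \<le> ?h k * \<bar>v k (Suc (?c k y))\<bar>" using h(1)[of k] by simp
        ultimately show "norm (?h k * v k (Suc (?c k y)) / 2) \<le> ?h k * K"
          using h(1)[of k] by (simp add: abs_mult)
      qed
      show "(\<lambda>k. ?h k * K) \<longlonglongrightarrow> 0" using mesh by (rule tendsto_mult_left_zero)
    qed
    moreover have "(\<lambda>k. ?I (U k) k - ?I w k) \<longlonglongrightarrow> 0"
    proof (rule Lim_null_comparison[OF _ lim], intro always_eventually allI)
      fix k
      have "?I (U k) k - ?I w k = (\<integral>z. indicator {0..<?a k} z * (U k z - w z) \<partial>?J)"
        using ind_int[OF Uint, of "?a k" k] ind_int[OF w, of "?a k"] by (simp add: right_diff_distrib)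
      also have "\<bar>\<dots>\<bar> \<le> (\<integral>z. \<bar>U k z - w z\<bar> \<partial>?J)"
      proof (rule integral_abs_bound[THEN order_trans], rule integral_mono)
        show "integrable ?J (\<lambda>z. \<bar>indicator {0..<?a k} z * (U k z - w z)\<bar>)"
          using Uint[of k] w by (intro integrable_abs ind_int Bochner_Integration.integrable_diff)
        show "integrable ?J (\<lambda>z. \<bar>U k z - w z\<bar>)"
          using Uint[of k] w by (intro integrable_abs Bochner_Integration.integrable_diff)
      qed (auto simp: indicator_def)
      finally show "norm (?I (U k) k - ?I w k) \<le> (\<integral>z. \<bar>v k (Suc (?c k z)) - w z\<bar> \<partial>?J)"
        by (simp add: U_def)
    qed
    moreover have "?I w \<longlonglongrightarrow> (\<integral>z. indicator {0..<y} z * w z \<partial>?J)"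
    proof (rule integral_dominated_convergence[where w="\<lambda>z. \<bar>w z\<bar>"])
      show "AE z in ?J. (\<lambda>k. indicator {0..<?a k} z * w z) \<longlonglongrightarrow> indicator {0..<y} z * w z"
      proof (rule AE_I2)
        fix z assume "z \<in> space ?J"
        then have z: "0 \<le> z" by simp
        show "(\<lambda>k. indicator {0..<?a k} z * w z) \<longlonglongrightarrow> indicator {0..<y} z * w z"
        proof (cases "z < y")
          case True
          from order_tendstoD(1)[OF a True]
          have "eventually (\<lambda>k. indicator {0..<?a k} z * w z = indicator {0..<y} z * w z) sequentially"
            by eventually_elim (use True z in \<open>auto simp: indicator_def\<close>)
          then show ?thesis by (rule tendsto_eventually)
        next
          case False
          then have "indicator {0..<?a k} z * w z = indicator {0..<y} z * w z" for k
            using a1[of k] by (auto simp: indicator_def)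
          then show ?thesis by (simp only: tendsto_const)
        qed
      qed
      show "AE z in ?J. norm (indicator {0..<?a k} z * w z) \<le> \<bar>w z\<bar>" for k
        by (auto simp: indicator_def)
    qed (use ind_int[OF w] w in auto)
    ultimately have "(\<lambda>k. ?I w k + (?I (U k) k - ?I w k) + ?h k * v k (Suc (?c k y)) / 2)
       \<longlonglongrightarrow> (\<integral>z. indicator {0..<y} z * w z \<partial>?J) + 0 + 0"
      by (intro tendsto_add)
    moreover have "(\<integral>z. indicator {0..<y} z * w z \<partial>?J) = (LINT z:{0..y}|lebesgue. w z)"
    proof -
      have "AE z in lebesgue. z \<in> {0..y} \<longleftrightarrow> z \<in> {0..<y}"
        using AE_lebesgue_neq[of y] by eventually_elim auto
      then have "(LINT z:{0..y}|lebesgue. w z) = (\<integral>z. w z \<partial>lebesgue_on {0..<y})"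
        by (rule set_integral_spike) simp
      also have "\<dots> = (\<integral>z. indicator {0..<y} z * w z \<partial>?J)" using y by (intro restr) simp
      finally show ?thesis by (rule sym)
    qed
    ultimately show ?thesis by (simp add: 1)
  qed
  have S_bd: "\<bar>S k i\<bar> \<le> K" if i: "i < N k" for k i
  proof -
    have "\<bar>(\<Sum>l=1..<Suc i. v k l) + v k (Suc i) / 2\<bar> \<le> (\<Sum>l=1..<Suc i. \<bar>v k l\<bar>) + \<bar>v k (Suc i)\<bar>"
      using sum_abs[of "v k" "{1..<Suc i}"] by linarith
    also have "\<dots> \<le> (\<Sum>l=1..<Suc i. K) + K"
      using i by (intro add_mono sum_mono vK) auto
    also have "\<dots> = real (Suc i) * K" by (simp add: algebra_simps)
    also have "\<dots> \<le> real (N k) * K" using i K by (intro mult_right_mono) auto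
    finally have "\<bar>S k i\<bar> \<le> ?h k * (real (N k) * K)"
      unfolding S_def using h(1)[of k] by (simp add: abs_mult mult_left_mono)
    also have "\<dots> = (real (N k) * ?h k) * K" by (simp add: mult_ac)
    finally show ?thesis by (simp add: h(2))
  qed
  have "(\<lambda>k. \<integral>y. S k (?c k y) \<partial>?J) \<longlonglongrightarrow> (\<integral>y. (LINT z:{0..y}|lebesgue. w z) \<partial>?J)"
  proof (rule bounded_convergence_on[where C=K])
    show "(\<lambda>y. S k (?c k y)) \<in> borel_measurable ?J" for k
      by (rule borel_imp_lebesgue_on[OF step_measurable])
    then show "(\<lambda>y. LINT z:{0..y}|lebesgue. w z) \<in> borel_measurable ?J"
      by (rule borel_measurable_LIMSEQ_real[rotated]) (use S_lim in auto)
    show "AE y in ?J. (\<lambda>k. S k (?c k y)) \<longlonglongrightarrow> (LINT z:{0..y}|lebesgue. w z)"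
      using S_lim by (intro AE_I2) auto
    show "AE y in ?J. \<bar>S k (?c k y)\<bar> \<le> K" for k
      using S_bd cN by (intro AE_I2) auto
  qed simp
  moreover have "(\<integral>y. S k (?c k y) \<partial>?J) = ?h k * (\<Sum>i<N k. S k i)" for k
    using step_integral[OF h(1)[of k], where m="N k" and v="S k"] by (simp add: h(2) sum_distrib_left)
  moreover have "(\<integral>y. (LINT z:{0..y}|lebesgue. w z) \<partial>?J) = (LINT y:{0..1}|lebesgue. (LINT z:{0..y}|lebesgue. w z))"
    by (rule set_integral_spike[OF unit_intervals_ae_eq(2), symmetric]) simp
  ultimately have "(\<lambda>k. S k (?c k x) - ?h k * (\<Sum>i<N k. S k i))
    \<longlonglongrightarrow> (LINT y:{0..x}|lebesgue. w y) - (LINT y:{0..1}|lebesgue. (LINT z:{0..y}|lebesgue. w z))"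
    using S_lim[OF x] by (intro tendsto_diff) auto
  moreover have "P_disc (N k) (v k) (Suc i) = S k i - ?h k * (\<Sum>i<N k. S k i)" for k i
    unfolding P_disc_def S_def
    by (simp only: sum_distrib_left[symmetric] sum.atLeast1_atMost_eq power2_eq_square mult.assoc One_nat_def)
  ultimately show ?thesis by simp
qed

section \<open>Cell averages of functions of bounded variation\<close>

text \<open>For \<open>W\<close> one takes the variation over \<open>[a, x]\<close>: a partition of \<open>[a, x]\<close> extends to one of
  \<open>[a, y]\<close> by the points \<open>x\<close> and \<open>y\<close>.\<close>

lemma bounded_variation_dominated:
  assumes "bounded_variation_on a b v"
  obtains W where "\<And>x y. a \<le> x \<Longrightarrow> x \<le> y \<Longrightarrow> y \<le> b \<Longrightarrow> \<bar>v y - v x\<bar> \<le> W y - W x"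
proof -
  define part where "part x n s \<longleftrightarrow> (\<forall>i\<le>n. s i \<in> {a..x}) \<and> (\<forall>i<n. s i \<le> s (Suc i))"
    for x and n :: nat and s :: "nat \<Rightarrow> real"
  define var where "var n s = (\<Sum>i<n. \<bar>v (s (Suc i)) - v (s i)\<bar>)" for n :: nat and s :: "nat \<Rightarrow> real"
  define W where "W x = Sup {var n s | n s. part x n s}" for x
  obtain C where C: "\<And>n s. part b n s \<Longrightarrow> var n s \<le> C"
    using assms unfolding bounded_variation_on_def part_def var_def by blast
  have bdd: "bdd_above {var n s | n s. part y n s}" if "y \<le> b" for y
  proof -
    have "part b n s" if "part y n s" for n s
      using that \<open>y \<le> b\<close> unfolding part_def by (meson atLeastAtMost_iff order_trans)
    then show ?thesis using C by (intro bdd_aboveI[of _ C]) auto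
  qed
  have "\<bar>v y - v x\<bar> \<le> W y - W x" if xy: "a \<le> x" "x \<le> y" "y \<le> b" for x y
  proof -
    have "W x \<le> W y - \<bar>v y - v x\<bar>"
      unfolding W_def[of x]
    proof (rule cSup_least)
      have "part x 0 (\<lambda>_. x)" using xy by (simp add: part_def)
      then show "{var n s | n s. part x n s} \<noteq> {}" by blast
      fix z assume "z \<in> {var n s | n s. part x n s}"
      then obtain n s where z: "z = var n s" and p: "part x n s" by blast
      \<comment> \<open>appending \<open>x\<close> before \<open>y\<close> keeps the last jump separate from the old partition\<close>
      define s' where "s' i = (if i \<le> n then s i else if i = Suc n then x else y)" for i
      have "part y (Suc (Suc n)) s'"
        using p xy unfolding part_def s'_def by (fastforce simp: less_Suc_eq le_Suc_eq)
      then have "var (Suc (Suc n)) s' \<le> W y"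
        unfolding W_def using bdd[OF xy(3)] by (intro cSup_upper) auto
      moreover have "var (Suc (Suc n)) s' = var n s + \<bar>v x - v (s n)\<bar> + \<bar>v y - v x\<bar>"
      proof -
        have "var n s' = var n s" unfolding var_def s'_def by (intro sum.cong) auto
        then show ?thesis unfolding var_def by (simp add: s'_def)
      qed
      ultimately show "z \<le> W y - \<bar>v y - v x\<bar>" using z by linarith
    qed
    then show ?thesis by linarith
  qed
  then show thesis by (rule that)
qed

lemma mono_on_measurable_lebesgue_on:
  fixes g :: "real \<Rightarrow> real"
  assumes "mono_on A g" "A \<in> sets borel"
  shows "g \<in> borel_measurable (lebesgue_on A)"
proof -
  have "g \<in> borel_measurable (restrict_space borel A)"
    using assms(1) by (rule borel_measurable_mono_on_fnc)
  then have "(\<lambda>x. indicator A x *\<^sub>R g x) \<in> borel_measurable borel"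
    using assms(2) by (subst (asm) borel_measurable_restrict_space_iff) auto
  then have "(\<lambda>x. indicator A x *\<^sub>R g x) \<in> borel_measurable lebesgue"
    by (simp add: measurable_completion)
  then show ?thesis using assms(2) by (subst borel_measurable_restrict_space_iff) auto
qed

text \<open>On each cell the average differs from the function by at most the increment of \<open>W\<close>, and these
  increments telescope.\<close>

lemma BV_cell_averages:
  assumes "BV 0 1 u0"
  obtains K where
    "integrable (lebesgue_on {0..<1}) u0"
    "\<And>F T N M j. N > 0 \<Longrightarrow> j \<in> {1..N} \<Longrightarrow> \<bar>scheme F u0 T N M 0 j\<bar> \<le> K"
    "\<And>F T N M. N > 0 \<Longrightarrow>
      (\<integral>x. \<bar>scheme F u0 T N M 0 (Suc (cell (mesh_dx N) x)) - u0 x\<bar> \<partial>lebesgue_on {0..<1}) \<le> mesh_dx N * K"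
proof -
  let ?J = "lebesgue_on {0..<1::real}"
  obtain v where bv: "bounded_variation_on 0 1 v" and ae: "AE x in lebesgue. x \<in> {0..1} \<longrightarrow> u0 x = v x"
    using assms unfolding BV_def by auto
  obtain W where W: "\<And>x y. 0 \<le> x \<Longrightarrow> x \<le> y \<Longrightarrow> y \<le> 1 \<Longrightarrow> \<bar>v y - v x\<bar> \<le> W y - W x"
    using bounded_variation_dominated[OF bv] by metis
  define K where "K = \<bar>v 0\<bar> + (W 1 - W 0)"
  have vK: "\<bar>v x\<bar> \<le> K" if "x \<in> {0..1}" for x
    using W[of 0 x] W[of x 1] that by (auto simp: K_def)
  have WK: "W 1 - W 0 \<le> K" by (simp add: K_def)
  have aeJ: "AE x in ?J. u0 x = v x"
    by (subst AE_restrict_space_iff) (use ae in \<open>auto elim: eventually_mono\<close>)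
  \<comment> \<open>\<open>v\<close> is a difference of monotone functions, hence measurable\<close>
  have "W x \<le> W y" "W x - v x \<le> W y - v y" if "0 \<le> x" "x \<le> y" "y < 1" for x y
    using W[of x y] that by auto
  then have "mono_on {0..<1} W" "mono_on {0..<1} (\<lambda>x. W x - v x)"
    by (auto intro!: mono_onI)
  then have "W \<in> borel_measurable ?J" "(\<lambda>x. W x - v x) \<in> borel_measurable ?J"
    by (simp_all add: mono_on_measurable_lebesgue_on)
  then have "(\<lambda>x. W x - (W x - v x)) \<in> borel_measurable ?J"
    by (rule borel_measurable_diff)
  then have vm: "v \<in> borel_measurable ?J" by simp
  have "(\<lambda>x. indicator {0..<1} x *\<^sub>R v x) \<in> borel_measurable lebesgue"
    using vm by (subst (asm) borel_measurable_restrict_space_iff) auto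
  then have "(\<lambda>x. indicator {0..<1} x *\<^sub>R u0 x) \<in> borel_measurable lebesgue"
    by (rule borel_measurable_AE, use ae in eventually_elim) (auto simp: indicator_def)
  then have um: "u0 \<in> borel_measurable ?J"
    by (subst borel_measurable_restrict_space_iff) auto
  have uK: "AE x in ?J. \<bar>u0 x\<bar> \<le> K"
    using aeJ AE_space by eventually_elim (auto intro!: vK)
  have ui: "integrable ?J u0" by (rule integrable_bounded_on[OF _ um uK]) simp
  have avg: "\<bar>scheme F u0 T N M 0 (Suc i) - c\<bar> \<le> e"
    if N: "N > 0" and i: "i < N" and e: "\<And>y. y \<in> {x_half N i..<x_half N (Suc i)} \<Longrightarrow> \<bar>v y - c\<bar> \<le> e"
    for F T N M i c e
  proof -
    let ?h = "mesh_dx N" and ?I = "{x_half N i..<x_half N (Suc i)}"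
    have h: "?h > 0" "real N * ?h = 1" using N by (auto simp: mesh_dx_def)
    have len: "x_half N (Suc i) - x_half N i = ?h" by (simp add: x_half_def algebra_simps)
    have le: "x_half N i \<le> x_half N (Suc i)" using len h(1) by linarith
    have "real (Suc i) * ?h \<le> real N * ?h" "0 \<le> real i * ?h"
      using i h(1) by (intro mult_right_mono mult_nonneg_nonneg; simp)+
    then have sub: "?I \<subseteq> {0..<1}" unfolding x_half_def h(2) by auto
    have ui': "set_integrable lebesgue {0..<1} u0"
      using ui by (subst (asm) integrable_restrict_space) (auto simp: set_integrable_def)
    have uI: "set_integrable lebesgue ?I u0" by (rule set_integrable_subset[OF ui' _ sub]) simp
    have cI: "set_integrable lebesgue ?I (\<lambda>_. a)" for a :: real
      by (rule absolutely_integrable_on_const) simp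
    have cv: "(LINT x:?I|lebesgue. a) = ?h * a" for a
      using set_integral_const_Ico[OF le] len by simp
    have "\<bar>(LINT x:?I|lebesgue. u0 x) - ?h * c\<bar> = \<bar>LINT x:?I|lebesgue. u0 x - c\<bar>"
      using set_integral_diff(2)[OF uI cI, of c] cv by simp
    also have "\<dots> \<le> (LINT x:?I|lebesgue. \<bar>u0 x - c\<bar>)"
      using set_integral_diff(1)[OF uI cI, of c] set_integral_norm_bound[of lebesgue ?I "\<lambda>x. u0 x - c"] by simp
    also have "\<dots> \<le> (LINT x:?I|lebesgue. e)"
    proof (rule set_integral_mono_AE)
      show "set_integrable lebesgue ?I (\<lambda>x. \<bar>u0 x - c\<bar>)"
        using set_integral_diff(1)[OF uI cI, of c] by (rule set_integrable_abs)
      show "AE x\<in>?I in lebesgue. \<bar>u0 x - c\<bar> \<le> e"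
        using ae by eventually_elim (use e sub in force)
    qed (rule cI)
    also have "\<dots> = ?h * e" by (rule cv)
    finally have "\<bar>(LINT x:?I|lebesgue. u0 x) - ?h * c\<bar> \<le> ?h * e" .
    then have "\<bar>1 / ?h * ((LINT x:?I|lebesgue. u0 x) - ?h * c)\<bar> \<le> e"
      using h(1) by (simp add: abs_mult field_simps)
    moreover have "1 / ?h * ((LINT x:?I|lebesgue. u0 x) - ?h * c) = scheme F u0 T N M 0 (Suc i) - c"
      using h(1) by (simp add: field_simps)
    ultimately show ?thesis by (simp only:)
  qed
  have cell_in: "x_half N (cell (mesh_dx N) x) \<le> x" "x < x_half N (Suc (cell (mesh_dx N) x))"
      "x_half N (Suc (cell (mesh_dx N) x)) \<le> 1" "cell (mesh_dx N) x < N" "0 \<le> x_half N (cell (mesh_dx N) x)"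
    if N: "N > 0" and x: "x \<in> {0..<1}" for N x
  proof -
    have h: "mesh_dx N > 0" "real N * mesh_dx N = 1" using N by (auto simp: mesh_dx_def)
    show l: "cell (mesh_dx N) x < N" using cell_less[OF h(1), of x N] x by (simp add: h(2))
    show "x_half N (cell (mesh_dx N) x) \<le> x" "x < x_half N (Suc (cell (mesh_dx N) x))"
      using cell_bounds[OF h(1), of x] x by (auto simp: x_half_def)
    have "real (Suc (cell (mesh_dx N) x)) * mesh_dx N \<le> real N * mesh_dx N"
      using l h(1) by (intro mult_right_mono) auto
    then show "x_half N (Suc (cell (mesh_dx N) x)) \<le> 1" unfolding x_half_def h(2) .
    show "0 \<le> x_half N (cell (mesh_dx N) x)" using h by (simp add: x_half_def)
  qed
  have bound: "\<bar>scheme F u0 T N M 0 j\<bar> \<le> K" if N: "N > 0" and j: "j \<in> {1..N}" for F T N M j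
  proof -
    obtain i where i: "j = Suc i" "i < N" using j by (cases j) auto
    have "real (Suc i) * mesh_dx N \<le> real N * mesh_dx N" "0 \<le> real i * mesh_dx N"
      using i N by (intro mult_right_mono mult_nonneg_nonneg; simp add: mesh_dx_def)+
    moreover have "real N * mesh_dx N = 1" using N by (simp add: mesh_dx_def)
    ultimately have "{x_half N i..<x_half N (Suc i)} \<subseteq> {0..1}"
      unfolding x_half_def by auto
    then have "\<bar>v y - 0\<bar> \<le> K" if "y \<in> {x_half N i..<x_half N (Suc i)}" for y
      using vK that by auto
    from avg[OF N i(2) this] show ?thesis unfolding i(1) by (simp only: diff_zero)
  qed
  have err: "(\<integral>x. \<bar>scheme F u0 T N M 0 (Suc (cell (mesh_dx N) x)) - u0 x\<bar> \<partial>?J) \<le> mesh_dx N * K"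
    if N: "N > 0" for F T N M
  proof -
    let ?h = "mesh_dx N"
    have h: "?h > 0" "real N * ?h = 1" using N by (auto simp: mesh_dx_def)
    define d where "d i = W (x_half N (Suc i)) - W (x_half N i)" for i
    have "(\<integral>x. \<bar>scheme F u0 T N M 0 (Suc (cell ?h x)) - u0 x\<bar> \<partial>?J) \<le> (\<integral>x. d (cell ?h x) \<partial>?J)"
    proof (rule integral_mono_AE)
      show "integrable ?J (\<lambda>x. d (cell ?h x))"
        using step_integrable[OF h(1), where m=N and v=d] by (simp add: h(2))
      show "integrable ?J (\<lambda>x. \<bar>scheme F u0 T N M 0 (Suc (cell ?h x)) - u0 x\<bar>)"
        using step_integrable[OF h(1), where m=N and v="\<lambda>i. scheme F u0 T N M 0 (Suc i)"] ui
        unfolding h(2) by (intro integrable_abs Bochner_Integration.integrable_diff)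
      show "AE x in ?J. \<bar>scheme F u0 T N M 0 (Suc (cell ?h x)) - u0 x\<bar> \<le> d (cell ?h x)"
        using aeJ AE_space
      proof eventually_elim
        fix x assume ux: "u0 x = v x" and "x \<in> space ?J"
        then have x: "x \<in> {0..<1}" by simp
        note c = cell_in[OF N x]
        show "\<bar>scheme F u0 T N M 0 (Suc (cell ?h x)) - u0 x\<bar> \<le> d (cell ?h x)"
          unfolding ux
        proof (rule avg[OF N c(4)])
          fix y assume y: "y \<in> {x_half N (cell ?h x)..<x_half N (Suc (cell ?h x))}"
          show "\<bar>v y - v x\<bar> \<le> d (cell ?h x)"
            using W[of x y] W[of y x] W[of "x_half N (cell ?h x)" y] W[of "x_half N (cell ?h x)" x]
              W[of y "x_half N (Suc (cell ?h x))"] W[of x "x_half N (Suc (cell ?h x))"] c y x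
            unfolding d_def by (cases "x \<le> y") auto
        qed
      qed
    qed
    also have "\<dots> = (\<Sum>i<N. ?h * d i)"
      using step_integral[OF h(1), where m=N and v=d] by (simp add: h(2))
    also have "\<dots> = ?h * (W 1 - W 0)"
      unfolding d_def sum_distrib_left[symmetric]
      using N by (subst sum_lessThan_telescope) (simp add: x_half_def h(2))
    also have "\<dots> \<le> ?h * K" using WK h(1) by (intro mult_left_mono) auto
    finally show ?thesis .
  qed
  show thesis by (rule that[OF ui bound err])
qed

section \<open>Consistency of the numerical entropy flux\<close>

lemma entropy_flux_eq_num_entropy_flux:
  assumes "numerical_flux f F"
  shows "entropy_flux f x v k = num_entropy_flux F k x v v"
proof -
  have "F x w w = f x w" for w using assms unfolding numerical_flux_def by blast
  then show ?thesis
    by (auto simp: entropy_flux_def num_entropy_flux_def sgn_if max_def min_def)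
qed

lemma num_entropy_flux_bound:
  assumes "numerical_flux f F"
  obtains L where "L \<ge> 0" "\<And>x k a b. \<bar>num_entropy_flux F k x a b\<bar> \<le> L * (\<bar>a - k\<bar> + \<bar>b - k\<bar>)"
proof -
  obtain L where L: "\<And>x. L-lipschitz_on UNIV (\<lambda>(u, v). F x u v)"
    using assms unfolding numerical_flux_def by blast
  have "\<bar>num_entropy_flux F k x a b\<bar> \<le> L * (\<bar>a - k\<bar> + \<bar>b - k\<bar>)" for x k a b
  proof -
    have "\<bar>max a k - min a k\<bar> = \<bar>a - k\<bar>" "\<bar>max b k - min b k\<bar> = \<bar>b - k\<bar>" by auto
    with lipschitz_on_pair_bound[OF L[of x], of "max a k" "max b k" "min a k" "min b k"]
    show ?thesis by (simp add: num_entropy_flux_def)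
  qed
  then show thesis using that lipschitz_on_nonneg[OF L] by blast
qed

text \<open>Stated with moving levels \<open>k n\<close>, so that it serves both the limit of vanishing mesh size and the
  approach of an arbitrary level by generic ones.\<close>

lemma num_entropy_flux_tendsto:
  assumes nf: "numerical_flux f F" and f: "continuous_on UNIV (\<lambda>(x, v). f x v)"
    and x: "X \<longlonglongrightarrow> x" and a: "a \<longlonglongrightarrow> v" and b: "b \<longlonglongrightarrow> v" and k: "k \<longlonglongrightarrow> \<kappa>"
  shows "(\<lambda>n. num_entropy_flux F (k n) (X n) (a n) (b n)) \<longlonglongrightarrow> entropy_flux f x v \<kappa>"
proof -
  obtain L where L: "\<And>x. L-lipschitz_on UNIV (\<lambda>(u, v). F x u v)"
    using nf unfolding numerical_flux_def by blast
  have cons: "F x w w = f x w" for x w using nf unfolding numerical_flux_def by blast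
  have F_lim: "(\<lambda>n. F (X n) (p n) (q n)) \<longlonglongrightarrow> f x w" if p: "p \<longlonglongrightarrow> w" and q: "q \<longlonglongrightarrow> w" for p q w
  proof -
    have "(\<lambda>n. \<bar>p n - w\<bar> + \<bar>q n - w\<bar>) \<longlonglongrightarrow> 0"
      using tendsto_add[OF tendsto_rabs_zero[OF LIM_zero[OF p]] tendsto_rabs_zero[OF LIM_zero[OF q]]] by simp
    then have "(\<lambda>n. L * (\<bar>p n - w\<bar> + \<bar>q n - w\<bar>)) \<longlonglongrightarrow> 0"
      by (rule tendsto_mult_right_zero)
    then have "(\<lambda>n. F (X n) (p n) (q n) - F (X n) w w) \<longlonglongrightarrow> 0"
      by (rule Lim_null_comparison[rotated]) (simp add: lipschitz_on_pair_bound[OF L] always_eventually)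
    moreover have "(\<lambda>n. (X n, w)) \<longlonglongrightarrow> (x, w)" using x by (intro tendsto_intros)
    then have "(\<lambda>n. f (X n) w) \<longlonglongrightarrow> f x w"
      using continuous_on_tendsto_compose[OF f] by fastforce
    ultimately have "(\<lambda>n. (F (X n) (p n) (q n) - F (X n) w w) + f (X n) w) \<longlonglongrightarrow> 0 + f x w"
      by (rule tendsto_add)
    then show ?thesis by (simp add: cons)
  qed
  have "(\<lambda>n. num_entropy_flux F (k n) (X n) (a n) (b n)) \<longlonglongrightarrow> f x (max v \<kappa>) - f x (min v \<kappa>)"
    unfolding num_entropy_flux_def by (intro tendsto_diff F_lim tendsto_max tendsto_min a b k)
  also have "f x (max v \<kappa>) - f x (min v \<kappa>) = entropy_flux f x v \<kappa>"
    by (simp add: entropy_flux_eq_num_entropy_flux[OF nf] num_entropy_flux_def cons)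
  finally show ?thesis .
qed

text \<open>The limit passage treats the values at a time level as given numbers and unfolds no time step.\<close>

declare scheme.simps [simp del]

section \<open>Convergence of the approximations along a subsequence\<close>

text \<open>The setting of the limit passage. The uniform bound on the scheme is
  a hypothesis here. The strip is taken half-open, which changes it by a null set, so that each of
  its points lies in exactly one grid cell.\<close>

locale convergent_approximations =
  fixes T c_f :: real and f :: "real \<Rightarrow> real \<Rightarrow> real" and F :: "real \<Rightarrow> real \<Rightarrow> real \<Rightarrow> real"
    and u0 :: "real \<Rightarrow> real" and N M :: "nat \<Rightarrow> nat" and u :: "real \<Rightarrow> real \<Rightarrow> real" and K :: real
  assumes T: "T > 0"
    and C2: "C_k 2 (\<lambda>(x, v). f x v)"
    and nf: "numerical_flux f F"
    and N: "\<And>k. N k > 0"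
    and CFL: "\<And>k. CFL_condition F c_f T (N k) (M k)"
    and mesh: "(\<lambda>k. mesh_dx (N k)) \<longlonglongrightarrow> 0"
    and u_C_L1: "u \<in> C_L1 T"
    and L1_lim: "uniform_limit {0..T}
           (\<lambda>k t. L1_dist (fv_approx F u0 T (N k) (M k) t) (u t)) (\<lambda>t. 0) sequentially"
    and bound: "\<And>k n j. n \<le> Suc (M k) \<Longrightarrow> j \<in> {1..N k} \<Longrightarrow> \<bar>scheme F u0 T (N k) (M k) n j\<bar> \<le> K"
begin

abbreviation "dx k \<equiv> mesh_dx (N k)"
abbreviation "dt k \<equiv> mesh_dt T (M k)"
abbreviation "tc k t \<equiv> cell (dt k) t"
abbreviation "xc k x \<equiv> cell (dx k) x"
abbreviation "V k \<equiv> scheme F u0 T (N k) (M k)"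
abbreviation "J \<equiv> lebesgue_on {0..<1::real}"
abbreviation "D \<equiv> lebesgue_on ({0..<T} \<times> {0..<1::real})"

lemma space_step: "dx k > 0" "real (N k) * dx k = 1"
  using N[of k] by (auto simp: mesh_dx_def)

lemma time_step: "dt k > 0" "real (Suc (M k)) * dt k = T"
  using T by (auto simp: mesh_dt_def add_nonneg_eq_0_iff add.commute)

lemma dt_tendsto: "dt \<longlonglongrightarrow> 0"
proof (rule Lim_null_comparison)
  have "dt k \<le> c_f * dx k" for k using CFL[of k] by (simp add: CFL_condition_def)
  then show "eventually (\<lambda>k. norm (dt k) \<le> c_f * dx k) sequentially"
    using time_step(1) by (simp add: less_imp_le abs_of_pos)
  show "(\<lambda>k. c_f * dx k) \<longlonglongrightarrow> 0" using mesh by (rule tendsto_mult_right_zero)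
qed

lemma time_cell:
  assumes "t \<in> {0..<T}"
  shows "tc k t < Suc (M k)" "0 \<le> real (tc k t) * dt k" "real (tc k t) * dt k \<le> t"
    "t < real (Suc (tc k t)) * dt k" "real (Suc (tc k t)) * dt k \<le> T"
proof -
  show l: "tc k t < Suc (M k)"
    using cell_less[OF time_step(1), of t "Suc (M k)" k] assms unfolding time_step(2) by simp
  show "real (tc k t) * dt k \<le> t" "t < real (Suc (tc k t)) * dt k" "0 \<le> real (tc k t) * dt k"
    using cell_bounds[OF time_step(1), of t k] time_step(1)[of k] assms by auto
  have "real (Suc (tc k t)) * dt k \<le> real (Suc (M k)) * dt k"
    using l time_step(1)[of k] by (intro mult_right_mono) auto
  then show "real (Suc (tc k t)) * dt k \<le> T" unfolding time_step(2) .
qed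

lemma space_cell:
  assumes "x \<in> {0..<1}"
  shows "xc k x < N k" "0 \<le> real (xc k x) * dx k" "real (xc k x) * dx k \<le> x"
    "x < real (Suc (xc k x)) * dx k" "real (Suc (xc k x)) * dx k \<le> 1"
proof -
  show l: "xc k x < N k"
    using cell_less[OF space_step(1), of x "N k" k] assms unfolding space_step(2) by simp
  show "real (xc k x) * dx k \<le> x" "x < real (Suc (xc k x)) * dx k" "0 \<le> real (xc k x) * dx k"
    using cell_bounds[OF space_step(1), of x k] space_step(1)[of k] assms by auto
  have "real (Suc (xc k x)) * dx k \<le> real (N k) * dx k"
    using l space_step(1)[of k] by (intro mult_right_mono) auto
  then show "real (Suc (xc k x)) * dx k \<le> 1" unfolding space_step(2) .
qed

lemma V_bound: "n \<le> Suc (M k) \<Longrightarrow> i < N k \<Longrightarrow> \<bar>V k n (Suc i)\<bar> \<le> K"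
  by (rule bound) auto

lemma grid_integrable: "integrable J (\<lambda>x. a (xc k x))" for a :: "nat \<Rightarrow> real"
  using step_integrable[OF space_step(1)[of k], where v=a and m="N k"] by (simp only: space_step(2))

lemma grid_integral: "(\<integral>x. a (xc k x) \<partial>J) = (\<Sum>i<N k. dx k * a i)" for a :: "nat \<Rightarrow> real"
  using step_integral[OF space_step(1)[of k], where v=a and m="N k"] by (simp only: space_step(2))

lemma u_integrable: "t \<in> {0..T} \<Longrightarrow> integrable J (u t)"
  using u_C_L1 by (auto simp: C_L1_def intro!: integrable_unit_interval)

lemma u_measurable: "(\<lambda>p. u (fst p) (snd p)) \<in> borel_measurable D"
proof -
  have "set_borel_measurable lebesgue (Pi_T T) (\<lambda>(t, x). u t x)" using u_C_L1 by (simp add: C_L1_def)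
  then have 1: "(\<lambda>p. indicator (Pi_T T) p *\<^sub>R u (fst p) (snd p)) \<in> borel_measurable lebesgue"
    by (simp add: set_borel_measurable_def case_prod_beta')
  have "(\<lambda>p. indicator ({0..<T} \<times> {0..<1}) p *\<^sub>R u (fst p) (snd p)) \<in> borel_measurable lebesgue"
    by (rule borel_measurable_AE[OF 1], use AE_Pi_T[of T] in eventually_elim) (simp add: indicator_def)
  then show ?thesis by (subst borel_measurable_restrict_space_iff) (simp_all add: fmeasurableD)
qed

text \<open>Uniformity in time allows the evaluation times to move with the mesh.\<close>

lemma L1_lim_along:
  assumes \<tau>: "\<And>k. \<tau> k \<in> {0..T}"
  shows "(\<lambda>k. \<integral>x. \<bar>V k (tc k (\<tau> k)) (Suc (xc k x)) - u (\<tau> k) x\<bar> \<partial>J) \<longlonglongrightarrow> 0"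
proof (rule tendstoI)
  fix e :: real assume "e > 0"
  with L1_lim have "eventually (\<lambda>k. \<forall>t\<in>{0..T}. dist (L1_dist (fv_approx F u0 T (N k) (M k) t) (u t)) 0 < e) sequentially"
    by (simp add: uniform_limit_iff)
  then show "eventually (\<lambda>k. dist (\<integral>x. \<bar>V k (tc k (\<tau> k)) (Suc (xc k x)) - u (\<tau> k) x\<bar> \<partial>J) 0 < e) sequentially"
  proof eventually_elim
    fix k assume "\<forall>t\<in>{0..T}. dist (L1_dist (fv_approx F u0 T (N k) (M k) t) (u t)) 0 < e"
    then have "dist (L1_dist (fv_approx F u0 T (N k) (M k) (\<tau> k)) (u (\<tau> k))) 0 < e" using \<tau> by blast
    then show "dist (\<integral>x. \<bar>V k (tc k (\<tau> k)) (Suc (xc k x)) - u (\<tau> k) x\<bar> \<partial>J) 0 < e"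
      by (simp add: L1_dist_eq fv_approx_def cell_def)
  qed
qed

lemma L1_lim_current: "t \<in> {0..T} \<Longrightarrow> (\<lambda>k. \<integral>x. \<bar>V k (tc k t) (Suc (xc k x)) - u t x\<bar> \<partial>J) \<longlonglongrightarrow> 0"
  by (rule L1_lim_along)

lemma L1_lim_final: "(\<lambda>k. \<integral>x. \<bar>V k (Suc (M k)) (Suc (xc k x)) - u T x\<bar> \<partial>J) \<longlonglongrightarrow> 0"
proof -
  have "tc k T = Suc (M k)" for k
    using time_step[of k] by (intro cell_eq) (auto simp: algebra_simps)
  then show ?thesis using L1_lim_current[of T] T by simp
qed

lemma L1_lim_initial: "(\<lambda>k. \<integral>x. \<bar>V k 0 (Suc (xc k x)) - u 0 x\<bar> \<partial>J) \<longlonglongrightarrow> 0"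
  using L1_lim_current[of 0] T by (simp add: cell_def)

text \<open>At a time \<open>t\<close> of the \<open>n\<close>-th interval, the next level is the approximation at \<open>t\<^sup>n\<^sup>+\<^sup>1\<close>, where
  it is close to the limit function; this time tends to \<open>t\<close>, and the limit function is continuous
  in time.\<close>

lemma L1_lim_next:
  assumes t: "t \<in> {0..<T}"
  shows "(\<lambda>k. \<integral>x. \<bar>V k (Suc (tc k t)) (Suc (xc k x)) - u t x\<bar> \<partial>J) \<longlonglongrightarrow> 0"
proof -
  \<comment> \<open>the next time level lies strictly beyond \<open>t\<close>, so it tends to \<open>t\<close> through the punctured neighbourhood\<close>
  define \<tau> where "\<tau> k = real (Suc (tc k t)) * dt k" for k
  have \<tau>T: "\<tau> k \<in> {0..T}" and \<tau>t: "t < \<tau> k" for k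
    using time_cell[OF t, of k] t unfolding \<tau>_def by auto
  have tc\<tau>: "tc k (\<tau> k) = Suc (tc k t)" for k
    unfolding \<tau>_def using time_step(1)[of k] by (intro cell_eq) (auto simp: algebra_simps)
  have "\<tau> \<longlonglongrightarrow> t" unfolding \<tau>_def using cell_point_tendsto(2)[OF dt_tendsto time_step(1)] t by simp
  then have "filterlim \<tau> (at t within {0..T}) sequentially"
    unfolding filterlim_at using \<tau>T \<tau>t by (auto intro!: always_eventually)
  moreover have "((\<lambda>s. L1_dist (u s) (u t)) \<longlongrightarrow> 0) (at t within {0..T})"
    using u_C_L1 t by (simp add: C_L1_def)
  ultimately have "(\<lambda>k. L1_dist (u (\<tau> k)) (u t)) \<longlonglongrightarrow> 0" by (rule filterlim_compose[rotated])
  from tendsto_add[OF L1_lim_along[where \<tau>=\<tau>, OF \<tau>T] this]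
  have lim: "(\<lambda>k. (\<integral>x. \<bar>V k (Suc (tc k t)) (Suc (xc k x)) - u (\<tau> k) x\<bar> \<partial>J)
     + (\<integral>x. \<bar>u (\<tau> k) x - u t x\<bar> \<partial>J)) \<longlonglongrightarrow> 0"
    by (simp add: tc\<tau> L1_dist_eq)
  show ?thesis
  proof (rule Lim_null_comparison[OF _ lim], intro always_eventually allI)
    fix k
    have int: "integrable J (\<lambda>x. V k (Suc (tc k t)) (Suc (xc k x)))" "integrable J (u (\<tau> k))" "integrable J (u t)"
      using grid_integrable[where a="\<lambda>i. V k (Suc (tc k t)) (Suc i)"] u_integrable \<tau>T t by auto
    have "(\<integral>x. \<bar>V k (Suc (tc k t)) (Suc (xc k x)) - u t x\<bar> \<partial>J)
       \<le> (\<integral>x. \<bar>V k (Suc (tc k t)) (Suc (xc k x)) - u (\<tau> k) x\<bar> + \<bar>u (\<tau> k) x - u t x\<bar> \<partial>J)"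
      by (intro integral_mono Bochner_Integration.integrable_add integrable_abs Bochner_Integration.integrable_diff int) auto
    also have "\<dots> = (\<integral>x. \<bar>V k (Suc (tc k t)) (Suc (xc k x)) - u (\<tau> k) x\<bar> \<partial>J)
     + (\<integral>x. \<bar>u (\<tau> k) x - u t x\<bar> \<partial>J)"
      by (intro Bochner_Integration.integral_add integrable_abs Bochner_Integration.integrable_diff int)
    finally show "norm (\<integral>x. \<bar>V k (Suc (tc k t)) (Suc (xc k x)) - u t x\<bar> \<partial>J)
       \<le> (\<integral>x. \<bar>V k (Suc (tc k t)) (Suc (xc k x)) - u (\<tau> k) x\<bar> \<partial>J) + (\<integral>x. \<bar>u (\<tau> k) x - u t x\<bar> \<partial>J)"
      by simp
  qed
qed

lemma time_index_le: "t \<in> {0..T} \<Longrightarrow> tc k t \<le> Suc (M k)"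
proof -
  assume t: "t \<in> {0..T}"
  have "t < real (Suc (Suc (M k))) * dt k"
    using t time_step[of k] by (simp add: algebra_simps)
  then show ?thesis using cell_less[OF time_step(1), of t "Suc (Suc (M k))" k] t by auto
qed

lemma L1_lim_neighbour:
  assumes t: "t \<in> {0..<T}"
  shows "(\<lambda>k. \<integral>x. \<bar>V k (tc k t) (Suc (Suc (xc k x) mod N k)) - u t x\<bar> \<partial>J) \<longlonglongrightarrow> 0"
proof -
  have "(\<lambda>k. \<integral>x. \<bar>V k (tc k t) (Suc (Suc (cell (1 / real (N k)) x) mod N k)) - u t x\<bar> \<partial>J) \<longlonglongrightarrow> 0"
  proof (rule cyclic_shift_tendsto[OF N, where v="\<lambda>k i. V k (tc k t) (Suc i)"])
    show "(\<lambda>k. 1 / real (N k)) \<longlonglongrightarrow> 0" using mesh by (simp add: mesh_dx_def)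
    show "\<bar>V k (tc k t) (Suc i)\<bar> \<le> K" if "i < N k" for k i
      using that t by (intro V_bound time_index_le) auto
    show "(\<lambda>k. \<integral>x. \<bar>V k (tc k t) (Suc (cell (1 / real (N k)) x)) - u t x\<bar> \<partial>J) \<longlonglongrightarrow> 0"
      using L1_lim_current[of t] t by (simp add: mesh_dx_def)
  qed (use u_integrable t in auto)
  then show ?thesis by (simp add: mesh_dx_def)
qed

lemma u_bounded:
  assumes t: "t \<in> {0..T}"
  shows "AE x in J. \<bar>u t x\<bar> \<le> K"
proof (rule L1_limit_bounded[OF _ u_integrable[OF t] _ _ L1_lim_current[OF t]])
  show "\<bar>V k (tc k t) (Suc (xc k x))\<bar> \<le> K" if "x \<in> {0..<1}" for k x
    using space_cell(1)[OF that] time_index_le[OF t] by (intro V_bound)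
  show "integrable J (\<lambda>x. V k (tc k t) (Suc (xc k x)))" for k
    by (rule grid_integrable)
qed simp

lemma ae_subsequence_at_time:
  fixes r :: "nat \<Rightarrow> nat"
  assumes t: "t \<in> {0..T}" and lim: "(\<lambda>k. \<integral>x. \<bar>a k (xc k x) - u t x\<bar> \<partial>J) \<longlonglongrightarrow> 0" and r: "strict_mono r"
  obtains s where "strict_mono s" "AE x in J. (\<lambda>k. a (r (s k)) (xc (r (s k)) x)) \<longlonglongrightarrow> u t x"
proof -
  have "(\<lambda>k. \<integral>x. norm (a (r k) (xc (r k) x) - u t x) \<partial>J) \<longlonglongrightarrow> 0"
    using LIMSEQ_subseq_LIMSEQ[OF lim r] by (simp add: o_def)
  moreover have "integrable J (\<lambda>x. a (r k) (xc (r k) x) - u t x)" for k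
    by (intro Bochner_Integration.integrable_diff grid_integrable u_integrable t)
  ultimately obtain s where "strict_mono s" "AE x in J. (\<lambda>k. a (r (s k)) (xc (r (s k)) x) - u t x) \<longlonglongrightarrow> 0"
    using tendsto_L1_AE_subseq[where M=J and u="\<lambda>k x. a (r k) (xc (r k) x) - u t x"] by blast
  then show thesis by (intro that[of s]) (auto elim!: eventually_mono simp: LIM_zero_cancel)
qed

lemma ae_subsequence_on_strip:
  fixes r :: "nat \<Rightarrow> nat"
  assumes lim: "\<And>t. t \<in> {0..<T} \<Longrightarrow> (\<lambda>k. \<integral>x. \<bar>a k (tc k t) (xc k x) - u t x\<bar> \<partial>J) \<longlonglongrightarrow> 0"
    and bd: "\<And>k n i. n \<le> M k \<Longrightarrow> i < N k \<Longrightarrow> \<bar>a k n i\<bar> \<le> K"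
    and r: "strict_mono r"
  obtains s where "strict_mono s"
    "AE p in D. (\<lambda>k. a (r (s k)) (tc (r (s k)) (fst p)) (xc (r (s k)) (snd p))) \<longlonglongrightarrow> u (fst p) (snd p)"
proof (rule ae_convergent_subsequence[where A="{0..<T}" and B="{0..<1}" and w=u and K=K
      and W="\<lambda>k t x. a (r k) (tc (r k) t) (xc (r k) x)"])
  show "(\<lambda>p. a (r k) (tc (r k) (fst p)) (xc (r k) (snd p))) \<in> borel_measurable borel" for k
    by (rule step_measurable_2)
  show "integrable J (u t)" if "t \<in> {0..<T}" for t using u_integrable that by auto
  show "AE x in J. \<bar>u t x\<bar> \<le> K" if "t \<in> {0..<T}" for t using u_bounded that by auto
  show "\<bar>a (r k) (tc (r k) t) (xc (r k) x)\<bar> \<le> K" if "t \<in> {0..<T}" "x \<in> {0..<1}" for k t x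
    using time_cell(1)[OF that(1), of "r k"] space_cell(1)[OF that(2), of "r k"] by (intro bd) auto
  show "(\<lambda>k. \<integral>x. \<bar>a (r k) (tc (r k) t) (xc (r k) x) - u t x\<bar> \<partial>J) \<longlonglongrightarrow> 0" if "t \<in> {0..<T}" for t
    using LIMSEQ_subseq_LIMSEQ[OF lim[OF that] r] by (simp add: o_def)
qed (use u_measurable that in auto)

lemma common_ae_subsequence:
  obtains r where "strict_mono r"
    "AE p in D. (\<lambda>k. V (r k) (tc (r k) (fst p)) (Suc (xc (r k) (snd p)))) \<longlonglongrightarrow> u (fst p) (snd p)"
    "AE p in D. (\<lambda>k. V (r k) (Suc (tc (r k) (fst p))) (Suc (xc (r k) (snd p)))) \<longlonglongrightarrow> u (fst p) (snd p)"
    "AE p in D. (\<lambda>k. V (r k) (tc (r k) (fst p)) (Suc (Suc (xc (r k) (snd p)) mod N (r k)))) \<longlonglongrightarrow> u (fst p) (snd p)"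
    "AE x in J. (\<lambda>k. V (r k) 0 (Suc (xc (r k) x))) \<longlonglongrightarrow> u 0 x"
    "AE x in J. (\<lambda>k. V (r k) (Suc (M (r k))) (Suc (xc (r k) x))) \<longlonglongrightarrow> u T x"
proof -
  have sub: "(\<lambda>k. g (s k)) \<longlonglongrightarrow> l" if "strict_mono s" "g \<longlonglongrightarrow> l" for g :: "nat \<Rightarrow> real" and s l
    using LIMSEQ_subseq_LIMSEQ[OF that(2,1)] by (simp add: o_def)
  have modN: "j mod N k < N k" for j k using N by simp
  obtain r1 where r1: "strict_mono r1"
    "AE p in D. (\<lambda>k. V (r1 k) (tc (r1 k) (fst p)) (Suc (xc (r1 k) (snd p)))) \<longlonglongrightarrow> u (fst p) (snd p)"
    by (rule ae_subsequence_on_strip[where a="\<lambda>k n i. V k n (Suc i)" and r="\<lambda>k. k"])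
       (auto intro!: L1_lim_current V_bound simp: strict_mono_def)
  obtain s2 where s2: "strict_mono s2"
    "AE p in D. (\<lambda>k. V (r1 (s2 k)) (Suc (tc (r1 (s2 k)) (fst p))) (Suc (xc (r1 (s2 k)) (snd p)))) \<longlonglongrightarrow> u (fst p) (snd p)"
    by (rule ae_subsequence_on_strip[where a="\<lambda>k n i. V k (Suc n) (Suc i)" and r=r1])
       (auto intro!: L1_lim_next V_bound r1)
  define r2 where "r2 k = r1 (s2 k)" for k
  have r2: "strict_mono r2" unfolding r2_def using r1(1) s2(1) by (simp add: strict_mono_def)
  obtain s3 where s3: "strict_mono s3"
    "AE p in D. (\<lambda>k. V (r2 (s3 k)) (tc (r2 (s3 k)) (fst p)) (Suc (Suc (xc (r2 (s3 k)) (snd p)) mod N (r2 (s3 k))))) \<longlonglongrightarrow> u (fst p) (snd p)"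
    by (rule ae_subsequence_on_strip[where a="\<lambda>k n i. V k n (Suc (Suc i mod N k))" and r=r2])
       (auto intro!: L1_lim_neighbour V_bound r2 modN)
  define r3 where "r3 k = r2 (s3 k)" for k
  have r3: "strict_mono r3" unfolding r3_def using r2 s3(1) by (simp add: strict_mono_def)
  obtain s4 where s4: "strict_mono s4" "AE x in J. (\<lambda>k. V (r3 (s4 k)) 0 (Suc (xc (r3 (s4 k)) x))) \<longlonglongrightarrow> u 0 x"
    using ae_subsequence_at_time[where a="\<lambda>k i. V k 0 (Suc i)" and t=0, OF _ L1_lim_initial r3] T by auto
  define r4 where "r4 k = r3 (s4 k)" for k
  have r4: "strict_mono r4" unfolding r4_def using r3 s4(1) by (simp add: strict_mono_def)
  obtain s5 where s5: "strict_mono s5"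
    "AE x in J. (\<lambda>k. V (r4 (s5 k)) (Suc (M (r4 (s5 k)))) (Suc (xc (r4 (s5 k)) x))) \<longlonglongrightarrow> u T x"
    using ae_subsequence_at_time[where a="\<lambda>k i. V k (Suc (M k)) (Suc i)" and t=T, OF _ L1_lim_final r4] T by auto
  define r where "r k = r4 (s5 k)" for k
  have r: "strict_mono r" unfolding r_def using r4 s5(1) by (simp add: strict_mono_def)
  have s45: "strict_mono (\<lambda>k. s4 (s5 k))" using s4(1) s5(1) by (simp add: strict_mono_def)
  have s345: "strict_mono (\<lambda>k. s3 (s4 (s5 k)))" using s3(1) s45 by (simp add: strict_mono_def)
  have s2345: "strict_mono (\<lambda>k. s2 (s3 (s4 (s5 k))))" using s2(1) s345 by (simp add: strict_mono_def)
  note defs = r_def r4_def r3_def r2_def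
  show thesis
  proof (rule that[OF r])
    show "AE p in D. (\<lambda>k. V (r k) (tc (r k) (fst p)) (Suc (xc (r k) (snd p)))) \<longlonglongrightarrow> u (fst p) (snd p)"
      using r1(2) by eventually_elim (drule sub[OF s2345], simp add: defs)
    show "AE p in D. (\<lambda>k. V (r k) (Suc (tc (r k) (fst p))) (Suc (xc (r k) (snd p)))) \<longlonglongrightarrow> u (fst p) (snd p)"
      using s2(2) by eventually_elim (drule sub[OF s345], simp add: defs)
    show "AE p in D. (\<lambda>k. V (r k) (tc (r k) (fst p)) (Suc (Suc (xc (r k) (snd p)) mod N (r k)))) \<longlonglongrightarrow> u (fst p) (snd p)"
      using s3(2) by eventually_elim (drule sub[OF s45], simp add: defs)
    show "AE x in J. (\<lambda>k. V (r k) 0 (Suc (xc (r k) x))) \<longlonglongrightarrow> u 0 x"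
      using s4(2) by eventually_elim (drule sub[OF s5(1)], simp add: defs)
    show "AE x in J. (\<lambda>k. V (r k) (Suc (M (r k))) (Suc (xc (r k) x))) \<longlonglongrightarrow> u T x"
      using s5(2) by (simp add: r_def)
  qed
qed

lemma u_bounded_ae: "AE p in D. \<bar>u (fst p) (snd p)\<bar> \<le> K"
proof -
  obtain r where "AE p in D. (\<lambda>k. V (r k) (tc (r k) (fst p)) (Suc (xc (r k) (snd p)))) \<longlonglongrightarrow> u (fst p) (snd p)"
    by (rule common_ae_subsequence)
  then show ?thesis using AE_space
  proof eventually_elim
    fix p assume lim: "(\<lambda>k. V (r k) (tc (r k) (fst p)) (Suc (xc (r k) (snd p)))) \<longlonglongrightarrow> u (fst p) (snd p)"
      and "p \<in> space D"
    then have p: "fst p \<in> {0..<T}" "snd p \<in> {0..<1}" by auto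
    have "\<bar>V (r k) (tc (r k) (fst p)) (Suc (xc (r k) (snd p)))\<bar> \<le> K" for k
      using time_cell(1)[OF p(1), of "r k"] space_cell(1)[OF p(2), of "r k"] by (intro V_bound) auto
    then show "\<bar>u (fst p) (snd p)\<bar> \<le> K"
      by (intro LIMSEQ_le_const2[OF tendsto_rabs[OF lim]]) auto
  qed
qed

lemma P_disc_lim:
  assumes t: "t \<in> {0..<T}" and x: "x \<in> {0..<1}"
  shows "(\<lambda>k. P_disc (N k) (V k (tc k t)) (Suc (xc k x))) \<longlonglongrightarrow> P_op u t x"
  unfolding P_op_def
proof (rule P_disc_tendsto[OF N mesh])
  show "\<bar>V k (tc k t) j\<bar> \<le> K" if "j \<in> {1..N k}" for k j using that t by (intro bound time_index_le) auto
qed (use u_integrable L1_lim_current t x in auto)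

lemma P_disc_bound:
  assumes "n \<le> Suc (M k)" "i < N k"
  shows "\<bar>P_disc (N k) (V k n) (Suc i)\<bar> \<le> 2 * K"
  using assms by (intro abs_P_disc_le[OF N bound]) auto

lemma P_op_bound:
  assumes t: "t \<in> {0..<T}" and x: "x \<in> {0..<1}"
  shows "\<bar>P_op u t x\<bar> \<le> 2 * K"
proof (rule LIMSEQ_le_const2[OF tendsto_rabs[OF P_disc_lim[OF t x]]])
  show "\<exists>n0. \<forall>k\<ge>n0. \<bar>P_disc (N k) (V k (tc k t)) (Suc (xc k x))\<bar> \<le> 2 * K"
    using P_disc_bound space_cell(1)[OF x] time_index_le[of t] t by auto
qed

text \<open>The limit function is jointly measurable only in the Lebesgue sense, so measurability of its
  partial integrals is not immediate; it is inherited from the discrete nonlocal terms.\<close>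

lemma P_op_measurable: "(\<lambda>p. P_op u (fst p) (snd p)) \<in> borel_measurable D"
proof (rule borel_measurable_LIMSEQ_real)
  show "(\<lambda>k. P_disc (N k) (V k (tc k (fst p))) (Suc (xc k (snd p)))) \<longlonglongrightarrow> P_op u (fst p) (snd p)"
    if "p \<in> space D" for p
    using that by (intro P_disc_lim) auto
  show "(\<lambda>p. P_disc (N k) (V k (tc k (fst p))) (Suc (xc k (snd p)))) \<in> borel_measurable D" for k
    by (intro borel_imp_lebesgue_on step_measurable_2)
qed

end

section \<open>Limit of the entropy inequality\<close>

lemma abs_four_terms_le:
  fixes a b c d :: real
  assumes "\<bar>a\<bar> \<le> A" "\<bar>b\<bar> \<le> B" "\<bar>c\<bar> \<le> C" "\<bar>d\<bar> \<le> E"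
  shows "\<bar>a + b - c + d\<bar> \<le> A + B + C + E"
  using assms by linarith

context convergent_approximations
begin

definition entropy_integrand :: "(real \<Rightarrow> real \<Rightarrow> real) \<Rightarrow> real \<Rightarrow> real \<times> real \<Rightarrow> real" where
  "entropy_integrand \<phi> \<kappa> = (\<lambda>(t, x).
      eta (u t x) \<kappa> * deriv (\<lambda>s. \<phi> s x) t
    + entropy_flux f x (u t x) \<kappa> * deriv (\<lambda>y. \<phi> t y) x
    - sgn (u t x - \<kappa>) * deriv (\<lambda>y. f y \<kappa>) x * \<phi> t x
    + sgn (u t x - \<kappa>) * P_op u t x * \<phi> t x)"

text \<open>The left-hand side of the entropy inequality, on the half-open strip.\<close>

definition entropy_balance :: "(real \<Rightarrow> real \<Rightarrow> real) \<Rightarrow> real \<Rightarrow> real" where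
  "entropy_balance \<phi> \<kappa> = (\<integral>p. entropy_integrand \<phi> \<kappa> p \<partial>D)
     - ((\<integral>x. \<bar>u T x - \<kappa>\<bar> * \<phi> T x \<partial>J) - (\<integral>x. \<bar>u 0 x - \<kappa>\<bar> * \<phi> 0 x \<partial>J))"

lemma flux_C2: "C_k (Suc (Suc 0)) (\<lambda>(x, v). f x v)"
  using C2 by (simp add: numeral_2_eq_2)

lemma f_continuous: "continuous_on UNIV (\<lambda>(x, v). f x v)"
  by (rule C_k_continuous[OF C2])

lemma continuous_measurable_D:
  fixes g :: "real \<Rightarrow> real \<Rightarrow> real"
  assumes "continuous_on UNIV (\<lambda>(s, y). g s y)" "a \<in> borel_measurable D" "b \<in> borel_measurable D"
  shows "(\<lambda>p. g (a p) (b p)) \<in> borel_measurable D"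
  using borel_measurable_continuous_on[OF assms(1) borel_measurable_Pair[OF assms(2,3)]] by simp

lemma fst_snd_measurable_D [simp]: "fst \<in> borel_measurable D" "snd \<in> borel_measurable D"
  by (auto intro!: borel_imp_lebesgue_on simp: borel_prod[symmetric])

context
  fixes \<phi> :: "real \<Rightarrow> real \<Rightarrow> real"
  assumes test: "test_function T \<phi>"
begin

lemma \<phi>_C1: "C_k (Suc 0) (\<lambda>(t, x). \<phi> t x)"
  using test unfolding test_function_def smooth_def by blast

lemma \<phi>_nonneg: "t \<in> {0..T} \<Longrightarrow> 0 \<le> \<phi> t x"
  using test by (simp add: test_function_def)

lemma \<phi>_periodic: "\<phi> t 1 = \<phi> t 0"
proof -
  have "\<phi> t (0 + 1) = \<phi> t 0" using test unfolding test_function_def by blast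
  then show ?thesis by simp
qed

lemmas \<phi>_continuous = C_k_continuous[OF \<phi>_C1]
lemmas \<phi>_t_continuous = C_k_continuous_partial_fst[OF \<phi>_C1]
lemmas \<phi>_x_continuous = C_k_continuous_partial_snd[OF \<phi>_C1]
lemmas f_x_continuous = C_k_continuous_partial_fst[OF flux_C2]

lemma entropy_integrand_measurable: "entropy_integrand \<phi> \<kappa> \<in> borel_measurable D"
proof -
  have "(\<lambda>p. eta (u (fst p) (snd p)) \<kappa> * deriv (\<lambda>s. \<phi> s (snd p)) (fst p)
    + entropy_flux f (snd p) (u (fst p) (snd p)) \<kappa> * deriv (\<lambda>y. \<phi> (fst p) y) (snd p)
    - sgn (u (fst p) (snd p) - \<kappa>) * deriv (\<lambda>y. f y \<kappa>) (snd p) * \<phi> (fst p) (snd p)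
    + sgn (u (fst p) (snd p) - \<kappa>) * P_op u (fst p) (snd p) * \<phi> (fst p) (snd p)) \<in> borel_measurable D"
    unfolding eta_def entropy_flux_def
    by (intro borel_measurable_add borel_measurable_diff borel_measurable_times borel_measurable_abs
        borel_measurable_const u_measurable P_op_measurable fst_snd_measurable_D
        measurable_compose[OF _ borel_measurable_sgn]
        continuous_measurable_D[OF \<phi>_continuous] continuous_measurable_D[OF \<phi>_t_continuous]
        continuous_measurable_D[OF \<phi>_x_continuous] continuous_measurable_D[OF f_x_continuous]
        continuous_measurable_D[OF f_continuous])
  then show ?thesis by (simp add: entropy_integrand_def case_prod_beta')
qed

lemma entropy_integrand_bound:
  obtains C where "\<And>\<kappa>. \<bar>\<kappa>\<bar> \<le> R \<Longrightarrow> AE p in D. \<bar>entropy_integrand \<phi> \<kappa> p\<bar> \<le> C"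
proof -
  obtain L where L: "L \<ge> 0" "\<And>x k a b. \<bar>num_entropy_flux F k x a b\<bar> \<le> L * (\<bar>a - k\<bar> + \<bar>b - k\<bar>)"
    using num_entropy_flux_bound[OF nf] by metis
  obtain B1 where B1: "\<And>t x. t \<in> {0..T} \<Longrightarrow> x \<in> {0..1} \<Longrightarrow> \<bar>\<phi> t x\<bar> \<le> B1"
    using continuous_bounded_rectangle[OF \<phi>_continuous] by metis
  obtain B2 where B2: "\<And>t x. t \<in> {0..T} \<Longrightarrow> x \<in> {0..1} \<Longrightarrow> \<bar>deriv (\<lambda>s. \<phi> s x) t\<bar> \<le> B2"
    using continuous_bounded_rectangle[OF \<phi>_t_continuous] by metis
  obtain B3 where B3: "\<And>t x. t \<in> {0..T} \<Longrightarrow> x \<in> {0..1} \<Longrightarrow> \<bar>deriv (\<lambda>y. \<phi> t y) x\<bar> \<le> B3"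
    using continuous_bounded_rectangle[OF \<phi>_x_continuous] by metis
  obtain B4 where B4: "\<And>x k. x \<in> {0..1} \<Longrightarrow> k \<in> {- R..R} \<Longrightarrow> \<bar>deriv (\<lambda>y. f y k) x\<bar> \<le> B4"
    using continuous_bounded_rectangle[OF f_x_continuous] by metis
  let ?C = "(K + R) * B2 + L * ((K + R) + (K + R)) * B3 + B4 * B1 + 2 * K * B1"
  have "AE p in D. \<bar>entropy_integrand \<phi> \<kappa> p\<bar> \<le> ?C" if \<kappa>: "\<bar>\<kappa>\<bar> \<le> R" for \<kappa>
    using u_bounded_ae AE_space
  proof eventually_elim
    fix p assume uK: "\<bar>u (fst p) (snd p)\<bar> \<le> K" and "p \<in> space D"
    then obtain t x where p: "p = (t, x)" and t: "t \<in> {0..<T}" and x: "x \<in> {0..<1}" by auto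
    have t': "t \<in> {0..T}" and x': "x \<in> {0..1}" using t x by auto
    have uk: "\<bar>u t x - \<kappa>\<bar> \<le> K + R" using uK \<kappa> p by auto
    have "\<bar>entropy_flux f x (u t x) \<kappa>\<bar> \<le> L * ((K + R) + (K + R))"
      unfolding entropy_flux_eq_num_entropy_flux[OF nf]
      using L(2)[of \<kappa> x "u t x" "u t x"] uk L(1) by (elim order_trans) (intro mult_left_mono add_mono)
    then have 2: "\<bar>entropy_flux f x (u t x) \<kappa> * deriv (\<lambda>y. \<phi> t y) x\<bar> \<le> L * ((K + R) + (K + R)) * B3"
      using B3[OF t' x'] unfolding abs_mult by (intro mult_mono) (auto intro: order_trans[OF abs_ge_zero])
    have 1: "\<bar>eta (u t x) \<kappa> * deriv (\<lambda>s. \<phi> s x) t\<bar> \<le> (K + R) * B2"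
      unfolding eta_def abs_mult abs_abs using uk B2[OF t' x'] by (intro mult_mono) auto
    have s: "\<bar>sgn (u t x - \<kappa>) * a\<bar> \<le> \<bar>a\<bar>" for a by (simp add: abs_mult sgn_if)
    have B4': "\<bar>deriv (\<lambda>y. f y \<kappa>) x\<bar> \<le> B4" using \<kappa> by (intro B4 x') auto
    have "\<bar>deriv (\<lambda>y. f y \<kappa>) x * \<phi> t x\<bar> \<le> B4 * B1"
      unfolding abs_mult using B4' B1[OF t' x'] by (intro mult_mono) auto
    then have 3: "\<bar>sgn (u t x - \<kappa>) * deriv (\<lambda>y. f y \<kappa>) x * \<phi> t x\<bar> \<le> B4 * B1"
      using s[of "deriv (\<lambda>y. f y \<kappa>) x * \<phi> t x"] unfolding mult.assoc by linarith
    have "\<bar>P_op u t x * \<phi> t x\<bar> \<le> 2 * K * B1"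
      unfolding abs_mult using P_op_bound[OF t x] B1[OF t' x'] by (intro mult_mono) auto
    then have 4: "\<bar>sgn (u t x - \<kappa>) * P_op u t x * \<phi> t x\<bar> \<le> 2 * K * B1"
      using s[of "P_op u t x * \<phi> t x"] unfolding mult.assoc by linarith
    show "\<bar>entropy_integrand \<phi> \<kappa> p\<bar> \<le> ?C"
      unfolding entropy_integrand_def p case_prod_conv by (rule abs_four_terms_le[OF 1 2 3 4])
  qed
  then show thesis by (rule that)
qed

text \<open>The test function is sampled at the left lower corners of the cells.\<close>

lemma discrete_entropy_balance:
  defines "\<psi> \<equiv> \<lambda>k n i. \<phi> (real n * dt k) (real i * dx k)"
  shows "(\<integral>x. \<bar>V k (Suc (M k)) (Suc (xc k x)) - \<kappa>\<bar> * \<phi> T (real (xc k x) * dx k) \<partial>J)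
      - (\<integral>x. \<bar>V k 0 (Suc (xc k x)) - \<kappa>\<bar> * \<phi> 0 (real (xc k x) * dx k) \<partial>J)
    \<le> (\<integral>p. discrete_entropy_density f F u0 T (N k) (M k) \<kappa> (\<psi> k) (tc k (fst p)) (xc k (snd p)) \<partial>D)"
proof -
  have \<psi>0: "\<psi> k n i \<ge> 0" if "n \<le> Suc (M k)" for n i
  proof -
    have "real n * dt k \<le> real (Suc (M k)) * dt k"
      using that time_step(1)[of k] by (intro mult_right_mono) auto
    then show ?thesis unfolding \<psi>_def time_step(2) using time_step(1)[of k] by (intro \<phi>_nonneg) auto
  qed
  have \<psi>N: "\<psi> k n (N k) = \<psi> k n 0" for n
    unfolding \<psi>_def space_step(2) by (simp add: \<phi>_periodic)
  have \<psi>T: "\<psi> k (Suc (M k)) i = \<phi> T (real i * dx k)" for i unfolding \<psi>_def time_step(2) ..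
  have \<psi>z: "\<psi> k 0 i = \<phi> 0 (real i * dx k)" for i unfolding \<psi>_def by simp
  let ?H = "discrete_entropy_density f F u0 T (N k) (M k) \<kappa> (\<psi> k)"
  have "(\<integral>p. ?H (tc k (fst p)) (xc k (snd p)) \<partial>D) = (\<Sum>n<Suc (M k). \<Sum>i<N k. dt k * dx k * ?H n i)"
    using step_integral_2[OF time_step(1)[of k] space_step(1)[of k], where H="?H" and m="Suc (M k)" and n="N k"]
    unfolding time_step(2) space_step(2) .
  then show ?thesis
    using discrete_entropy_inequality[OF CFL nf N T, where \<psi>="\<psi> k" and m="Suc (M k)" and k=\<kappa> and ?u0.0=u0,
        OF \<psi>0 \<psi>N]
    unfolding \<psi>T \<psi>z grid_integral[where a="\<lambda>i. \<bar>V k (Suc (M k)) (Suc i) - \<kappa>\<bar> * \<phi> T (real i * dx k)"]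
      grid_integral[where a="\<lambda>i. \<bar>V k 0 (Suc i) - \<kappa>\<bar> * \<phi> 0 (real i * dx k)"] by simp
qed


lemma discrete_density_tendsto:
  fixes r :: "nat \<Rightarrow> nat" and \<kappa> :: real
  defines "\<psi> \<equiv> \<lambda>k n i. \<phi> (real n * dt k) (real i * dx k)"
  assumes r: "strict_mono r" and t: "t \<in> {0..<T}" and x: "x \<in> {0..<1}"
    and A: "(\<lambda>k. V (r k) (tc (r k) t) (Suc (xc (r k) x))) \<longlonglongrightarrow> u t x"
    and B: "(\<lambda>k. V (r k) (Suc (tc (r k) t)) (Suc (xc (r k) x))) \<longlonglongrightarrow> u t x"
    and C: "(\<lambda>k. V (r k) (tc (r k) t) (Suc (Suc (xc (r k) x) mod N (r k)))) \<longlonglongrightarrow> u t x"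
    and neq: "u t x \<noteq> \<kappa>"
  shows "(\<lambda>k. discrete_entropy_density f F u0 T (N (r k)) (M (r k)) \<kappa> (\<psi> (r k)) (tc (r k) t) (xc (r k) x))
     \<longlonglongrightarrow> entropy_integrand \<phi> \<kappa> (t, x)"
proof -
  have sub: "(\<lambda>k. g (r k)) \<longlonglongrightarrow> l" if "g \<longlonglongrightarrow> l" for g :: "nat \<Rightarrow> real" and l
    using LIMSEQ_subseq_LIMSEQ[OF that r] by (simp add: o_def)
  let ?t0 = "\<lambda>k. real (tc (r k) t) * dt (r k)" and ?t1 = "\<lambda>k. real (Suc (tc (r k) t)) * dt (r k)"
  let ?x0 = "\<lambda>k. real (xc (r k) x) * dx (r k)" and ?x1 = "\<lambda>k. real (Suc (xc (r k) x)) * dx (r k)"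
  have t0: "?t0 \<longlonglongrightarrow> t" and t1: "?t1 \<longlonglongrightarrow> t"
    using cell_point_tendsto[OF dt_tendsto time_step(1), of t] t sub[of "\<lambda>k. real (tc k t) * dt k" t]
      sub[of "\<lambda>k. real (Suc (tc k t)) * dt k" t] by auto
  have x0: "?x0 \<longlonglongrightarrow> x" and x1: "?x1 \<longlonglongrightarrow> x"
    using cell_point_tendsto[OF mesh space_step(1), of x] x sub[of "\<lambda>k. real (xc k x) * dx k" x]
      sub[of "\<lambda>k. real (Suc (xc k x)) * dx k" x] by auto
  have dtd: "?t1 k - ?t0 k = dt (r k)" and dxd: "?x1 k - ?x0 k = dx (r k)" for k
    by (simp_all add: algebra_simps)
  have tlt: "?t0 k < ?t1 k" and xlt: "?x0 k < ?x1 k" for k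
    using dtd[of k] dxd[of k] time_step(1)[of "r k"] space_step(1)[of "r k"] by linarith+
  have q1: "(\<lambda>k. (\<phi> (?t1 k) (?x0 k) - \<phi> (?t0 k) (?x0 k)) / dt (r k)) \<longlonglongrightarrow> deriv (\<lambda>s. \<phi> s x) t"
    using difference_quotient_tendsto[OF C_k_partial_fst[OF \<phi>_C1] \<phi>_t_continuous t0 t1 tlt x0]
    unfolding dtd .
  have "continuous_on UNIV (\<lambda>(y, s). deriv (\<phi> s) y)"
    using continuous_on_compose2[OF \<phi>_x_continuous continuous_on_swap, of UNIV]
    by (simp add: case_prod_beta')
  from difference_quotient_tendsto[OF C_k_partial_snd[OF \<phi>_C1] this x0 x1 xlt t1]
  have q2: "(\<lambda>k. (\<phi> (?t1 k) (?x1 k) - \<phi> (?t1 k) (?x0 k)) / dx (r k)) \<longlonglongrightarrow> deriv (\<lambda>y. \<phi> t y) x"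
    unfolding dxd .
  have q3: "(\<lambda>k. (f (?x1 k) \<kappa> - f (?x0 k) \<kappa>) / dx (r k)) \<longlonglongrightarrow> deriv (\<lambda>y. f y \<kappa>) x"
    using difference_quotient_tendsto[OF C_k_partial_fst[OF flux_C2] f_x_continuous x0 x1 xlt tendsto_const]
    unfolding dxd .
  have P: "(\<lambda>k. P_disc (N (r k)) (V (r k) (tc (r k) t)) (Suc (xc (r k) x))) \<longlonglongrightarrow> P_op u t x"
    by (rule sub[OF P_disc_lim[OF t x]])
  have sg: "(\<lambda>k. sgn (V (r k) (Suc (tc (r k) t)) (Suc (xc (r k) x)) - \<kappa>)) \<longlonglongrightarrow> sgn (u t x - \<kappa>)"
    using neq by (intro tendsto_sgn tendsto_diff B tendsto_const) simp
  have ph: "(\<lambda>k. \<phi> (?t1 k) (?x0 k)) \<longlonglongrightarrow> \<phi> t x"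
    by (rule tendsto_continuous_2[OF \<phi>_continuous t1 x0])
  have Q: "(\<lambda>k. num_entropy_flux F \<kappa> (?x1 k) (V (r k) (tc (r k) t) (Suc (xc (r k) x)))
      (V (r k) (tc (r k) t) (Suc (Suc (xc (r k) x) mod N (r k))))) \<longlonglongrightarrow> entropy_flux f x (u t x) \<kappa>"
    by (rule num_entropy_flux_tendsto[OF nf f_continuous x1 A C tendsto_const])
  \<comment> \<open>the right neighbour of a cell, with values stored at indices shifted by one\<close>
  have per: "periodic_ext (N k) v (Suc (Suc (xc k x))) = v (Suc (Suc (xc k x) mod N k))" for k and v :: "nat \<Rightarrow> real"
    using space_cell(1)[OF x, of k] by (cases "Suc (xc k x) = N k") (auto simp: periodic_ext_def)
  show ?thesis
    unfolding entropy_integrand_def discrete_entropy_density_def Let_def per case_prod_conv \<psi>_def x_half_def eta_def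
    by (intro tendsto_add tendsto_diff tendsto_mult tendsto_rabs tendsto_const A q1 q2 q3 Q sg ph P)
qed

lemma discrete_density_bound:
  fixes \<kappa> :: real
  defines "\<psi> \<equiv> \<lambda>k n i. \<phi> (real n * dt k) (real i * dx k)"
  obtains C where "\<And>k t x. t \<in> {0..<T} \<Longrightarrow> x \<in> {0..<1} \<Longrightarrow>
    \<bar>discrete_entropy_density f F u0 T (N k) (M k) \<kappa> (\<psi> k) (tc k t) (xc k x)\<bar> \<le> C"
proof -
  obtain L where L: "L \<ge> 0" "\<And>x k a b. \<bar>num_entropy_flux F k x a b\<bar> \<le> L * (\<bar>a - k\<bar> + \<bar>b - k\<bar>)"
    using num_entropy_flux_bound[OF nf] by metis
  obtain B1 where B1: "\<And>t x. t \<in> {0..T} \<Longrightarrow> x \<in> {0..1} \<Longrightarrow> \<bar>\<phi> t x\<bar> \<le> B1"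
    using continuous_bounded_rectangle[OF \<phi>_continuous] by metis
  obtain B2 where B2: "\<And>t x. t \<in> {0..T} \<Longrightarrow> x \<in> {0..1} \<Longrightarrow> \<bar>deriv (\<lambda>s. \<phi> s x) t\<bar> \<le> B2"
    using continuous_bounded_rectangle[OF \<phi>_t_continuous] by metis
  obtain B3 where B3: "\<And>t x. t \<in> {0..T} \<Longrightarrow> x \<in> {0..1} \<Longrightarrow> \<bar>deriv (\<lambda>y. \<phi> t y) x\<bar> \<le> B3"
    using continuous_bounded_rectangle[OF \<phi>_x_continuous] by metis
  obtain B4 where B4: "\<And>x k. x \<in> {0..1} \<Longrightarrow> k \<in> {\<kappa>..\<kappa>} \<Longrightarrow> \<bar>deriv (\<lambda>y. f y k) x\<bar> \<le> B4"
    using continuous_bounded_rectangle[OF f_x_continuous] by metis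
  let ?R = "K + \<bar>\<kappa>\<bar>"
  let ?C = "?R * B2 + L * (?R + ?R) * B3 + B4 * B1 + 2 * K * B1"
  have "\<bar>discrete_entropy_density f F u0 T (N k) (M k) \<kappa> (\<psi> k) (tc k t) (xc k x)\<bar> \<le> ?C"
    if t: "t \<in> {0..<T}" and x: "x \<in> {0..<1}" for k t x
  proof -
    note tt = time_cell[OF t, of k] and xx = space_cell[OF x, of k]
    let ?t0 = "real (tc k t) * dt k" and ?t1 = "real (Suc (tc k t)) * dt k"
    let ?x0 = "real (xc k x) * dx k" and ?x1 = "real (Suc (xc k x)) * dx k"
    let ?a = "V k (tc k t) (Suc (xc k x))" and ?b = "V k (Suc (tc k t)) (Suc (xc k x))"
    let ?c = "periodic_ext (N k) (V k (tc k t)) (Suc (Suc (xc k x)))"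
    let ?P = "P_disc (N k) (V k (tc k t)) (Suc (xc k x))"
    have dtd: "?t1 - ?t0 = dt k" and dxd: "?x1 - ?x0 = dx k" by (simp_all add: algebra_simps)
    have lt: "?t0 < ?t1" "?x0 < ?x1" using tt(3,4) xx(3,4) by linarith+
    have q1: "\<bar>(\<phi> ?t1 ?x0 - \<phi> ?t0 ?x0) / (?t1 - ?t0)\<bar> \<le> B2"
      using tt xx by (intro difference_quotient_bound[OF C_k_partial_fst[OF \<phi>_C1] lt(1)] B2) auto
    have q2: "\<bar>(\<phi> ?t1 ?x1 - \<phi> ?t1 ?x0) / (?x1 - ?x0)\<bar> \<le> B3"
      using tt xx by (intro difference_quotient_bound[OF C_k_partial_snd[OF \<phi>_C1] lt(2)] B3) auto
    have q3: "\<bar>(f ?x1 \<kappa> - f ?x0 \<kappa>) / (?x1 - ?x0)\<bar> \<le> B4"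
      using tt xx by (intro difference_quotient_bound[OF C_k_partial_fst[OF flux_C2] lt(2)] B4) auto
    note q1 = q1[unfolded dtd] and q2 = q2[unfolded dxd] and q3 = q3[unfolded dxd]
    have ph: "\<bar>\<phi> ?t1 ?x0\<bar> \<le> B1" using tt xx by (intro B1) auto
    have a: "\<bar>?a\<bar> \<le> K" using tt(1) xx(1) by (intro V_bound) auto
    have c: "\<bar>?c\<bar> \<le> K" using tt(1) xx(1) by (intro periodic_ext_bound N bound) auto
    have P: "\<bar>?P\<bar> \<le> 2 * K" using tt(1) xx(1) by (intro P_disc_bound) auto
    have ak: "\<bar>?a - \<kappa>\<bar> \<le> ?R" and ck: "\<bar>?c - \<kappa>\<bar> \<le> ?R" using a c by auto
    have 1: "\<bar>\<bar>?a - \<kappa>\<bar> * ((\<phi> ?t1 ?x0 - \<phi> ?t0 ?x0) / dt k)\<bar> \<le> ?R * B2"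
      unfolding abs_mult[of "\<bar>?a - \<kappa>\<bar>"] abs_abs using q1 ak by (intro mult_mono) auto
    have "\<bar>num_entropy_flux F \<kappa> ?x1 ?a ?c\<bar> \<le> L * (?R + ?R)"
      using L(2)[of \<kappa> ?x1 ?a ?c] ak ck L(1) by (elim order_trans) (intro mult_left_mono add_mono)
    then have 2: "\<bar>num_entropy_flux F \<kappa> ?x1 ?a ?c * ((\<phi> ?t1 ?x1 - \<phi> ?t1 ?x0) / dx k)\<bar> \<le> L * (?R + ?R) * B3"
      unfolding abs_mult[of "num_entropy_flux F \<kappa> ?x1 ?a ?c"] using q2
      by (intro mult_mono) (auto intro: order_trans[OF abs_ge_zero])
    have s: "\<bar>sgn (?b - \<kappa>) * z\<bar> \<le> \<bar>z\<bar>" for z by (simp add: abs_mult sgn_if)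
    have "\<bar>((f ?x1 \<kappa> - f ?x0 \<kappa>) / dx k) * \<phi> ?t1 ?x0\<bar> \<le> B4 * B1"
      unfolding abs_mult[of "(f ?x1 \<kappa> - f ?x0 \<kappa>) / dx k"] using q3 ph order_trans[OF abs_ge_zero q3]
      by (intro mult_mono q3) auto
    then have 3: "\<bar>sgn (?b - \<kappa>) * ((f ?x1 \<kappa> - f ?x0 \<kappa>) / dx k) * \<phi> ?t1 ?x0\<bar> \<le> B4 * B1"
      using s[of "((f ?x1 \<kappa> - f ?x0 \<kappa>) / dx k) * \<phi> ?t1 ?x0"] unfolding mult.assoc by linarith
    have "\<bar>?P * \<phi> ?t1 ?x0\<bar> \<le> 2 * K * B1"
      unfolding abs_mult using P ph by (intro mult_mono) auto
    then have 4: "\<bar>sgn (?b - \<kappa>) * ?P * \<phi> ?t1 ?x0\<bar> \<le> 2 * K * B1"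
      using s[of "?P * \<phi> ?t1 ?x0"] unfolding mult.assoc by linarith
    show ?thesis
      unfolding discrete_entropy_density_def Let_def \<psi>_def x_half_def by (rule abs_four_terms_le[OF 1 2 3 4])
  qed
  then show thesis by (rule that)
qed

lemma boundary_tendsto:
  fixes r :: "nat \<Rightarrow> nat" and a :: "nat \<Rightarrow> nat \<Rightarrow> real"
  assumes r: "strict_mono r" and t: "t \<in> {0..T}"
    and lim: "AE x in J. (\<lambda>k. a (r k) (xc (r k) x)) \<longlonglongrightarrow> u t x"
    and bd: "\<And>k i. i < N k \<Longrightarrow> \<bar>a k i\<bar> \<le> K"
  shows "(\<lambda>k. \<integral>x. \<bar>a (r k) (xc (r k) x) - \<kappa>\<bar> * \<phi> t (real (xc (r k) x) * dx (r k)) \<partial>J)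
    \<longlonglongrightarrow> (\<integral>x. \<bar>u t x - \<kappa>\<bar> * \<phi> t x \<partial>J)"
proof -
  obtain B1 where B1: "\<And>t x. t \<in> {0..T} \<Longrightarrow> x \<in> {0..1} \<Longrightarrow> \<bar>\<phi> t x\<bar> \<le> B1"
    using continuous_bounded_rectangle[OF \<phi>_continuous] by metis
  have mesh_r: "(\<lambda>k. dx (r k)) \<longlonglongrightarrow> 0"
    using LIMSEQ_subseq_LIMSEQ[OF mesh r] by (simp add: o_def)
  show ?thesis
  proof (rule bounded_convergence_on[where C="(K + \<bar>\<kappa>\<bar>) * B1"])
    show "(\<lambda>x. \<bar>a (r k) (xc (r k) x) - \<kappa>\<bar> * \<phi> t (real (xc (r k) x) * dx (r k))) \<in> borel_measurable J" for k
      by (rule borel_imp_lebesgue_on[OF step_measurable])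
    have "continuous_on UNIV (\<phi> t)"
      using continuous_on_compose2[OF \<phi>_continuous, of UNIV "\<lambda>x. (t, x)"] by (simp add: continuous_on_Pair)
    then have "\<phi> t \<in> borel_measurable J" by (intro borel_imp_lebesgue_on borel_measurable_continuous_onI)
    then show "(\<lambda>x. \<bar>u t x - \<kappa>\<bar> * \<phi> t x) \<in> borel_measurable J"
      using u_integrable[OF t] by (intro borel_measurable_times borel_measurable_abs borel_measurable_diff) auto
    show "AE x in J. (\<lambda>k. \<bar>a (r k) (xc (r k) x) - \<kappa>\<bar> * \<phi> t (real (xc (r k) x) * dx (r k)))
        \<longlonglongrightarrow> \<bar>u t x - \<kappa>\<bar> * \<phi> t x"
      using lim AE_space
    proof eventually_elim
      fix x assume l: "(\<lambda>k. a (r k) (xc (r k) x)) \<longlonglongrightarrow> u t x" and "x \<in> space J"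
      then have "0 \<le> x" by simp
      from cell_point_tendsto(1)[OF mesh_r space_step(1) this]
      have "(\<lambda>k. \<phi> t (real (xc (r k) x) * dx (r k))) \<longlonglongrightarrow> \<phi> t x"
        by (rule tendsto_continuous_2[OF \<phi>_continuous tendsto_const])
      then show "(\<lambda>k. \<bar>a (r k) (xc (r k) x) - \<kappa>\<bar> * \<phi> t (real (xc (r k) x) * dx (r k)))
        \<longlonglongrightarrow> \<bar>u t x - \<kappa>\<bar> * \<phi> t x"
        by (intro tendsto_mult tendsto_rabs tendsto_diff l tendsto_const)
    qed
    show "AE x in J. \<bar>\<bar>a (r k) (xc (r k) x) - \<kappa>\<bar> * \<phi> t (real (xc (r k) x) * dx (r k))\<bar> \<le> (K + \<bar>\<kappa>\<bar>) * B1" for k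
    proof (rule AE_I2)
      fix x assume "x \<in> space J"
      then have x: "x \<in> {0..<1}" by simp
      note xx = space_cell[OF x, of "r k"]
      have "\<bar>a (r k) (xc (r k) x) - \<kappa>\<bar> \<le> K + \<bar>\<kappa>\<bar>" using bd[OF xx(1)] by linarith
      moreover have "\<bar>\<phi> t (real (xc (r k) x) * dx (r k))\<bar> \<le> B1" using xx x t by (intro B1) auto
      ultimately show "\<bar>\<bar>a (r k) (xc (r k) x) - \<kappa>\<bar> * \<phi> t (real (xc (r k) x) * dx (r k))\<bar> \<le> (K + \<bar>\<kappa>\<bar>) * B1"
        unfolding abs_mult abs_abs by (intro mult_mono) auto
    qed
  qed simp
qed

text \<open>Away from the level set, which is null by assumption, all factors of the discrete density
  converge along the common subsequence.\<close>

lemma entropy_balance_nonneg_generic: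
  assumes generic: "AE p in D. u (fst p) (snd p) \<noteq> \<kappa>"
  shows "entropy_balance \<phi> \<kappa> \<ge> 0"
proof -
  define \<psi> where "\<psi> k n i = \<phi> (real n * dt k) (real i * dx k)" for k n i
  let ?G = "\<lambda>k p. discrete_entropy_density f F u0 T (N k) (M k) \<kappa> (\<psi> k) (tc k (fst p)) (xc k (snd p))"
  obtain C where C: "\<And>k t x. t \<in> {0..<T} \<Longrightarrow> x \<in> {0..<1} \<Longrightarrow> \<bar>?G k (t, x)\<bar> \<le> C"
    using discrete_density_bound[of \<kappa>] unfolding \<psi>_def fst_conv snd_conv by metis
  show ?thesis
  proof (rule common_ae_subsequence)
    fix r :: "nat \<Rightarrow> nat"
    assume r: "strict_mono r"
      and A: "AE p in D. (\<lambda>k. V (r k) (tc (r k) (fst p)) (Suc (xc (r k) (snd p)))) \<longlonglongrightarrow> u (fst p) (snd p)"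
      and B: "AE p in D. (\<lambda>k. V (r k) (Suc (tc (r k) (fst p))) (Suc (xc (r k) (snd p)))) \<longlonglongrightarrow> u (fst p) (snd p)"
      and E: "AE p in D. (\<lambda>k. V (r k) (tc (r k) (fst p)) (Suc (Suc (xc (r k) (snd p)) mod N (r k)))) \<longlonglongrightarrow> u (fst p) (snd p)"
      and init: "AE x in J. (\<lambda>k. V (r k) 0 (Suc (xc (r k) x))) \<longlonglongrightarrow> u 0 x"
      and final: "AE x in J. (\<lambda>k. V (r k) (Suc (M (r k))) (Suc (xc (r k) x))) \<longlonglongrightarrow> u T x"
    have "(\<lambda>k. \<integral>p. ?G (r k) p \<partial>D) \<longlonglongrightarrow> (\<integral>p. entropy_integrand \<phi> \<kappa> p \<partial>D)"
    proof (rule bounded_convergence_on[where C=C])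
      show "?G (r k) \<in> borel_measurable D" for k
        by (rule borel_imp_lebesgue_on[OF step_measurable_2])
      show "AE p in D. (\<lambda>k. ?G (r k) p) \<longlonglongrightarrow> entropy_integrand \<phi> \<kappa> p"
        using A B E generic AE_space
      proof eventually_elim
        fix p
        assume "(\<lambda>k. V (r k) (tc (r k) (fst p)) (Suc (xc (r k) (snd p)))) \<longlonglongrightarrow> u (fst p) (snd p)"
          "(\<lambda>k. V (r k) (Suc (tc (r k) (fst p))) (Suc (xc (r k) (snd p)))) \<longlonglongrightarrow> u (fst p) (snd p)"
          "(\<lambda>k. V (r k) (tc (r k) (fst p)) (Suc (Suc (xc (r k) (snd p)) mod N (r k)))) \<longlonglongrightarrow> u (fst p) (snd p)"
          "u (fst p) (snd p) \<noteq> \<kappa>" "p \<in> space D"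
        then show "(\<lambda>k. ?G (r k) p) \<longlonglongrightarrow> entropy_integrand \<phi> \<kappa> p"
          using discrete_density_tendsto[OF r, of "fst p" "snd p" \<kappa>] unfolding \<psi>_def by auto
      qed
      show "AE p in D. \<bar>?G (r k) p\<bar> \<le> C" for k
        using C by (intro AE_I2) auto
    qed (simp_all add: entropy_integrand_measurable)
    moreover have "(\<lambda>k. (\<integral>x. \<bar>V (r k) (Suc (M (r k))) (Suc (xc (r k) x)) - \<kappa>\<bar> * \<phi> T (real (xc (r k) x) * dx (r k)) \<partial>J)
        - (\<integral>x. \<bar>V (r k) 0 (Suc (xc (r k) x)) - \<kappa>\<bar> * \<phi> 0 (real (xc (r k) x) * dx (r k)) \<partial>J))
      \<longlonglongrightarrow> (\<integral>x. \<bar>u T x - \<kappa>\<bar> * \<phi> T x \<partial>J) - (\<integral>x. \<bar>u 0 x - \<kappa>\<bar> * \<phi> 0 x \<partial>J)"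
      by (intro tendsto_diff boundary_tendsto[where a="\<lambda>k i. V k (Suc (M k)) (Suc i)", OF r]
          boundary_tendsto[where a="\<lambda>k i. V k 0 (Suc i)", OF r] init final V_bound)
        (use T in auto)
    ultimately have "(\<integral>x. \<bar>u T x - \<kappa>\<bar> * \<phi> T x \<partial>J) - (\<integral>x. \<bar>u 0 x - \<kappa>\<bar> * \<phi> 0 x \<partial>J)
        \<le> (\<integral>p. entropy_integrand \<phi> \<kappa> p \<partial>D)"
      using discrete_entropy_balance unfolding \<psi>_def by (intro LIMSEQ_le) auto
    then show ?thesis by (simp add: entropy_balance_def)
  qed
qed

text \<open>The push-forward of a finite measure under \<open>u\<close> has only countably many atoms.\<close>

lemma generic_level_exists:
  assumes "a < b"
  obtains \<kappa> where "a < \<kappa>" "\<kappa> < b" "AE p in D. u (fst p) (snd p) \<noteq> \<kappa>"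
proof -
  interpret finite_measure D by (rule finite_measure_lebesgue_on) simp
  let ?w = "\<lambda>p. u (fst p) (snd p)"
  interpret distr: finite_measure "distr D borel ?w"
    by (rule finite_measure_distr[OF u_measurable])
  have "\<exists>\<kappa>\<in>{a<..<b}. \<kappa> \<notin> {x. measure (distr D borel ?w) {x} \<noteq> 0}"
    using assms by (intro open_minus_countable distr.countable_support) auto
  then obtain \<kappa> where \<kappa>: "a < \<kappa>" "\<kappa> < b" "measure (distr D borel ?w) {\<kappa>} = 0" by auto
  have m: "?w -` {\<kappa>} \<inter> space D \<in> sets D" using u_measurable by (rule measurable_sets) simp
  have "measure D (?w -` {\<kappa>} \<inter> space D) = 0"
    using \<kappa>(3) by (subst (asm) measure_distr[OF u_measurable]) auto
  then have "?w -` {\<kappa>} \<inter> space D \<in> null_sets D"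
    using m by (auto simp: null_sets_def emeasure_eq_measure)
  from AE_not_in[OF this] have "AE p in D. ?w p \<noteq> \<kappa>"
    using AE_space by eventually_elim auto
  with \<kappa> that show thesis by blast
qed

lemma boundary_level_tendsto:
  assumes k: "k \<longlonglongrightarrow> \<kappa>" and kR: "\<And>n::nat. \<bar>k n\<bar> \<le> R" and t: "t \<in> {0..T}"
  shows "(\<lambda>n. \<integral>x. \<bar>u t x - k n\<bar> * \<phi> t x \<partial>J) \<longlonglongrightarrow> (\<integral>x. \<bar>u t x - \<kappa>\<bar> * \<phi> t x \<partial>J)"
proof -
  obtain B1 where B1: "\<And>t x. t \<in> {0..T} \<Longrightarrow> x \<in> {0..1} \<Longrightarrow> \<bar>\<phi> t x\<bar> \<le> B1"
    using continuous_bounded_rectangle[OF \<phi>_continuous] by metis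
  have "continuous_on UNIV (\<phi> t)"
    using continuous_on_compose2[OF \<phi>_continuous, of UNIV "\<lambda>x. (t, x)"] by (simp add: continuous_on_Pair)
  then have "\<phi> t \<in> borel_measurable J" by (intro borel_imp_lebesgue_on borel_measurable_continuous_onI)
  then have m: "(\<lambda>x. \<bar>u t x - c\<bar> * \<phi> t x) \<in> borel_measurable J" for c
    using u_integrable[OF t] by (intro borel_measurable_times borel_measurable_abs borel_measurable_diff) auto
  show ?thesis
  proof (rule bounded_convergence_on[OF _ m m, where C="(K + R) * B1"])
    show "AE x in J. (\<lambda>n. \<bar>u t x - k n\<bar> * \<phi> t x) \<longlonglongrightarrow> \<bar>u t x - \<kappa>\<bar> * \<phi> t x"
      by (intro AE_I2 tendsto_intros k)
    show "AE x in J. \<bar>\<bar>u t x - k n\<bar> * \<phi> t x\<bar> \<le> (K + R) * B1" for n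
      using u_bounded[OF t] AE_space
    proof eventually_elim
      fix x assume "\<bar>u t x\<bar> \<le> K" and "x \<in> space J"
      then show "\<bar>\<bar>u t x - k n\<bar> * \<phi> t x\<bar> \<le> (K + R) * B1"
        unfolding abs_mult abs_abs using kR[of n] t B1[of t x] by (intro mult_mono) auto
    qed
  qed simp
qed

text \<open>Where \<open>u = \<kappa>\<close>, the signs at \<open>p n\<close> and \<open>q n\<close> are \<open>-1\<close> and \<open>1\<close> and cancel, in accordance with
  \<open>sgn 0 = 0\<close>; elsewhere the sign is continuous.\<close>

lemma entropy_integrand_symmetric_tendsto:
  assumes p: "p \<longlonglongrightarrow> \<kappa>" "\<And>n. \<kappa> < p n" and q: "q \<longlonglongrightarrow> \<kappa>" "\<And>n. q n < \<kappa>"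
  shows "(\<lambda>n. entropy_integrand \<phi> (p n) z + entropy_integrand \<phi> (q n) z) \<longlonglongrightarrow> 2 * entropy_integrand \<phi> \<kappa> z"
proof -
  obtain t x where z: "z = (t, x)" by (cases z)
  let ?v = "u t x"
  have fx: "(\<lambda>n. deriv (\<lambda>y. f y (k n)) x) \<longlonglongrightarrow> deriv (\<lambda>y. f y \<kappa>) x" if "k \<longlonglongrightarrow> \<kappa>" for k :: "nat \<Rightarrow> real"
    by (rule tendsto_continuous_2[OF f_x_continuous tendsto_const that])
  have fl: "(\<lambda>n. entropy_flux f x ?v (k n)) \<longlonglongrightarrow> entropy_flux f x ?v \<kappa>" if "k \<longlonglongrightarrow> \<kappa>" for k :: "nat \<Rightarrow> real"
    using num_entropy_flux_tendsto[OF nf f_continuous tendsto_const tendsto_const tendsto_const that]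
    unfolding entropy_flux_eq_num_entropy_flux[OF nf, symmetric] .
  define S where "S k = sgn (?v - k) * deriv (\<lambda>y. f y k) x" for k
  have sg: "(\<lambda>n. sgn (?v - p n) + sgn (?v - q n)) \<longlonglongrightarrow> 2 * sgn (?v - \<kappa>)"
    and S: "(\<lambda>n. S (p n) + S (q n)) \<longlonglongrightarrow> 2 * S \<kappa>"
  proof -
    have "(\<lambda>n. sgn (?v - p n) + sgn (?v - q n)) \<longlonglongrightarrow> 2 * sgn (?v - \<kappa>)
      \<and> (\<lambda>n. S (p n) + S (q n)) \<longlonglongrightarrow> 2 * S \<kappa>"
    proof (cases "?v = \<kappa>")
      case True
      have "sgn (?v - p n) = -1" "sgn (?v - q n) = 1" for n
        using p(2)[of n] q(2)[of n] True by (auto simp: sgn_if)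
      moreover have "(\<lambda>n. - deriv (\<lambda>y. f y (p n)) x + deriv (\<lambda>y. f y (q n)) x)
          \<longlonglongrightarrow> - deriv (\<lambda>y. f y \<kappa>) x + deriv (\<lambda>y. f y \<kappa>) x"
        by (intro tendsto_add tendsto_minus fx p(1) q(1))
      ultimately show ?thesis using True by (simp add: S_def)
    next
      case False
      then have sgl: "(\<lambda>n. sgn (?v - k n)) \<longlonglongrightarrow> sgn (?v - \<kappa>)" if "k \<longlonglongrightarrow> \<kappa>" for k :: "nat \<Rightarrow> real"
        using that by (intro tendsto_sgn tendsto_intros) auto
      have "(\<lambda>n. sgn (?v - p n) + sgn (?v - q n)) \<longlonglongrightarrow> sgn (?v - \<kappa>) + sgn (?v - \<kappa>)"
        "(\<lambda>n. S (p n) + S (q n)) \<longlonglongrightarrow> S \<kappa> + S \<kappa>"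
        unfolding S_def by (intro tendsto_add tendsto_mult sgl fx p(1) q(1))+
      then show ?thesis by simp
    qed
    then show "(\<lambda>n. sgn (?v - p n) + sgn (?v - q n)) \<longlonglongrightarrow> 2 * sgn (?v - \<kappa>)"
      "(\<lambda>n. S (p n) + S (q n)) \<longlonglongrightarrow> 2 * S \<kappa>" by auto
  qed
  have "(\<lambda>n. (\<bar>?v - p n\<bar> + \<bar>?v - q n\<bar>) * deriv (\<lambda>s. \<phi> s x) t
      + (entropy_flux f x ?v (p n) + entropy_flux f x ?v (q n)) * deriv (\<lambda>y. \<phi> t y) x
      - (S (p n) + S (q n)) * \<phi> t x + (sgn (?v - p n) + sgn (?v - q n)) * (P_op u t x * \<phi> t x))
    \<longlonglongrightarrow> (\<bar>?v - \<kappa>\<bar> + \<bar>?v - \<kappa>\<bar>) * deriv (\<lambda>s. \<phi> s x) t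
      + (entropy_flux f x ?v \<kappa> + entropy_flux f x ?v \<kappa>) * deriv (\<lambda>y. \<phi> t y) x
      - (2 * S \<kappa>) * \<phi> t x + (2 * sgn (?v - \<kappa>)) * (P_op u t x * \<phi> t x)"
    by (intro tendsto_intros p(1) q(1) fl S sg)
  then show ?thesis
    by (simp add: z entropy_integrand_def eta_def S_def algebra_simps)
qed

lemma entropy_balance_nonneg: "entropy_balance \<phi> \<kappa> \<ge> 0"
proof -
  have level: "\<exists>k. a < k \<and> k < b \<and> (AE z in D. u (fst z) (snd z) \<noteq> k)" if "a < b" for a b
    by (rule generic_level_exists[OF that]) blast
  have "\<exists>p. \<forall>n. \<kappa> < p n \<and> p n < \<kappa> + 1 / real (Suc n) \<and> (AE z in D. u (fst z) (snd z) \<noteq> p n)"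
    by (intro choice allI level) simp
  then obtain p where p: "\<And>n. \<kappa> < p n" "\<And>n. p n < \<kappa> + 1 / real (Suc n)"
    "\<And>n. AE z in D. u (fst z) (snd z) \<noteq> p n" by blast
  have "\<exists>q. \<forall>n. \<kappa> - 1 / real (Suc n) < q n \<and> q n < \<kappa> \<and> (AE z in D. u (fst z) (snd z) \<noteq> q n)"
    by (intro choice allI level) simp
  then obtain q where q: "\<And>n. \<kappa> - 1 / real (Suc n) < q n" "\<And>n. q n < \<kappa>"
    "\<And>n. AE z in D. u (fst z) (snd z) \<noteq> q n" by blast
  have inv: "(\<lambda>n. 1 / real (Suc n)) \<longlonglongrightarrow> 0" using LIMSEQ_inverse_real_of_nat by (simp add: inverse_eq_divide)
  have p_lim: "p \<longlonglongrightarrow> \<kappa>"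
  proof (rule tendsto_sandwich[where f="\<lambda>_. \<kappa>" and h="\<lambda>n. \<kappa> + 1 / real (Suc n)"])
    show "(\<lambda>n. \<kappa> + 1 / real (Suc n)) \<longlonglongrightarrow> \<kappa>" using tendsto_add[OF tendsto_const inv, of \<kappa>] by simp
  qed (use p in \<open>simp_all add: less_imp_le\<close>)
  have q_lim: "q \<longlonglongrightarrow> \<kappa>"
  proof (rule tendsto_sandwich[where h="\<lambda>_. \<kappa>" and f="\<lambda>n. \<kappa> - 1 / real (Suc n)"])
    show "(\<lambda>n. \<kappa> - 1 / real (Suc n)) \<longlonglongrightarrow> \<kappa>" using tendsto_diff[OF tendsto_const inv, of \<kappa>] by simp
  qed (use q in \<open>simp_all add: less_imp_le\<close>)
  define R where "R = \<bar>\<kappa>\<bar> + 1"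
  have one: "1 / real (Suc n) \<le> 1" for n by simp
  have pR: "\<bar>p n\<bar> \<le> R" and qR: "\<bar>q n\<bar> \<le> R" for n
    using p(1,2)[of n] q(1,2)[of n] one[of n] unfolding R_def by linarith+
  obtain C where C: "\<And>k. \<bar>k\<bar> \<le> R \<Longrightarrow> AE z in D. \<bar>entropy_integrand \<phi> k z\<bar> \<le> C"
    using entropy_integrand_bound[of R] by metis
  have int: "integrable D (entropy_integrand \<phi> k)" if "\<bar>k\<bar> \<le> R" for k
    by (rule integrable_bounded_on[OF _ entropy_integrand_measurable C[OF that]]) simp
  have "(\<lambda>n. \<integral>z. entropy_integrand \<phi> (p n) z + entropy_integrand \<phi> (q n) z \<partial>D)
     \<longlonglongrightarrow> (\<integral>z. 2 * entropy_integrand \<phi> \<kappa> z \<partial>D)"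
  proof (rule bounded_convergence_on[where C="C + C"])
    show "AE z in D. (\<lambda>n. entropy_integrand \<phi> (p n) z + entropy_integrand \<phi> (q n) z) \<longlonglongrightarrow> 2 * entropy_integrand \<phi> \<kappa> z"
      using entropy_integrand_symmetric_tendsto[OF p_lim p(1) q_lim q(2)] by simp
    show "AE z in D. \<bar>entropy_integrand \<phi> (p n) z + entropy_integrand \<phi> (q n) z\<bar> \<le> C + C" for n
      using C[OF pR[of n]] C[OF qR[of n]] by eventually_elim linarith
  qed (auto intro!: borel_measurable_add borel_measurable_times entropy_integrand_measurable)
  then have I: "(\<lambda>n. (\<integral>z. entropy_integrand \<phi> (p n) z \<partial>D) + (\<integral>z. entropy_integrand \<phi> (q n) z \<partial>D))
     \<longlonglongrightarrow> 2 * (\<integral>z. entropy_integrand \<phi> \<kappa> z \<partial>D)"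
    by (simp add: Bochner_Integration.integral_add int pR qR)
  let ?b = "\<lambda>k. (\<integral>x. \<bar>u T x - k\<bar> * \<phi> T x \<partial>J) - (\<integral>x. \<bar>u 0 x - k\<bar> * \<phi> 0 x \<partial>J)"
  have b: "(\<lambda>n. ?b (k n)) \<longlonglongrightarrow> ?b \<kappa>" if "k \<longlonglongrightarrow> \<kappa>" "\<And>n. \<bar>k n\<bar> \<le> R" for k
    using T by (intro tendsto_diff boundary_level_tendsto[OF that]) auto
  have "(\<lambda>n. (\<integral>z. entropy_integrand \<phi> (p n) z \<partial>D) + (\<integral>z. entropy_integrand \<phi> (q n) z \<partial>D) - (?b (p n) + ?b (q n)))
     \<longlonglongrightarrow> 2 * (\<integral>z. entropy_integrand \<phi> \<kappa> z \<partial>D) - (?b \<kappa> + ?b \<kappa>)"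
    by (intro tendsto_diff[OF I] tendsto_add b p_lim q_lim pR qR)
  moreover have "0 \<le> (\<integral>z. entropy_integrand \<phi> (p n) z \<partial>D) + (\<integral>z. entropy_integrand \<phi> (q n) z \<partial>D) - (?b (p n) + ?b (q n))" for n
    using entropy_balance_nonneg_generic[OF p(3)[of n]] entropy_balance_nonneg_generic[OF q(3)[of n]]
    unfolding entropy_balance_def by linarith
  ultimately have "0 \<le> 2 * (\<integral>z. entropy_integrand \<phi> \<kappa> z \<partial>D) - (?b \<kappa> + ?b \<kappa>)"
    by (intro LIMSEQ_le_const) auto
  then show ?thesis by (simp add: entropy_balance_def)
qed

end

end

section \<open>Entropy solutions as limits of finite volume approximations\<close>

theorem theorem7:
  fixes T c_f :: real
    and f :: "real \<Rightarrow> real \<Rightarrow> real"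
    and F :: "real \<Rightarrow> real \<Rightarrow> real \<Rightarrow> real"
    and u0 :: "real \<Rightarrow> real"
    and N M :: "nat \<Rightarrow> nat"
    and u :: "real \<Rightarrow> real \<Rightarrow> real"
  assumes "T > 0"
    and "C_k 2 (\<lambda>(x, v). f x v)"
    and "\<And>x v. f (x + 1) v = f x v"
    and "numerical_flux f F"
    and "BV 0 1 u0"
    and "(LINT x:{0..1}|lebesgue. u0 x) = 0"
    and "\<And>k. N k > 0"
    and "\<And>k. M k > 0"
    and "\<And>k. CFL_condition F c_f T (N k) (M k)"
    and "(\<lambda>k. mesh_dx (N k)) \<longlonglongrightarrow> 0"
    and "u \<in> C_L1 T"
    and "uniform_limit {0..T}
           (\<lambda>k t. L1_dist (fv_approx F u0 T (N k) (M k) t) (u t)) (\<lambda>t. 0) sequentially"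
  shows "entropy_solution T f u0 u"
proof (rule BV_cell_averages[OF assms(5)])
  let ?J = "lebesgue_on {0..<1::real}"
  fix K0
  assume u0_int: "integrable ?J u0"
    and init_bd: "\<And>F T N M j. N > 0 \<Longrightarrow> j \<in> {1..N} \<Longrightarrow> \<bar>scheme F u0 T N M 0 j\<bar> \<le> K0"
    and init_err: "\<And>F T N M. N > 0 \<Longrightarrow>
      (\<integral>x. \<bar>scheme F u0 T N M 0 (Suc (cell (mesh_dx N) x)) - u0 x\<bar> \<partial>?J) \<le> mesh_dx N * K0"
  have "K0 \<ge> 0" using order_trans[OF abs_ge_zero init_bd[of 1 1]] by simp
  obtain K where K: "\<And>k n j. n \<le> Suc (M k) \<Longrightarrow> j \<in> {1..N k} \<Longrightarrow> \<bar>scheme F u0 T (N k) (M k) n j\<bar> \<le> K"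
  proof (rule scheme_bounded[where c=c_f and ?u0.0=u0, OF assms(2,4,1) \<open>K0 \<ge> 0\<close>])
    fix K
    assume K: "\<And>N M n j. N > 0 \<Longrightarrow> CFL_condition F c_f T N M \<Longrightarrow>
      (\<And>j. j \<in> {1..N} \<Longrightarrow> \<bar>scheme F u0 T N M 0 j\<bar> \<le> K0) \<Longrightarrow> n \<le> Suc M \<Longrightarrow> j \<in> {1..N} \<Longrightarrow>
      \<bar>scheme F u0 T N M n j\<bar> \<le> K"
    show thesis
      by (rule that) (rule K[OF assms(7,9) init_bd[OF assms(7)]])
  qed
  interpret convergent_approximations T c_f f F u0 N M u K
    by unfold_locales (rule assms K; assumption?)+
  have "(\<integral>x. \<bar>u 0 x - u0 x\<bar> \<partial>?J) \<le> 0"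
  proof (rule LIMSEQ_le_const)
    show "(\<lambda>k. (\<integral>x. \<bar>V k 0 (Suc (xc k x)) - u 0 x\<bar> \<partial>?J) + dx k * K0) \<longlonglongrightarrow> 0"
      using tendsto_add[OF L1_lim_initial tendsto_mult_left_zero[OF assms(10), of K0]] by simp
    have "(\<integral>x. \<bar>u 0 x - u0 x\<bar> \<partial>?J) \<le> (\<integral>x. \<bar>V k 0 (Suc (xc k x)) - u 0 x\<bar> \<partial>?J) + dx k * K0" for k
    proof -
      have int: "integrable ?J (\<lambda>x. V k 0 (Suc (xc k x)))" "integrable ?J (u 0)"
        using grid_integrable[where a="\<lambda>i. V k 0 (Suc i)"] u_integrable T by auto
      have "(\<integral>x. \<bar>u 0 x - u0 x\<bar> \<partial>?J)
         \<le> (\<integral>x. \<bar>V k 0 (Suc (xc k x)) - u 0 x\<bar> + \<bar>V k 0 (Suc (xc k x)) - u0 x\<bar> \<partial>?J)"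
        by (intro integral_mono Bochner_Integration.integrable_add integrable_abs
            Bochner_Integration.integrable_diff int u0_int) auto
      also have "\<dots> = (\<integral>x. \<bar>V k 0 (Suc (xc k x)) - u 0 x\<bar> \<partial>?J) + (\<integral>x. \<bar>V k 0 (Suc (xc k x)) - u0 x\<bar> \<partial>?J)"
        by (intro Bochner_Integration.integral_add integrable_abs Bochner_Integration.integrable_diff int u0_int)
      also have "\<dots> \<le> (\<integral>x. \<bar>V k 0 (Suc (xc k x)) - u 0 x\<bar> \<partial>?J) + dx k * K0"
        using init_err[OF N] by simp
      finally show ?thesis .
    qed
    then show "\<exists>n. \<forall>k\<ge>n. (\<integral>x. \<bar>u 0 x - u0 x\<bar> \<partial>?J) \<le> (\<integral>x. \<bar>V k 0 (Suc (xc k x)) - u 0 x\<bar> \<partial>?J) + dx k * K0"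
      by blast
  qed
  then have "(\<integral>x. \<bar>u 0 x - u0 x\<bar> \<partial>?J) = 0" by (intro antisym integral_nonneg) auto
  then have "AE x in ?J. \<bar>u 0 x - u0 x\<bar> = 0"
    using u_integrable[of 0] u0_int T by (subst (asm) integral_nonneg_eq_0_iff_AE) auto
  then have initial: "AE x in lebesgue. x \<in> {0<..<1} \<longrightarrow> u 0 x = u0 x"
    by (subst (asm) AE_restrict_space_iff) (auto elim!: eventually_mono)
  have "AE p in lebesgue. p \<in> {0..<T} \<times> {0..<1} \<longrightarrow> \<bar>u (fst p) (snd p)\<bar> \<le> K"
    using u_bounded_ae by (subst (asm) AE_restrict_space_iff) (auto simp: fmeasurableD)
  then have "AE (t, x) in lebesgue. (t, x) \<in> Pi_T T \<longrightarrow> \<bar>u t x\<bar> \<le> K"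
    using AE_Pi_T[of T] by eventually_elim auto
  then have L_inf: "u \<in> L_infinity T"
    using u_C_L1 unfolding L_infinity_def C_L1_def by blast
  have "set_lebesgue_integral lebesgue (Pi_T T) (\<lambda>(t, x).
            eta (u t x) k * deriv (\<lambda>s. \<phi> s x) t
          + entropy_flux f x (u t x) k * deriv (\<lambda>y. \<phi> t y) x
          - sgn (u t x - k) * deriv (\<lambda>y. f y k) x * \<phi> t x
          + sgn (u t x - k) * P_op u t x * \<phi> t x)
        - ((LINT x:{0..1}|lebesgue. eta (u T x) k * \<phi> T x)
           - (LINT x:{0..1}|lebesgue. eta (u 0 x) k * \<phi> 0 x)) \<ge> 0"
    if "test_function T \<phi>" for k \<phi>
  proof -
    have "{0..<T} \<times> {0..<1::real} \<in> sets lebesgue" by (simp add: fmeasurableD)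
    note D_eq = set_integral_spike[OF AE_Pi_T this]
    have J_eq: "(LINT x:{0..1}|lebesgue. g x) = integral\<^sup>L ?J g" for g :: "real \<Rightarrow> real"
      by (rule set_integral_spike[OF unit_intervals_ae_eq(2)]) simp
    show ?thesis
      using entropy_balance_nonneg[OF that, of k]
      unfolding entropy_balance_def entropy_integrand_def D_eq J_eq eta_def .
  qed
  then show ?thesis
    unfolding entropy_solution_def using u_C_L1 L_inf initial by blast
qed

end
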